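(* Let $\mathfrak g$ be a stratified Lie algebra whose maximal Tanaka prolongation $\operatorname{Prol}(\mathfrak g,\mathfrak g_0)=\sum_{j=-\ell}^{m}\mathfrak g_j$ is finite-dimensional and satisfies $\mathfrak g_1\neq\{0\}$, and let $G$ be the corresponding Carnot group. Then the Carnot group $H=\mathfrak g^{\mathrm{ab}}\rtimes G$ is rigid. Moreover, let $V\in\mathfrak g_1\setminus\{0\}$ and let $\vec V=\sum_{i=1}^n v_i\tilde X_i$ be the corresponding precontact vector field on $G$. Then the vector field $\tau(\vec V)=\sum_{i=1}^n (v_i\circ\pi)\tilde Y_i$ on $H$ is precontact, its flow $\operatorname{Exp}(t\tau(\vec V))$ is defined on all of $H$ for all $t\in\mathbb R$ and consists of contact maps, and, for every $t\ne0$, the global contact map $\operatorname{Exp}(t\tau(\vec V)):H\to H$ is not quasiconformal (that is, it is not $\lambda$-quasiconformal for any $\lambda\in[1,\infty)$).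
   Context: A stratified Lie algebra of step $\ell$ is a real Lie algebra $\mathfrak g=\mathfrak g_{-1}\oplus\cdots\oplus\mathfrak g_{-\ell}$ with $3\le\dim\mathfrak g<\infty$, $[\mathfrak g_{-j},\mathfrak g_{-1}]=\mathfrak g_{-j-1}$ for $1\le j\le\ell$, $\mathfrak g_{-\ell}\ne\{0\}$, $\mathfrak g_{-\ell-1}=\{0\}$. The associated Carnot group is the connected, simply connected Lie group $G$ with Lie algebra $\mathfrak g$ (viewed as the tangent space at the identity), equipped with its Carnot--Carathéodory distance $\varrho$: fix a scalar product on $\mathfrak g$ with the strata pairwise orthogonal; $\varrho(p,q)$ is the infimum of the lengths of piecewise smooth curves from $p$ to $q$ tangent to the horizontal distribution $p\mapsto(L_p)_*\mathfrak g_{-1}$, with respect to the left-invariant inner product induced from $\mathfrak g_{-1}$. For $s>0$, $\delta_s$ is the automorphism of $\mathfrak g$ acting as $s^j$ on $\mathfrak g_{-j}$, and also the corresponding automorphism of $G$. Let $n_k=\sum_{j\le k}\dim\mathfrak g_{-j}$ ($n_0=0$), $n=\dim\mathfrak g$, and let $\{X_1,\dots,X_n\}$ be a basis of $\mathfrak g$ such that $X_{n_{k-1}+1},\dots,X_{n_k}$ is a basis of $\mathfrak g_{-k}$ for each $k$; write $[X_i,X_j]=\sum_k c_{ij}^kX_k$. Let $\mathfrak h=\mathfrak g^{\mathrm{ab}}\rtimes\mathfrak g$ be the Lie algebra with basis $\{Y_1,\dots,Y_n,Z_1,\dots,Z_n\}$ and brackets $[Y_i,Y_j]=0$, $[Y_i,Z_j]=\sum_kc_{ij}^kY_k$,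 $[Z_i,Z_j]=\sum_kc_{ij}^kZ_k$, stratified by $\mathfrak h_{-k}=\operatorname{span}\{Y_i,Z_i:n_{k-1}<i\le n_k\}$. Its connected simply connected group is $H=\mathfrak g^{\mathrm{ab}}\rtimes G$, with elements $(Y,z)$, $Y\in\mathfrak g^{\mathrm{ab}}=\operatorname{span}\{Y_i\}$, $z\in G$, product $(Y,z)(Y',z')=(Y+\operatorname{Ad}(z)Y',zz')$, and projection $\pi(Y,z)=z$. For $X$ in the Lie algebra, $\tilde X$ denotes the left-invariant vector field equal to $X$ at the identity. Prolongation: let $\mathfrak g_0$ be the Lie algebra of derivations of $\mathfrak g$ mapping each $\mathfrak g_{-j}$ into itself. $\operatorname{Prol}(\mathfrak g,\mathfrak g_0)=\bigoplus_{i\ge-\ell}\mathfrak g_i$ is the maximal graded Lie algebra with negative part $\mathfrak g$ and degree-zero part $\mathfrak g_0$ such that $U\in\mathfrak g_k$, $k\ge0$, $[U,\mathfrak g_{-1}]=0$ imply $U=0$; concretely, for $k\ge1$, $\mathfrak g_k$ is the space of linear maps $u:\mathfrak g\to\bigoplus_{i<k}\mathfrak g_i$ with $u(\mathfrak g_{-j})\subseteq\mathfrak g_{k-j}$ and $u([X,Y])=[u(X),Y]+[X,u(Y)]$. A Carnot group is rigid if this prolongation of its Lie algebra is finite-dimensional. Contact: a $C^2$ map is contact if its differential maps the horizontal distribution into itself. A vector field is precontact if its (local) flow consists of contact maps; equivalently its bracket with every horizontal vector field is horizontal. When $G$ is rigid there is a graded isomorphism between $\operatorname{Prol}(\mathfrak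 g,\mathfrak g_0)$ and the Lie algebra of all precontact vector fields on $G$ (which are all polynomial), with $\mathfrak g_k$ corresponding to the precontact vector fields that are homogeneous of degree $k$, i.e. $(\delta_s)_*(\vec V_p)=s^{-k}\vec V_{\delta_sp}$ for all $s>0$, $p\in G$. $\operatorname{Exp}(t\vec V)$ denotes the flow of $\vec V$ at time $t$. Quasiconformality: a homeomorphism $f$ of a Carnot group is $\lambda$-quasiconformal if $\limsup_{s\to0+}H(f,p,s)\le\lambda$ for all points $p$, where $H(f,p,s)=\sup\{\varrho(f(x),f(p)):\varrho(x,p)=s\}\,/\,\inf\{\varrho(f(x),f(p)):\varrho(x,p)=s\}$. *)

theory Defs
  imports "HOL-Analysis.Analysis" "HOL-Algebra.Group"
begin

section \<open>Smooth maps\<close>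

fun C_k :: "nat \<Rightarrow> ('a::real_normed_vector \<Rightarrow> 'b::real_normed_vector) \<Rightarrow> bool" where
  "C_k 0 f \<longleftrightarrow> continuous_on UNIV f"
| "C_k (Suc k) f \<longleftrightarrow>
     (\<forall>x. f differentiable (at x)) \<and> (\<forall>v. C_k k (\<lambda>x. frechet_derivative f (at x) v))"

definition smooth :: "('a::real_normed_vector \<Rightarrow> 'b::real_normed_vector) \<Rightarrow> bool" where
  "smooth f \<longleftrightarrow> (\<forall>k. C_k k f)"

section \<open>Stratified Lie algebras\<close>

definition lie_algebra :: "('a::real_vector \<Rightarrow> 'a \<Rightarrow> 'a) \<Rightarrow> bool" where
  "lie_algebra brk \<longleftrightarrow>
     (\<forall>X. linear (brk X)) \<and> (\<forall>Y. linear (\<lambda>X. brk X Y)) \<and> (\<forall>X. brk X X = 0) \<and>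
     (\<forall>X Y Z. brk X (brk Y Z) + brk Y (brk Z X) + brk Z (brk X Y) = 0)"

text \<open>The underlying space of the Lie algebra is a whole type of class \<open>euclidean_space\<close>; its
  built-in inner product is only used for the topology. The stratum with index \<open>-j\<close> is \<open>V j\<close>.\<close>

definition stratified_lie_algebra ::
    "('a::euclidean_space \<Rightarrow> 'a \<Rightarrow> 'a) \<Rightarrow> (nat \<Rightarrow> 'a set) \<Rightarrow> nat \<Rightarrow> bool" where
  "stratified_lie_algebra brk V l \<longleftrightarrow>
     lie_algebra brk \<and> 3 \<le> DIM('a) \<and> 1 \<le> l \<and>
     (\<forall>j\<in>{1..l}. subspace (V j)) \<and>
     (\<forall>X. \<exists>!x. (\<forall>j\<in>{1..l}. x j \<in> V j) \<and> (\<forall>j. j \<notin> {1..l} \<longrightarrow> x j = 0) \<and> X = (\<Sum>j=1..l. x j)) \<and>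
     (\<forall>j\<in>{1..l}. span {brk X Y | X Y. X \<in> V j \<and> Y \<in> V 1} = V (Suc j)) \<and>
     V l \<noteq> {0} \<and> V (Suc l) = {0}"

definition adapted_basis :: "(nat \<Rightarrow> 'a::euclidean_space set) \<Rightarrow> nat \<Rightarrow> (nat \<Rightarrow> 'a) \<Rightarrow> bool" where
  "adapted_basis V l X \<longleftrightarrow>
     (\<forall>k\<in>{1..l}. let I = {(\<Sum>j=1..k-1. dim (V j))<..(\<Sum>j=1..k. dim (V j))} in
        inj_on X I \<and> independent (X ` I) \<and> span (X ` I) = V k)"

section \<open>Tanaka prolongation\<close>

text \<open>An element \<open>U\<close> of the prolongation is encoded by the function
  \<open>u :: 'a list \<Rightarrow> 'a\<close> sending \<open>[X1, \<dots>, Xr]\<close> to the component in the negative part of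
  \<open>[\<dots>[[U, X1], X2], \<dots>, Xr]\<close>. In particular \<open>u []\<close> is the negative component of \<open>U\<close> itself,
  and \<open>\<lambda>xs. u (X # xs)\<close> encodes \<open>[U, X]\<close>, which is \<open>U(X)\<close> when \<open>U\<close> has nonnegative
  degree, i.e. is a linear map on the negative part. An element \<open>X\<close> of the negative part
  becomes \<open>\<lambda>xs. foldl brk X xs\<close>. The encoding is injective because elements of nonnegative
  degree are linear maps, and vector space operations are pointwise.

  \<open>prol brk V l k u\<close> says that \<open>u\<close> encodes an element of degree \<open>k\<close>. For \<open>k = 0\<close> the clause
  \<open>nonneg\<close> describes exactly the derivations preserving the strata, and for \<open>k \<ge> 1\<close> it is the
  inductive description of the higher degrees; the derivation rule reads
  \<open>u([X,Y]) = [u(X),Y] - [u(Y),X]\<close>.\<close>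

inductive prol ::
    "('a::real_vector \<Rightarrow> 'a \<Rightarrow> 'a) \<Rightarrow> (nat \<Rightarrow> 'a set) \<Rightarrow> nat \<Rightarrow> int \<Rightarrow> ('a list \<Rightarrow> 'a) \<Rightarrow> bool"
  for brk V l where
  neg: "1 \<le> j \<Longrightarrow> j \<le> l \<Longrightarrow> X \<in> V j \<Longrightarrow> prol brk V l (- int j) (\<lambda>xs. foldl brk X xs)"
| nonneg: "0 \<le> k \<Longrightarrow> u [] = 0 \<Longrightarrow>
     (\<forall>xs. linear (\<lambda>X. u (X # xs))) \<Longrightarrow>
     (\<forall>j X. 1 \<le> j \<and> j \<le> l \<and> X \<in> V j \<longrightarrow> prol brk V l (k - int j) (\<lambda>xs. u (X # xs))) \<Longrightarrow>
     (\<forall>X Y xs. u (brk X Y # xs) = u (X # Y # xs) - u (Y # X # xs)) \<Longrightarrow>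
     prol brk V l k u"

definition prol_space ::
    "('a::real_vector \<Rightarrow> 'a \<Rightarrow> 'a) \<Rightarrow> (nat \<Rightarrow> 'a set) \<Rightarrow> nat \<Rightarrow> ('a list \<Rightarrow> 'a) set" where
  "prol_space brk V l =
     {\<lambda>xs. \<Sum>i\<in>I. w i xs | I w. finite I \<and> (\<forall>i\<in>I. prol brk V l i (w i))}"

definition prol_finite_dim ::
    "('a::real_vector \<Rightarrow> 'a \<Rightarrow> 'a) \<Rightarrow> (nat \<Rightarrow> 'a set) \<Rightarrow> nat \<Rightarrow> bool" where
  "prol_finite_dim brk V l \<longleftrightarrow>
     (\<exists>B. finite B \<and> (\<forall>u\<in>prol_space brk V l. \<exists>c. u = (\<lambda>xs. \<Sum>b\<in>B. c b *\<^sub>R b xs)))"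

text \<open>The Lie bracket of the prolongation in this encoding. The second equation is the Jacobi
  identity \<open>[[U,W],X] = [[U,X],W] + [U,[W,X]]\<close>. For the first, split \<open>U\<close> and \<open>W\<close> into their
  negative components \<open>X\<close>, \<open>Y\<close> and nonnegative parts \<open>U'\<close>, \<open>W'\<close>: the negative component of
  \<open>[U,W]\<close> is that of \<open>[X,Y] + U'(Y) - W'(X)\<close>, that is of \<open>[U,Y] - [W,X] - [X,Y]\<close>.\<close>

fun prol_bracket ::
    "('a::real_vector \<Rightarrow> 'a \<Rightarrow> 'a) \<Rightarrow> ('a list \<Rightarrow> 'a) \<Rightarrow> ('a list \<Rightarrow> 'a) \<Rightarrow> 'a list \<Rightarrow> 'a" where
  "prol_bracket brk u w [] = u [w []] - w [u []] - brk (u []) (w [])"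
| "prol_bracket brk u w (X # xs) =
     prol_bracket brk (\<lambda>ys. u (X # ys)) w xs + prol_bracket brk u (\<lambda>ys. w (X # ys)) xs"

lemma prol_bracket_right_negative:
  assumes "lie_algebra brk"
    and "\<And>ys X Y xs. u (ys @ brk X Y # xs) = u (ys @ X # Y # xs) - u (ys @ Y # X # xs)"
  shows "prol_bracket brk u (\<lambda>xs. foldl brk X xs) xs = u (X # xs)"
  using assms(2)
proof (induction xs arbitrary: u X)
  case Nil
  have "brk A B + brk B A = 0" for A B
  proof -
    have lin: "linear (brk A)" "linear (brk B)" "linear (\<lambda>Z. brk Z (A + B))"
      and alt: "\<And>Z. brk Z Z = 0"
      using assms(1) by (auto simp: lie_algebra_def)
    have "0 = brk A (A + B) + brk B (A + B)"
      using linear_add[OF lin(3), of A B] alt[of "A + B"] by simp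
    also have "\<dots> = brk A B + brk B A"
      using linear_add[OF lin(1), of A B] linear_add[OF lin(2), of A B] alt by simp
    finally show ?thesis by simp
  qed
  then show ?case by (simp add: algebra_simps)
next
  case (Cons Z xs)
  have "prol_bracket brk (\<lambda>ys. u (Z # ys)) (foldl brk X) xs = u (Z # X # xs)"
    using Cons.IH[of "\<lambda>ys. u (Z # ys)" X] Cons.prems[of "Z # _"] by simp
  moreover have "prol_bracket brk u (foldl brk (brk X Z)) xs = u (brk X Z # xs)"
    using Cons.IH[of u "brk X Z"] Cons.prems by simp
  ultimately show ?case
    using Cons.prems[of "[]" X Z xs] by simp
qed

section \<open>Carnot groups\<close>

text \<open>The exponential map of a connected, simply connected nilpotent Lie group is a
  diffeomorphism, so the manifold underlying a Carnot group is taken to be a Euclidean space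
  (which is connected and simply connected), all tangent spaces being identified with that
  space. The group law is arbitrary smooth, not necessarily in exponential coordinates.
  A vector field is a map \<open>'a \<Rightarrow> 'a\<close>.\<close>

definition left_inv_field :: "('a::euclidean_space) monoid \<Rightarrow> 'a \<Rightarrow> 'a \<Rightarrow> 'a" where
  "left_inv_field G X p = frechet_derivative (\<lambda>q. p \<otimes>\<^bsub>G\<^esub> q) (at \<one>\<^bsub>G\<^esub>) X"

definition left_trivialize :: "('a::euclidean_space) monoid \<Rightarrow> 'a \<Rightarrow> 'a \<Rightarrow> 'a" where
  "left_trivialize G p \<xi> = frechet_derivative (\<lambda>q. inv\<^bsub>G\<^esub> p \<otimes>\<^bsub>G\<^esub> q) (at p) \<xi>"

definition vf_bracket ::
    "('a::real_normed_vector \<Rightarrow> 'a) \<Rightarrow> ('a \<Rightarrow> 'a) \<Rightarrow> 'a \<Rightarrow> 'a" where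
  "vf_bracket W W' p =
     frechet_derivative W' (at p) (W p) - frechet_derivative W (at p) (W' p)"

definition lie_group :: "('a::euclidean_space) monoid \<Rightarrow> bool" where
  "lie_group G \<longleftrightarrow> group G \<and> carrier G = UNIV \<and>
     smooth (\<lambda>(p, q). p \<otimes>\<^bsub>G\<^esub> q) \<and> smooth (\<lambda>p. inv\<^bsub>G\<^esub> p)"

definition carnot_group ::
    "('a::euclidean_space) monoid \<Rightarrow> ('a \<Rightarrow> 'a \<Rightarrow> 'a) \<Rightarrow> (nat \<Rightarrow> 'a set) \<Rightarrow> nat \<Rightarrow> bool" where
  "carnot_group G brk V l \<longleftrightarrow> stratified_lie_algebra brk V l \<and> lie_group G \<and>
     (\<forall>X Y. vf_bracket (left_inv_field G X) (left_inv_field G Y) \<one>\<^bsub>G\<^esub> = brk X Y)"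

definition rigid ::
    "('a::euclidean_space) monoid \<Rightarrow> ('a \<Rightarrow> 'a \<Rightarrow> 'a) \<Rightarrow> (nat \<Rightarrow> 'a set) \<Rightarrow> nat \<Rightarrow> bool" where
  "rigid G brk V l \<longleftrightarrow> carnot_group G brk V l \<and> prol_finite_dim brk V l"

section \<open>Contact maps and precontact vector fields\<close>

text \<open>In this section and the next, \<open>V1\<close> is the first stratum of the Lie algebra of \<open>G\<close>.\<close>

definition horizontal :: "('a::euclidean_space) monoid \<Rightarrow> 'a set \<Rightarrow> 'a \<Rightarrow> 'a set" where
  "horizontal G V1 p = (\<lambda>X. left_inv_field G X p) ` V1"

definition contact_map :: "('a::euclidean_space) monoid \<Rightarrow> 'a set \<Rightarrow> ('a \<Rightarrow> 'a) \<Rightarrow> bool" where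
  "contact_map G V1 f \<longleftrightarrow> C_k 2 f \<and>
     (\<forall>p. frechet_derivative f (at p) ` horizontal G V1 p \<subseteq> horizontal G V1 (f p))"

definition precontact :: "('a::euclidean_space) monoid \<Rightarrow> 'a set \<Rightarrow> ('a \<Rightarrow> 'a) \<Rightarrow> bool" where
  "precontact G V1 W \<longleftrightarrow> smooth W \<and>
     (\<forall>E. smooth E \<and> (\<forall>p. E p \<in> horizontal G V1 p) \<longrightarrow>
        (\<forall>p. vf_bracket W E p \<in> horizontal G V1 p))"

definition integral_curve :: "('a::real_normed_vector \<Rightarrow> 'a) \<Rightarrow> 'a \<Rightarrow> (real \<Rightarrow> 'a) \<Rightarrow> bool" where
  "integral_curve W p \<gamma> \<longleftrightarrow>
     \<gamma> 0 = p \<and> (\<forall>t. (\<gamma> has_vector_derivative W (\<gamma> t)) (at t))"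

definition complete_vf :: "('a::real_normed_vector \<Rightarrow> 'a) \<Rightarrow> bool" where
  "complete_vf W \<longleftrightarrow> (\<forall>p. \<exists>\<gamma>. integral_curve W p \<gamma>)"

text \<open>\<open>Exp (t W)\<close>, meaningful for complete smooth fields, whose integral curves are unique.\<close>

definition vf_Exp :: "real \<Rightarrow> ('a::real_normed_vector \<Rightarrow> 'a) \<Rightarrow> 'a \<Rightarrow> 'a" where
  "vf_Exp t W p = (THE q. \<exists>\<gamma>. integral_curve W p \<gamma> \<and> \<gamma> t = q)"

definition algebra_dilation ::
    "(nat \<Rightarrow> 'a::real_vector set) \<Rightarrow> nat \<Rightarrow> real \<Rightarrow> ('a \<Rightarrow> 'a) \<Rightarrow> bool" where
  "algebra_dilation V l s D \<longleftrightarrow> linear D \<and> (\<forall>j\<in>{1..l}. \<forall>X\<in>V j. D X = s ^ j *\<^sub>R X)"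

text \<open>The dilation of the group is its automorphism with differential at the identity equal to
  the dilation of the algebra; it exists and is unique since \<open>G\<close> is connected and simply
  connected.\<close>

definition group_dilation ::
    "('a::euclidean_space) monoid \<Rightarrow> (nat \<Rightarrow> 'a set) \<Rightarrow> nat \<Rightarrow> real \<Rightarrow> ('a \<Rightarrow> 'a) \<Rightarrow> bool" where
  "group_dilation G V l s \<delta> \<longleftrightarrow> \<delta> \<in> iso G G \<and> smooth \<delta> \<and>
     algebra_dilation V l s (frechet_derivative \<delta> (at \<one>\<^bsub>G\<^esub>))"

definition homogeneous_vf ::
    "('a::euclidean_space) monoid \<Rightarrow> (nat \<Rightarrow> 'a set) \<Rightarrow> nat \<Rightarrow> int \<Rightarrow> ('a \<Rightarrow> 'a) \<Rightarrow> bool" where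
  "homogeneous_vf G V l k W \<longleftrightarrow>
     (\<forall>s>0. \<exists>\<delta>. group_dilation G V l s \<delta> \<and>
        (\<forall>p. frechet_derivative \<delta> (at p) (W p) = (s powi (- k)) *\<^sub>R W (\<delta> p)))"

text \<open>A graded Lie algebra isomorphism from the prolongation onto the precontact fields. One is
  \<open>U \<mapsto> - W\<close>, where \<open>W p\<close> is the left translate to \<open>p\<close> of the negative component of
  \<open>Ad(inv p) U\<close> (the sign because right-invariant fields satisfy
  \<open>[R X, R Y] = - R [X,Y]\<close>).\<close>

definition prol_field_iso ::
    "('a::euclidean_space) monoid \<Rightarrow> ('a \<Rightarrow> 'a \<Rightarrow> 'a) \<Rightarrow> (nat \<Rightarrow> 'a set) \<Rightarrow> nat \<Rightarrow>
     (('a list \<Rightarrow> 'a) \<Rightarrow> ('a \<Rightarrow> 'a)) \<Rightarrow> bool" where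
  "prol_field_iso G brk V l \<Phi> \<longleftrightarrow>
     bij_betw \<Phi> (prol_space brk V l) {W. precontact G (V 1) W} \<and>
     (\<forall>u\<in>prol_space brk V l. \<forall>w\<in>prol_space brk V l. \<forall>a b.
        \<Phi> (\<lambda>xs. a *\<^sub>R u xs + b *\<^sub>R w xs) = (\<lambda>p. a *\<^sub>R \<Phi> u p + b *\<^sub>R \<Phi> w p)) \<and>
     (\<forall>u\<in>prol_space brk V l. \<forall>w\<in>prol_space brk V l.
        \<Phi> (prol_bracket brk u w) = vf_bracket (\<Phi> u) (\<Phi> w)) \<and>
     (\<forall>k\<ge>- int l. \<Phi> ` {u. prol brk V l k u} =
        {W. precontact G (V 1) W \<and> homogeneous_vf G V l k W})"

section \<open>Carnot--Caratheodory distance and quasiconformality\<close>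

text \<open>\<open>ip\<close> is a scalar product on the Lie algebra.\<close>

definition adapted_scalar_product ::
    "(nat \<Rightarrow> 'a::euclidean_space set) \<Rightarrow> nat \<Rightarrow> ('a \<Rightarrow> 'a \<Rightarrow> real) \<Rightarrow> bool" where
  "adapted_scalar_product V l ip \<longleftrightarrow>
     bilinear ip \<and> (\<forall>X Y. ip X Y = ip Y X) \<and> (\<forall>X. X \<noteq> 0 \<longrightarrow> 0 < ip X X) \<and>
     (\<forall>i\<in>{1..l}. \<forall>j\<in>{1..l}. i \<noteq> j \<longrightarrow> (\<forall>X\<in>V i. \<forall>Y\<in>V j. ip X Y = 0))"

text \<open>Piecewise smooth: smooth up to the endpoints on every closed interval between consecutive
  points of a finite exceptional set \<open>S\<close>.\<close>

definition horizontal_curve :: "('a::euclidean_space) monoid \<Rightarrow> 'a set \<Rightarrow> (real \<Rightarrow> 'a) \<Rightarrow> bool" where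
  "horizontal_curve G V1 \<gamma> \<longleftrightarrow> path \<gamma> \<and>
     (\<exists>S. finite S \<and>
        (\<forall>a b. 0 \<le> a \<and> a < b \<and> b \<le> 1 \<and> {a<..<b} \<inter> S = {} \<longrightarrow>
           (\<exists>g. smooth g \<and> (\<forall>t\<in>{a..b}. \<gamma> t = g t))) \<and>
        (\<forall>t\<in>{0<..<1} - S. vector_derivative \<gamma> (at t) \<in> horizontal G V1 (\<gamma> t)))"

definition curve_length ::
    "('a::euclidean_space) monoid \<Rightarrow> ('a \<Rightarrow> 'a \<Rightarrow> real) \<Rightarrow> (real \<Rightarrow> 'a) \<Rightarrow> real" where
  "curve_length G ip \<gamma> =
     integral {0..1} (\<lambda>t. let \<omega> = left_trivialize G (\<gamma> t) (vector_derivative \<gamma> (at t))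
                          in sqrt (ip \<omega> \<omega>))"

definition cc_dist ::
    "('a::euclidean_space) monoid \<Rightarrow> 'a set \<Rightarrow> ('a \<Rightarrow> 'a \<Rightarrow> real) \<Rightarrow> 'a \<Rightarrow> 'a \<Rightarrow> ennreal" where
  "cc_dist G V1 ip p q =
     (INF \<gamma>\<in>{\<gamma>. horizontal_curve G V1 \<gamma> \<and> pathstart \<gamma> = p \<and> pathfinish \<gamma> = q}.
        ennreal (curve_length G ip \<gamma>))"

definition distortion ::
    "('a::euclidean_space) monoid \<Rightarrow> 'a set \<Rightarrow> ('a \<Rightarrow> 'a \<Rightarrow> real) \<Rightarrow> ('a \<Rightarrow> 'a) \<Rightarrow> 'a \<Rightarrow> real \<Rightarrow> ennreal"
  where
  "distortion G V1 ip f p s =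
     (SUP x\<in>{x. cc_dist G V1 ip x p = ennreal s}. cc_dist G V1 ip (f x) (f p)) /
     (INF x\<in>{x. cc_dist G V1 ip x p = ennreal s}. cc_dist G V1 ip (f x) (f p))"

definition quasiconformal ::
    "('a::euclidean_space) monoid \<Rightarrow> 'a set \<Rightarrow> ('a \<Rightarrow> 'a \<Rightarrow> real) \<Rightarrow> real \<Rightarrow> ('a \<Rightarrow> 'a) \<Rightarrow> bool" where
  "quasiconformal G V1 ip K f \<longleftrightarrow>
     (\<exists>g. homeomorphism UNIV UNIV f g) \<and>
     (\<forall>p. Limsup (at_right 0) (\<lambda>s. distortion G V1 ip f p s) \<le> ennreal K)"

section \<open>The semidirect product\<close>

text \<open>The pair \<open>(Y, Z)\<close> stands for the sum of \<open>Y\<close> in the abelianized copy of the algebra and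
  \<open>Z\<close> in the algebra itself: \<open>Y i = (X i, 0)\<close> and \<open>Z i = (0, X i)\<close> for an adapted basis
  \<open>X\<close>, cf. the following lemma.\<close>

definition semidirect_bracket ::
    "('a::real_vector \<Rightarrow> 'a \<Rightarrow> 'a) \<Rightarrow> 'a \<times> 'a \<Rightarrow> 'a \<times> 'a \<Rightarrow> 'a \<times> 'a" where
  "semidirect_bracket brk = (\<lambda>(Y, Z) (Y', Z'). (brk Y Z' + brk Z Y', brk Z Z'))"

lemma semidirect_bracket_basis:
  assumes "lie_algebra brk"
  shows "semidirect_bracket brk (A, 0) (B, 0) = 0"
    and "semidirect_bracket brk (A, 0) (0, B) = (brk A B, 0)"
    and "semidirect_bracket brk (0, A) (0, B) = (0, brk A B)"
proof -
  have "brk A 0 = 0" "brk 0 A = 0" for A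
    using assms linear_0 unfolding lie_algebra_def by blast+
  then show "semidirect_bracket brk (A, 0) (B, 0) = 0"
    and "semidirect_bracket brk (A, 0) (0, B) = (brk A B, 0)"
    and "semidirect_bracket brk (0, A) (0, B) = (0, brk A B)"
    by (simp_all add: semidirect_bracket_def zero_prod_def)
qed

definition semidirect_strata :: "(nat \<Rightarrow> 'a set) \<Rightarrow> nat \<Rightarrow> ('a \<times> 'a) set" where
  "semidirect_strata V k = V k \<times> V k"

definition Ad :: "('a::euclidean_space) monoid \<Rightarrow> 'a \<Rightarrow> 'a \<Rightarrow> 'a" where
  "Ad G z Y = frechet_derivative (\<lambda>q. z \<otimes>\<^bsub>G\<^esub> q \<otimes>\<^bsub>G\<^esub> inv\<^bsub>G\<^esub> z) (at \<one>\<^bsub>G\<^esub>) Y"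

definition semidirect_group :: "('a::euclidean_space) monoid \<Rightarrow> ('a \<times> 'a) monoid" where
  "semidirect_group G =
     \<lparr>carrier = UNIV,
      mult = (\<lambda>(Y, z) (Y', z'). (Y + Ad G z Y', z \<otimes>\<^bsub>G\<^esub> z')),
      one = (0, \<one>\<^bsub>G\<^esub>)\<rparr>"

text \<open>\<open>tau_field G X v\<close> is the field on the semidirect product obtained from the field on \<open>G\<close>
  with coefficients \<open>v 1, \<dots>, v n\<close> in the left-invariant frame of the basis \<open>X\<close>.\<close>

definition tau_field ::
    "('a::euclidean_space) monoid \<Rightarrow> (nat \<Rightarrow> 'a) \<Rightarrow> (nat \<Rightarrow> 'a \<Rightarrow> real) \<Rightarrow> 'a \<times> 'a \<Rightarrow> 'a \<times> 'a" where
  "tau_field G X v h =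
     (\<Sum>i=1..DIM('a). (v i \<circ> snd) h *\<^sub>R left_inv_field (semidirect_group G) (X i, 0) h)"

end

(* The Lie algebra h is g tensored with the dual numbers R[eps], and H is the tangent group of G.

   Finiteness of Prol(h): contracting an element u of Prol(h) with elements of eps g and then
   restricting to words in g gives elements of Prol(g), so u can only be large in degree if many
   contractions with eps g do not vanish. Let T be the derivation of h that sends Z in g of degree -j to
   j eps Z and kills eps g. On elements of negative degree T acts with square zero, hence a high power of
   T sends every u to an element vanishing on words in g. Since [T, ad Z] = j ad (eps Z), each
   factor of T can then be traded for a contraction with an element of eps g. So a bounded number
   of such contractions is zero, and Prol(h) vanishes in large degree.

   The flow of tau(V) is the shear (Y, z) -> (Y + t F z, z), where F is the right trivialization of
   the field on G. The mixed derivatives of a z b in a and b show that the derivative of F along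
   the left-invariant horizontal field of B is Ad z C(z, B) with C(z, B) horizontal. The shear thus
   maps the horizontal direction (A, B) to (A + t C(z, B), B). As V has degree 1, C(., B) scales
   linearly under dilations; it is not identically zero, because otherwise F would be constant and
   homogeneity would force it to vanish. So the linear distortion of the shear is unbounded.
   Distances are compared exactly by means of horizontal lines and the abelianization of H,
   which is 1-Lipschitz for the norm on the first stratum. *)

theory Submission
  imports Defs "HOL-Library.Function_Algebras"
begin

section \<open>Graded Lie algebras\<close>

text \<open>An element of Prol(h) might be nonzero only on words with many letters from eps g, and
  restriction to words in g does not see these. Words are therefore organised by the number of such
  letters: [g, eps g] lies in eps g, so sorting a word never changes that number. The exponent of T
  comes from a dichotomy with a degree bound m for Prol(g). An element of degree k < N - 2 is killed
  by the N-th power of T, because each letter has degree at least one and T squares to zero on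
  negative elements; an element of degree k > m vanishes on words in g anyway. So N0 = m + 3 serves
  all degrees at once, and Prol(h) vanishes above m + N0 l.

  On the geometric side, the estimate at one fixed point gives only a finite lower bound for the
  distortion, so the base point must be moved by a dilation that depends on K. The distortion
  compares points at exactly equal distance from the centre, which is why exact distances are
  computed for the two test points; for their images an upper bound for one and a lower bound for
  the other suffice.\<close>

locale stratified =
  fixes brk :: "'a::euclidean_space \<Rightarrow> 'a \<Rightarrow> 'a" and V :: "nat \<Rightarrow> 'a set" and l :: nat
  assumes stratified: "stratified_lie_algebra brk V l"
begin

lemma lie: "lie_algebra brk"
  using stratified unfolding stratified_lie_algebra_def by blast

lemma linear_brk_right: "linear (brk X)" and linear_brk_left: "linear (\<lambda>X. brk X Y)"
  and brk_self [simp]: "brk X X = 0"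
  and jacobi_cyclic: "brk X (brk Y Z) + brk Y (brk Z X) + brk Z (brk X Y) = 0"
  using lie unfolding lie_algebra_def by blast+

lemmas brk_linear_simps =
  linear_add[OF linear_brk_right] linear_add[OF linear_brk_left]
  linear_diff[OF linear_brk_right] linear_diff[OF linear_brk_left]
  linear_neg[OF linear_brk_right] linear_neg[OF linear_brk_left]
  linear_scale[OF linear_brk_right] linear_scale[OF linear_brk_left]

lemma brk_0 [simp]: "brk X 0 = 0" "brk 0 X = 0"
  using linear_0[OF linear_brk_right] linear_0[OF linear_brk_left] by blast+

lemma brk_antisym: "brk X Y = - brk Y X"
proof -
  have "0 = brk (X + Y) (X + Y)" by simp
  also have "\<dots> = brk X Y + brk Y X"
    unfolding brk_linear_simps(1,2) by simp
  finally show ?thesis by (simp add: eq_neg_iff_add_eq_0)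
qed

lemma jacobi: "brk X (brk Y Z) = brk (brk X Y) Z + brk Y (brk X Z)"
  using jacobi_cyclic[of X Y Z] brk_antisym[of Z "brk X Y"] brk_antisym[of Z X]
  by (simp add: brk_linear_simps algebra_simps)

text \<open>Nothing is assumed about \<open>V 0\<close> or about \<open>V j\<close> for j > l + 1.
  Indexing by all integers, with {0} outside 1..l, makes the grading compatible with brackets
  without side conditions.\<close>

definition S :: "int \<Rightarrow> 'a set" where
  "S i = (if 1 \<le> i \<and> i \<le> int l then V (nat i) else {0})"

lemma subspace_V: "j \<in> {1..l} \<Longrightarrow> subspace (V j)" and l_ge_1: "1 \<le> l"
  using stratified unfolding stratified_lie_algebra_def by blast+

lemma subspace_S: "subspace (S i)"
  using subspace_V[of "nat i"] unfolding S_def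
  by (cases "1 \<le> i \<and> i \<le> int l") (auto simp: Suc_le_eq nat_le_iff)

lemmas S_0 [simp] = subspace_0[OF subspace_S]

lemma S_1: "S 1 = V 1"
  using l_ge_1 unfolding S_def by simp

lemma S_nat: "j \<in> {1..l} \<Longrightarrow> S (int j) = V j"
  unfolding S_def by auto

definition decomposition :: "'a \<Rightarrow> nat \<Rightarrow> 'a" where
  "decomposition X = (THE x. (\<forall>j\<in>{1..l}. x j \<in> V j) \<and> (\<forall>j. j \<notin> {1..l} \<longrightarrow> x j = 0) \<and> X = (\<Sum>j=1..l. x j))"

definition component :: "nat \<Rightarrow> 'a \<Rightarrow> 'a" where "component j X = decomposition X j"

lemma decomposition_ex1:
  "\<exists>!x. (\<forall>j\<in>{1..l}. x j \<in> V j) \<and> (\<forall>j. j \<notin> {1..l} \<longrightarrow> x j = 0) \<and> X = (\<Sum>j=1..l. x j)"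
  using stratified unfolding stratified_lie_algebra_def by blast

lemma component_props:
  "\<forall>j\<in>{1..l}. component j X \<in> V j" "\<forall>j. j \<notin> {1..l} \<longrightarrow> component j X = 0"
  "X = (\<Sum>j=1..l. component j X)"
  using theI'[OF decomposition_ex1[of X]] unfolding component_def decomposition_def by blast+

lemma component_unique:
  assumes "\<And>j. j \<in> {1..l} \<Longrightarrow> x j \<in> V j" "\<And>j. j \<notin> {1..l} \<Longrightarrow> x j = 0" "X = (\<Sum>j=1..l. x j)"
  shows "component j X = x j"
proof -
  have "(\<lambda>j. component j X) = x"
    using decomposition_ex1[of X] component_props[of X] assms by (metis (no_types, lifting))
  then show ?thesis by metis
qed

lemma component_in_S: "component j X \<in> S (int j)"
  using component_props[of X] unfolding S_def by (cases "j \<in> {1..l}") auto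

lemma linear_component: "linear (component j)"
proof (rule linearI)
  have sub: "\<forall>j\<in>{1..l}. subspace (V j)"
    using subspace_V by blast
  fix X Y show "component j (X + Y) = component j X + component j Y"
    by (rule component_unique)
      (use component_props(1,2) component_props(3)[of X] component_props(3)[of Y] sub in
        \<open>auto intro: subspace_add simp: sum.distrib\<close>)
next
  have sub: "\<forall>j\<in>{1..l}. subspace (V j)"
    using subspace_V by blast
  fix c X show "component j (c *\<^sub>R X) = c *\<^sub>R component j X"
    by (rule component_unique)
      (use component_props(1,2) component_props(3)[of X] sub in
        \<open>auto intro: subspace_scale simp: scaleR_sum_right[symmetric]\<close>)
qed

lemma component_S: "X \<in> S i \<Longrightarrow> component j X = (if int j = i then X else 0)"
proof (cases "1 \<le> i \<and> i \<le> int l")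
  case True
  assume X: "X \<in> S i"
  have "component j X = (\<lambda>j. if int j = i then X else 0) j"
  proof (rule component_unique)
    fix j assume "j \<in> {1..l}"
    then show "(if int j = i then X else 0) \<in> V j"
      using X True S_nat[of j] S_0[of "int j"] by auto
  next
    have "(\<Sum>j=1..l. if int j = i then X else 0) = (\<Sum>j=1..l. if j = nat i then X else 0)"
      using True by (intro sum.cong) auto
    also have "\<dots> = X" using True by (subst sum.delta) auto
    finally show "X = (\<Sum>j=1..l. if int j = i then X else 0)" by simp
  qed (use True in auto)
  then show ?thesis by simp
next
  case False
  assume "X \<in> S i"
  then have "X = 0" using False unfolding S_def by auto
  then show ?thesis using linear_0[OF linear_component] by simp
qed

lemma sum_component: "(\<Sum>j=1..l. component j X) = X"
  using component_props(3)[of X] by simp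

lemma linear_ext:
  assumes "linear f" "linear g" "\<And>i X. 1 \<le> i \<Longrightarrow> X \<in> S i \<Longrightarrow> f X = g X"
  shows "f = g"
proof
  fix X
  have "f (\<Sum>j=1..l. component j X) = g (\<Sum>j=1..l. component j X)"
    using assms(3)[OF _ component_in_S] by (simp add: linear_sum[OF assms(1)] linear_sum[OF assms(2)])
  then show "f X = g X" by (simp only: sum_component)
qed

text \<open>The index \<open>d - i\<close> is the degree of the value that a prolongation element of
  degree i takes on a word of degree d; distinct i give distinct strata, and those outside the range
  are zero anyway.\<close>

lemma S_independent:
  assumes "finite I" "\<And>i. i \<in> I \<Longrightarrow> x i \<in> S (d - i)" "(\<Sum>i\<in>I. x i) = 0" "i \<in> I"
  shows "x i = 0"
proof (cases "1 \<le> d - i")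
  case True
  have "0 = component (nat (d - i)) (\<Sum>i\<in>I. x i)"
    using assms(3) linear_0[OF linear_component] by simp
  also have "\<dots> = (\<Sum>i'\<in>I. if int (nat (d - i)) = d - i' then x i' else 0)"
    using component_S[OF assms(2)] by (simp add: linear_sum[OF linear_component])
  also have "\<dots> = (\<Sum>i'\<in>I. if i' = i then x i' else 0)"
    using True by (intro sum.cong) auto
  also have "\<dots> = x i" using assms(1,4) by (simp add: sum.delta)
  finally show ?thesis by simp
next
  case False
  then show ?thesis using assms(2)[OF assms(4)] unfolding S_def by auto
qed

lemma span_brk_V: "j \<in> {1..l} \<Longrightarrow> span {brk X Y | X Y. X \<in> V j \<and> Y \<in> V 1} = V (Suc j)"
  using stratified unfolding stratified_lie_algebra_def by blast

lemma V_Suc_l: "V (Suc l) = {0}"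
  using stratified unfolding stratified_lie_algebra_def by blast

lemma S_Suc: "1 \<le> i \<Longrightarrow> i \<le> int l \<Longrightarrow> S (i + 1) = span {brk X Y | X Y. X \<in> S i \<and> Y \<in> S 1}"
proof -
  assume i: "1 \<le> i" "i \<le> int l"
  have "S (i + 1) = V (Suc (nat i))"
  proof (cases "i + 1 \<le> int l")
    case True then show ?thesis using i by (simp add: S_def Suc_nat_eq_nat_zadd1 add.commute)
  next
    case False
    then have "nat i = l" using i by auto
    then show ?thesis using False V_Suc_l by (simp add: S_def)
  qed
  moreover have "S i = V (nat i)" "nat i \<in> {1..l}" using i by (auto simp: S_def)
  ultimately show ?thesis using span_brk_V[of "nat i"] by (simp only: S_1)
qed

lemma brk_S_1: "X \<in> S i \<Longrightarrow> Y \<in> S 1 \<Longrightarrow> brk X Y \<in> S (i + 1)"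
proof (cases "1 \<le> i \<and> i \<le> int l")
  case True
  assume "X \<in> S i" "Y \<in> S 1"
  then have "brk X Y \<in> span {brk X Y | X Y. X \<in> S i \<and> Y \<in> S 1}"
    by (intro span_base) blast
  then show ?thesis using True S_Suc[of i] by simp
next
  case False
  assume "X \<in> S i"
  then have "X = 0" using False unfolding S_def by auto
  then show ?thesis by simp
qed

text \<open>The stratification only describes brackets with the first stratum. Induction on j: S (j
  + 1) is spanned by brackets [A, B] with B in S 1, and [X, [A, B]] = [[X, A], B] - [[X, B], A] by
  Jacobi.\<close>

lemma brk_S: "X \<in> S i \<Longrightarrow> Y \<in> S j \<Longrightarrow> brk X Y \<in> S (i + j)"
proof -
  have *: "\<forall>i X Y. X \<in> S i \<longrightarrow> Y \<in> S (int (Suc j)) \<longrightarrow> brk X Y \<in> S (i + int (Suc j))" for j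
  proof (induction j)
    case 0 then show ?case using brk_S_1 by simp
  next
    case (Suc j)
    show ?case
    proof (intro allI impI)
      fix i X Y assume X: "X \<in> S i" and Y: "Y \<in> S (int (Suc (Suc j)))"
      show "brk X Y \<in> S (i + int (Suc (Suc j)))"
      proof (cases "int (Suc j) \<le> int l")
        case True
        have "Y \<in> span {brk A B | A B. A \<in> S (int (Suc j)) \<and> B \<in> S 1}"
          using Y S_Suc[of "int (Suc j)"] True by (simp add: add.commute)
        then show ?thesis
        proof (induction rule: span_induct)
          case base
          show ?case using subspace_S by (auto simp: subspace_def brk_linear_simps)
        next
          case (step Y)
          then obtain A B where AB: "Y = brk A B" "A \<in> S (int (Suc j))" "B \<in> S 1" by auto
          have "brk (brk X A) B \<in> S ((i + int (Suc j)) + 1)"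
            using Suc.IH X AB brk_S_1 by blast
          then have 1: "brk (brk X A) B \<in> S (i + int (Suc (Suc j)))" by (simp add: algebra_simps)
          have "brk (brk X B) A \<in> S ((i + 1) + int (Suc j))"
            using Suc.IH X AB brk_S_1 by blast
          then have 2: "brk (brk X B) A \<in> S (i + int (Suc (Suc j)))" by (simp add: algebra_simps)
          have "brk X Y = brk (brk X A) B + - brk (brk X B) A"
            unfolding AB(1) jacobi[of X A B] brk_antisym[of A "brk X B"] ..
          then show ?case
            using subspace_add[OF subspace_S 1 subspace_neg[OF subspace_S 2]] by simp
        qed
      next
        case False
        then have "Y = 0" using Y unfolding S_def by auto
        then show ?thesis by simp
      qed
    qed
  qed
  assume X: "X \<in> S i" and Y: "Y \<in> S j"
  show ?thesis
  proof (cases "1 \<le> j")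
    case True
    then show ?thesis using *[of "nat (j - 1)"] X Y by (auto simp: nat_diff_distrib)
  next
    case False
    then have "Y = 0" using Y unfolding S_def by auto
    then show ?thesis by simp
  qed
qed

definition grading :: "'a \<Rightarrow> 'a" where
  "grading X = (\<Sum>j=1..l. real j *\<^sub>R component j X)"

lemma linear_grading: "linear grading"
  unfolding grading_def
  by (rule linearI)
    (simp_all add: linear_add[OF linear_component] linear_scale[OF linear_component]
      sum.distrib scaleR_sum_right algebra_simps)

lemma grading_S: "X \<in> S i \<Longrightarrow> grading X = of_int i *\<^sub>R X"
proof (cases "1 \<le> i \<and> i \<le> int l")
  case True
  assume X: "X \<in> S i"
  have "grading X = (\<Sum>j=1..l. if j = nat i then of_int i *\<^sub>R X else 0)"
    unfolding grading_def component_S[OF X] using True by (intro sum.cong) auto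
  then show ?thesis using True by (subst (asm) sum.delta) auto
next
  case False
  assume "X \<in> S i"
  then have "X = 0" using False unfolding S_def by auto
  then show ?thesis using linear_0[OF linear_grading] by simp
qed

lemma grading_brk: "grading (brk X Y) = brk (grading X) Y + brk X (grading Y)"
proof -
  have hom: "grading (brk X Y) = brk (grading X) Y + brk X (grading Y)"
    if "X \<in> S i" "Y \<in> S j" for X Y i j
    using grading_S[OF brk_S[OF that]] grading_S[OF that(1)] grading_S[OF that(2)]
    by (simp add: brk_linear_simps algebra_simps)
  have lin: "linear (\<lambda>X. grading (brk X Y))" "linear (\<lambda>X. brk (grading X) Y + brk X (grading Y))"
     "linear (\<lambda>Y. grading (brk X Y))" "linear (\<lambda>Y. brk (grading X) Y + brk X (grading Y))" for X Y
    by (auto intro!: linearI simp: brk_linear_simps linear_add[OF linear_grading]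
        linear_scale[OF linear_grading] algebra_simps)
  have "(\<lambda>Y. grading (brk X Y)) = (\<lambda>Y. brk (grading X) Y + brk X (grading Y))" if "X \<in> S i" for X i
    by (rule linear_ext) (use lin hom that in auto)
  then have "(\<lambda>X. grading (brk X Y)) = (\<lambda>X. brk (grading X) Y + brk X (grading Y))" for Y
    by (intro linear_ext) (use lin in \<open>auto dest: fun_cong\<close>)
  then show ?thesis by (auto dest: fun_cong)
qed

end

section \<open>The prolongation as a space of functions on words\<close>

context stratified begin

text \<open>The degree is a relation, not a function of the word: a letter 0 lies in every stratum
  and may be counted with any i \<ge> 1.\<close>

fun hom_word :: "int \<Rightarrow> 'a list \<Rightarrow> bool" where
  "hom_word d [] \<longleftrightarrow> d = 0"
| "hom_word d (X # w) \<longleftrightarrow> (\<exists>i\<ge>1. X \<in> S i \<and> hom_word (d - i) w)"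

lemma hom_word_append:
  "hom_word d v \<Longrightarrow> hom_word e w \<Longrightarrow> hom_word (d + e) (v @ w)"
proof (induction v arbitrary: d)
  case (Cons X v)
  then obtain i where "i \<ge> 1" "X \<in> S i" "hom_word (d - i) v" by auto
  moreover from this have "hom_word (d + e - i) (v @ w)"
    using Cons.IH[of "d - i"] Cons.prems(2) by (simp add: algebra_simps)
  ultimately show ?case by auto
qed auto

lemma hom_word_appendE:
  assumes "hom_word d (v @ w)"
  obtains e where "hom_word e v" "hom_word (d - e) w"
proof -
  have "\<exists>e. hom_word e v \<and> hom_word (d - e) w"
    using assms
  proof (induction v arbitrary: d)
    case (Cons X v)
    then obtain i where i: "i \<ge> 1" "X \<in> S i" "hom_word (d - i) (v @ w)" by auto
    then obtain e where "hom_word e v" "hom_word (d - i - e) w" using Cons.IH by blast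
    then have "hom_word (i + e) (X # v)" "hom_word (d - (i + e)) w"
      using i by (auto simp: algebra_simps intro!: exI[of _ i])
    then show ?case by blast
  qed auto
  then show ?thesis using that by blast
qed

lemma length_le_degree: "hom_word d w \<Longrightarrow> int (length w) \<le> d"
  by (induction w arbitrary: d) fastforce+

lemma hom_word_singleton: "1 \<le> i \<Longrightarrow> X \<in> S i \<Longrightarrow> hom_word i [X]"
  by auto

definition multilinear :: "('a list \<Rightarrow> 'a) \<Rightarrow> bool" where
  "multilinear u \<longleftrightarrow> (\<forall>p s. linear (\<lambda>X. u (p @ X # s)))"

lemma multilinear_0: "multilinear u \<Longrightarrow> u (p @ 0 # s) = 0"
  unfolding multilinear_def using linear_0[of "\<lambda>X. u (p @ X # s)"] by blast

lemma multilinear_prefix: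
  assumes "multilinear u"
  shows "multilinear (\<lambda>s. u (r @ s))"
  unfolding multilinear_def
proof (intro allI)
  fix p s
  have "linear (\<lambda>X. u ((r @ p) @ X # s))" using assms unfolding multilinear_def by blast
  then show "linear (\<lambda>X. u (r @ p @ X # s))" by simp
qed

lemma multilinear_Cons: "multilinear u \<Longrightarrow> multilinear (\<lambda>s. u (X # s))"
  using multilinear_prefix[of u "[X]"] by simp

text \<open>Letters are replaced by their homogeneous components from left to right. The length n is
  kept fixed because the lemma is also applied to functions that are controlled on words of one
  length only.\<close>

lemma multilinear_ext:
  assumes "multilinear f" and "\<And>d w. hom_word d w \<Longrightarrow> length w = n \<Longrightarrow> f w = 0"
    and "length w = n"
  shows "f w = 0"
proof -
  have "\<forall>d p. hom_word d p \<longrightarrow> length (p @ w) = n \<longrightarrow> f (p @ w) = 0" for w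
  proof (induction w)
    case Nil then show ?case using assms(2) by simp
  next
    case (Cons X w)
    show ?case
    proof (intro allI impI)
      fix d p assume p: "hom_word d p" "length (p @ X # w) = n"
      have lin: "linear (\<lambda>X. f (p @ X # w))" using assms(1) unfolding multilinear_def by blast
      have "f (p @ component j X # w) = 0" if "j \<in> {1..l}" for j
      proof -
        have "hom_word (d + int j) (p @ [component j X])"
          using that component_in_S by (intro hom_word_append[OF p(1)] hom_word_singleton) auto
        then have "f ((p @ [component j X]) @ w) = 0"
          using Cons.IH p(2) by (metis append.assoc append_Cons append_Nil length_append length_Cons)
        then show ?thesis by simp
      qed
      then have "f (p @ (\<Sum>j=1..l. component j X) # w) = 0"
        by (simp add: linear_sum[OF lin])
      then show "f (p @ X # w) = 0" by (simp only: sum_component)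
    qed
  qed
  from this[of w] show ?thesis using assms(3) by (auto dest: spec[of _ 0] spec[of _ "[]"])
qed

lemma multilinear_ext_all:
  assumes "multilinear f" and "\<And>d w. hom_word d w \<Longrightarrow> f w = 0"
  shows "f = (\<lambda>_. 0)"
  using multilinear_ext[OF assms(1)] assms(2) by blast

definition commuting :: "('a list \<Rightarrow> 'a) \<Rightarrow> bool" where
  "commuting u \<longleftrightarrow> (\<forall>p X Y s. u (p @ brk X Y # s) = u (p @ X # Y # s) - u (p @ Y # X # s))"

lemma commutingD: "commuting u \<Longrightarrow> u (p @ brk X Y # s) = u (p @ X # Y # s) - u (p @ Y # X # s)"
  unfolding commuting_def by blast

lemma commuting_prefix: "commuting u \<Longrightarrow> commuting (\<lambda>s. u (r @ s))"
  using commutingD[of u "r @ _"] unfolding commuting_def by simp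

lemma commuting_Cons: "commuting u \<Longrightarrow> commuting (\<lambda>s. u (X # s))"
  using commuting_prefix[of u "[X]"] by simp

text \<open>A description of the elements of degree k without recursion on k, so that contractions
  and Lie derivatives can be checked clause by clause. The last clause says that contraction with a
  word of degree d > k gives an element of negative degree k - d, which is the algebra element
  \<open>u w\<close> and acts on further letters by brackets.\<close>

definition prol_word :: "int \<Rightarrow> ('a list \<Rightarrow> 'a) \<Rightarrow> bool" where
  "prol_word k u \<longleftrightarrow> multilinear u \<and> commuting u \<and>
     (\<forall>d w. hom_word d w \<longrightarrow> u w \<in> S (d - k)) \<and>
     (\<forall>d w s. hom_word d w \<and> k < d \<longrightarrow> u (w @ s) = foldl brk (u w) s)"

lemma prol_wordD:
  assumes "prol_word k u"
  shows "multilinear u" "commuting u" "hom_word d w \<Longrightarrow> u w \<in> S (d - k)"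
    "hom_word d w \<Longrightarrow> k < d \<Longrightarrow> u (w @ s) = foldl brk (u w) s"
  using assms unfolding prol_word_def by blast+

lemma prol_word_append:
  assumes "prol_word k u" "hom_word d p"
  shows "prol_word (k - d) (\<lambda>s. u (p @ s))"
  unfolding prol_word_def
proof (intro conjI allI impI)
  show "multilinear (\<lambda>s. u (p @ s))"
    using prol_wordD(1)[OF assms(1)] by (rule multilinear_prefix)
  show "commuting (\<lambda>s. u (p @ s))"
    using prol_wordD(2)[OF assms(1)] by (rule commuting_prefix)
  fix e w assume w: "hom_word e w"
  show "u (p @ w) \<in> S (e - (k - d))"
    using prol_wordD(3)[OF assms(1) hom_word_append[OF assms(2) w]] by (simp add: algebra_simps)
next
  fix e w s assume w: "hom_word e w \<and> k - d < e"
  then show "u (p @ w @ s) = foldl brk (u (p @ w)) s"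
    using prol_wordD(4)[OF assms(1) hom_word_append[OF assms(2), of e w], of s] by simp
qed

lemma prol_word_Cons:
  assumes "prol_word k u" "1 \<le> i" "X \<in> S i"
  shows "prol_word (k - i) (\<lambda>s. u (X # s))"
  using prol_word_append[OF assms(1) hom_word_singleton[OF assms(2,3)]] by simp

lemma linear_foldl: "linear (\<lambda>X. foldl brk X s)"
proof (induction s)
  case (Cons Z s)
  show ?case using linear_compose[OF linear_brk_left Cons.IH] by (simp add: o_def)
qed (simp add: linear_id[unfolded id_def])

lemma foldl_brk_0 [simp]: "foldl brk 0 s = 0"
  using linear_0[OF linear_foldl] by simp

lemma foldl_brk_S:
  "X \<in> S i \<Longrightarrow> hom_word d s \<Longrightarrow> foldl brk X s \<in> S (i + d)"
proof (induction s arbitrary: X i d)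
  case (Cons Z s)
  then obtain j where "j \<ge> 1" "Z \<in> S j" "hom_word (d - j) s" by auto
  then show ?case using Cons.IH[OF brk_S[OF Cons.prems(1)]] by (fastforce simp: algebra_simps)
qed auto

lemma foldl_multilinear: "multilinear (foldl brk X)"
  unfolding multilinear_def
proof (intro allI)
  fix p s
  show "linear (\<lambda>Y. foldl brk X (p @ Y # s))"
    using linear_compose[OF linear_brk_right linear_foldl] by (simp add: o_def)
qed

lemma foldl_prol_word:
  assumes "X \<in> S j"
  shows "prol_word (- j) (foldl brk X)"
  unfolding prol_word_def
proof (intro conjI allI impI foldl_multilinear)
  show "commuting (foldl brk X)"
    unfolding commuting_def
  proof (intro allI)
    fix p A B s
    have "brk W (brk A B) = brk (brk W A) B - brk (brk W B) A" for W
      using jacobi[of W A B] brk_antisym[of A "brk W B"] by simp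
    then show "foldl brk X (p @ brk A B # s) = foldl brk X (p @ A # B # s) - foldl brk X (p @ B # A # s)"
      by (simp add: linear_diff[OF linear_foldl])
  qed
qed (use foldl_brk_S[OF assms] in \<open>auto simp: algebra_simps\<close>)

lemma prol_word_zero: "prol_word k (\<lambda>_. 0)"
  by (simp add: prol_word_def multilinear_def commuting_def linear_zero)

text \<open>The rules of \<open>prol\<close> speak of homogeneous first letters of degree at most l.
  Linearity in the first letter carries the clauses over to all words, by splitting that letter into
  components.\<close>

lemma prol_imp_prol_word: "prol brk V l k u \<Longrightarrow> prol_word k u"
proof (induction rule: prol.induct)
  case (neg j X)
  then show ?case using foldl_prol_word[of X "int j"] S_nat[of j] by auto
next
  case (nonneg k u)
  have lin: "linear (\<lambda>X. u (X # s))" for s using nonneg by blast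
  have IH: "prol_word (k - int j) (\<lambda>s. u (X # s))" if "j \<in> {1..l}" "X \<in> S (int j)" for j X
    using nonneg that S_nat[of j] by auto
  have u0: "u (0 # s) = 0" for s using linear_0[OF lin] .
  have letter: "prol_word (k - i) (\<lambda>s. u (X # s))" if "1 \<le> i" "X \<in> S i" for i X
  proof (cases "i \<le> int l")
    case True
    then have "nat i \<in> {1..l}" using that by auto
    then show ?thesis using IH[of "nat i" X] that by simp
  next
    case False
    then have "X = 0" using that unfolding S_def by auto
    then show ?thesis by (simp add: u0 prol_word_zero)
  qed
  have split: "u (X # s) = (\<Sum>j=1..l. u (component j X # s))" for X s
    using linear_sum[OF lin, of "\<lambda>j. component j X" "{1..l}"] by (simp only: sum_component)
  have IHc: "prol_word (k - int j) (\<lambda>s. u (component j X # s))" if "j \<in> {1..l}" for j X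
    using IH[OF that component_in_S] .
  show ?case
    unfolding prol_word_def
  proof (intro conjI allI impI)
    show "multilinear u"
      unfolding multilinear_def
    proof (intro allI)
      fix p s show "linear (\<lambda>X. u (p @ X # s))"
      proof (cases p)
        case Nil then show ?thesis using lin by simp
      next
        case (Cons Z p')
        have "linear (\<lambda>X. u (component j Z # p' @ X # s))" if "j \<in> {1..l}" for j
          using prol_wordD(1)[OF IHc[OF that]] unfolding multilinear_def by blast
        then have "linear (\<lambda>X. \<Sum>j=1..l. u (component j Z # p' @ X # s))"
          by (intro linear_compose_sum) auto
        then show ?thesis unfolding Cons by (simp add: split[of Z])
      qed
    qed
    show "commuting u"
      unfolding commuting_def
    proof (intro allI)
      fix p X Y s show "u (p @ brk X Y # s) = u (p @ X # Y # s) - u (p @ Y # X # s)"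
      proof (cases p)
        case Nil then show ?thesis using nonneg by simp
      next
        case (Cons Z p')
        have "u (component j Z # p' @ brk X Y # s) =
           u (component j Z # p' @ X # Y # s) - u (component j Z # p' @ Y # X # s)" if "j \<in> {1..l}" for j
          using prol_wordD(2)[OF IHc[OF that]] unfolding commuting_def by blast
        then show ?thesis unfolding Cons by (simp add: split[of Z] sum_subtractf)
      qed
    qed
  next
    fix d w assume w: "hom_word d w"
    show "u w \<in> S (d - k)"
    proof (cases w)
      case Nil then show ?thesis using nonneg by simp
    next
      case (Cons X w')
      then obtain i where i: "i \<ge> 1" "X \<in> S i" "hom_word (d - i) w'" using w by auto
      from prol_wordD(3)[OF letter[OF i(1,2)] i(3)] show ?thesis by (simp add: Cons)
    qed
  next
    fix d w s assume w: "hom_word d w \<and> k < d"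
    show "u (w @ s) = foldl brk (u w) s"
    proof (cases w)
      case Nil then show ?thesis using nonneg w by simp
    next
      case (Cons X w')
      then obtain i where i: "i \<ge> 1" "X \<in> S i" "hom_word (d - i) w'" using w by auto
      from prol_wordD(4)[OF letter[OF i(1,2)] i(3), of s] show ?thesis using w by (simp add: Cons)
    qed
  qed
qed

text \<open>Induction on k + l. For k \<ge> 0 a contraction with a letter of degree j in 1..l leaves
  degree k - j \<ge> -l; for k < 0 the last clause of \<open>prol_word\<close>, taken at the empty
  word, shows that u encodes the algebra element \<open>u []\<close>.\<close>

lemma prol_word_imp_prol:
  assumes "prol_word k u" "- int l \<le> k"
  shows "prol brk V l k u"
  using assms
proof (induction "nat (k + int l)" arbitrary: k u rule: less_induct)
  case less
  note u = prol_wordD[OF less.prems(1)]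
  show ?case
  proof (cases "k < 0")
    case True
    define X where "X = u []"
    have "u ([] @ s) = foldl brk (u []) s" for s
      by (rule u(4)) (use True in auto)
    then have u_eq: "u = (\<lambda>s. foldl brk X s)" unfolding X_def append_Nil by (rule ext)
    have k: "k = - int (nat (- k))" "1 \<le> nat (- k)" "nat (- k) \<le> l"
      using True less.prems(2) by auto
    have "X \<in> S (0 - k)" unfolding X_def by (rule u(3)) simp
    then have "X \<in> V (nat (- k))" using True less.prems(2) by (auto simp: S_def)
    with k(2,3) have "prol brk V l (- int (nat (- k))) (\<lambda>s. foldl brk X s)" by (intro prol.neg)
    then show ?thesis unfolding u_eq using k(1) by simp
  next
    case False
    show ?thesis
    proof (rule prol.nonneg)
      show "0 \<le> k" using False by simp
      show "u [] = 0" using u(3)[of 0 "[]"] False by (auto simp: S_def)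
      show "\<forall>s. linear (\<lambda>X. u (X # s))"
        using u(1) unfolding multilinear_def by (auto dest: spec[of _ "[]"])
      show "\<forall>X Y s. u (brk X Y # s) = u (X # Y # s) - u (Y # X # s)"
        using commutingD[OF u(2), of "[]"] by simp
      show "\<forall>j X. 1 \<le> j \<and> j \<le> l \<and> X \<in> V j \<longrightarrow> prol brk V l (k - int j) (\<lambda>s. u (X # s))"
      proof (intro allI impI)
        fix j X assume j: "1 \<le> j \<and> j \<le> l \<and> X \<in> V j"
        have "prol_word (k - int j) (\<lambda>s. u (X # s))"
          using j S_nat[of j] by (intro prol_word_Cons[OF less.prems(1)]) auto
        then show "prol brk V l (k - int j) (\<lambda>s. u (X # s))"
          using j False less.hyps[of "k - int j"] by auto
      qed
    qed
  qed
qed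

end

section \<open>Finite dimension of the prolongation versus a bound on its degrees\<close>

interpretation fun_space: vector_space "\<lambda>(a::real) (f::'x \<Rightarrow> 'b::real_vector). (\<lambda>x. a *\<^sub>R f x)"
  by unfold_locales (auto simp: fun_eq_iff algebra_simps)

lemma prol_mem_prol_space: "prol brk V l k u \<Longrightarrow> u \<in> prol_space brk V l"
  unfolding prol_space_def
  by (rule CollectI, rule exI[of _ "{k}"], rule exI[of _ "\<lambda>_. u"]) simp

context stratified begin

lemma prol_word_linearly_independent:
  assumes "finite I" "\<And>k. k \<in> I \<Longrightarrow> prol_word k (u k)" "\<And>xs. (\<Sum>k\<in>I. c k *\<^sub>R u k xs) = 0" "k \<in> I"
    "u k \<noteq> (\<lambda>_. 0)"
  shows "c k = 0"
proof -
  obtain d w where w: "hom_word d w" "u k w \<noteq> 0"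
    using multilinear_ext_all[OF prol_wordD(1)[OF assms(2)[OF assms(4)]]] assms(5) by blast
  have "c k *\<^sub>R u k w = 0"
    by (rule S_independent[OF assms(1) _ assms(3) assms(4), where d = d])
      (use prol_wordD(3)[OF assms(2) w(1)] subspace_scale[OF subspace_S] in blast)
  then show ?thesis using w by simp
qed

text \<open>One nonzero element is chosen in each nonnegative degree that has one. Elements of
  distinct degrees are independent, so a finite spanning set B allows at most \<open>card B\<close>
  such degrees.\<close>

lemma prol_finite_dim_imp_degree_bound:
  assumes "prol_finite_dim brk V l"
  obtains m where "0 \<le> m" "\<And>k u. m < k \<Longrightarrow> prol_word k u \<Longrightarrow> u = (\<lambda>_. 0)"
proof -
  obtain B where B: "finite B" "\<And>u. u \<in> prol_space brk V l \<Longrightarrow> \<exists>c. u = (\<lambda>xs. \<Sum>b\<in>B. c b *\<^sub>R b xs)"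
    using assms unfolding prol_finite_dim_def by blast
  define D where "D = {k. 0 \<le> k \<and> (\<exists>u. prol_word k u \<and> u \<noteq> (\<lambda>_. 0))}"
  define u where "u k = (SOME u. prol_word k u \<and> u \<noteq> (\<lambda>_. 0))" for k
  have u: "prol_word k (u k)" "u k \<noteq> (\<lambda>_. 0)" if "k \<in> D" for k
    using someI_ex[of "\<lambda>u. prol_word k u \<and> u \<noteq> (\<lambda>_. 0)"] that unfolding D_def u_def by auto
  have card: "card I \<le> card B" if I: "finite I" "I \<subseteq> D" for I
  proof -
    have inj: "inj_on u I"
    proof (rule inj_onI, rule ccontr)
      fix j k assume jk: "j \<in> I" "k \<in> I" "u j = u k" "j \<noteq> k"
      \<comment> \<open>If one element served two degrees, subtracting it from itself would be a
        vanishing combination with coefficients 1 and -1.\<close>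
      have "(if j = j then 1 else - 1) = (0 :: real)"
        by (rule prol_word_linearly_independent[of "{j, k}" u "\<lambda>i. if i = j then 1 else - 1" j])
          (use jk I u in auto)
      then show False by simp
    qed
    have "fun_space.independent (u ` I)"
      unfolding fun_space.independent_explicit_module
    proof (intro allI impI)
      fix T c v
      assume T: "finite T" "T \<subseteq> u ` I" "(\<Sum>v\<in>T. (\<lambda>x. c v *\<^sub>R v x)) = 0" "v \<in> T"
      obtain J where J: "J \<subseteq> I" "T = u ` J" using T(2) by (meson subset_imageE)
      then obtain k where k: "k \<in> J" "v = u k" using T(4) by blast
      have injJ: "inj_on u J" using inj J(1) inj_on_subset by blast
      have "c (u k) = 0"
      proof (rule prol_word_linearly_independent[of J u "\<lambda>j. c (u j)" k])
        show "finite J" using J(1) I(1) finite_subset by blast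
        fix xs
        have "(\<Sum>v\<in>T. (\<lambda>x. c v *\<^sub>R v x)) xs = 0" using T(3) by (simp only: zero_fun_def)
        moreover have "(\<Sum>v\<in>T. (\<lambda>x. c v *\<^sub>R v x)) xs = (\<Sum>v\<in>T. c v *\<^sub>R v xs)"
          using T(1) by (induction T) auto
        ultimately show "(\<Sum>j\<in>J. c (u j) *\<^sub>R u j xs) = 0"
          unfolding J(2) by (simp add: sum.reindex[OF injJ])
      qed (use k J I u in auto)
      then show "c v = 0" using k by simp
    qed
    moreover have "u ` I \<subseteq> fun_space.span B"
    proof
      fix v assume "v \<in> u ` I"
      then obtain k where k: "k \<in> I" "v = u k" by blast
      then have "k \<in> D" using I(2) by blast
      then have "prol brk V l k (u k)"
        using u(1)[of k] by (intro prol_word_imp_prol) (auto simp: D_def)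
      then obtain c where c: "v = (\<lambda>xs. \<Sum>b\<in>B. c b *\<^sub>R b xs)"
        using B(2) prol_mem_prol_space k by metis
      have "v = (\<Sum>b\<in>B. (\<lambda>xs. c b *\<^sub>R b xs))"
        unfolding c using B(1) by (induction B) (auto simp: fun_eq_iff)
      moreover have "(\<Sum>b\<in>B. (\<lambda>xs. c b *\<^sub>R b xs)) \<in> fun_space.span B"
        by (rule fun_space.span_sum) (rule fun_space.span_scale[OF fun_space.span_base])
      ultimately show "v \<in> fun_space.span B" by simp
    qed
    ultimately have "card (u ` I) \<le> card B" using fun_space.independent_span_bound[OF B(1)] by blast
    then show ?thesis by (simp add: card_image[OF inj])
  qed
  have "finite D"
  proof (rule ccontr)
    assume "infinite D"
    then obtain I where "I \<subseteq> D" "finite I" "card I = Suc (card B)"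
      using infinite_arbitrarily_large by blast
    then show False using card[of I] by simp
  qed
  then obtain m where m: "\<And>k. k \<in> D \<Longrightarrow> k \<le> m" using Max_ge by blast
  show ?thesis
  proof (rule that[of "max 0 m"])
    fix k u assume "max 0 m < k" "prol_word k u"
    then show "u = (\<lambda>_. 0)" using m[of k] unfolding D_def by fastforce
  qed simp
qed

fun word_coefficient :: "'a list \<Rightarrow> 'a list \<Rightarrow> real" where
  "word_coefficient [] [] = 1"
| "word_coefficient (X # p) (b # q) = (X \<bullet> b) * word_coefficient p q"
| "word_coefficient _ _ = 0"

lemma word_coefficient_length: "length p \<noteq> length q \<Longrightarrow> word_coefficient p q = 0"
  by (induction p q rule: word_coefficient.induct) auto

lemma multilinear_expansion:
  assumes "multilinear u"
  shows "u (r @ p) = (\<Sum>q\<in>{q. set q \<subseteq> Basis \<and> length q = length p}. word_coefficient p q *\<^sub>R u (r @ q))"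
proof (induction p arbitrary: r)
  case Nil
  have "{q. set q \<subseteq> (Basis :: 'a set) \<and> length q = length []} = {[]}" by auto
  then show ?case by simp
next
  case (Cons X p)
  let ?Q = "{q. set q \<subseteq> (Basis :: 'a set) \<and> length q = length p}"
  have lin: "linear (\<lambda>X. u (r @ X # p))" using assms unfolding multilinear_def by blast
  have "u (r @ X # p) = u (r @ (\<Sum>b\<in>Basis. (X \<bullet> b) *\<^sub>R b) # p)" by (simp add: euclidean_representation)
  also have "\<dots> = (\<Sum>b\<in>Basis. (X \<bullet> b) *\<^sub>R u ((r @ [b]) @ p))"
    by (simp add: linear_sum[OF lin] linear_scale[OF lin])
  also have "\<dots> = (\<Sum>b\<in>Basis. \<Sum>q\<in>?Q. ((X \<bullet> b) * word_coefficient p q) *\<^sub>R u (r @ b # q))"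
    by (subst Cons.IH) (simp add: scaleR_sum_right)
  also have "\<dots> = (\<Sum>(q, b)\<in>?Q \<times> Basis. ((X \<bullet> b) * word_coefficient p q) *\<^sub>R u (r @ b # q))"
    by (subst sum.swap) (simp add: sum.cartesian_product)
  also have "\<dots> = (\<Sum>q\<in>(\<lambda>(q, b). b # q) ` (?Q \<times> Basis). word_coefficient (X # p) q *\<^sub>R u (r @ q))"
    by (subst sum.reindex) (auto simp: inj_on_def case_prod_beta)
  also have "(\<lambda>(q, b). b # q) ` (?Q \<times> Basis) = {q. set q \<subseteq> Basis \<and> length q = length (X # p)}"
    using lists_length_Suc_eq[of "Basis :: 'a set" "length p"] by simp
  finally show ?case .
qed

text \<open>Every letter has degree at least one, so a word of length n has degree above m, and an
  element of degree at most m acts by brackets on all letters after the n-th. It is therefore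
  determined by its values on the finitely many words of length at most n in the Euclidean
  basis.\<close>

lemma degree_bound_imp_prol_finite_dim:
  assumes bound: "\<And>k u. m < k \<Longrightarrow> prol_word k u \<Longrightarrow> u = (\<lambda>_. 0)"
  shows "prol_finite_dim brk V l"
proof -
  define n where "n = Suc (nat m)"
  define Q where "Q = {q. set q \<subseteq> (Basis :: 'a set) \<and> length q \<le> n} \<times> (Basis :: 'a set)"
  define e :: "'a list \<times> 'a \<Rightarrow> 'a list \<Rightarrow> 'a" where "e = (\<lambda>(q, b) w. word_coefficient (take n w) q *\<^sub>R foldl brk b (drop n w))"
  have finQ: "finite Q" unfolding Q_def using finite_lists_length_le[of "Basis :: 'a set" n] by simp
  \<comment> \<open>Basis vectors need not be homogeneous, so the last clause of
    \<open>prol_word\<close> is first extended to all words of length n by multilinearity.\<close>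
  have fold: "u (p @ s) = foldl brk (u p) s" if u: "prol_word k u" and p: "length p = n" for k u p s
  proof (cases "k \<le> m")
    case True
    have u': "multilinear u" using prol_wordD(1)[OF u] .
    have "u (p @ s) - foldl brk (u p) s = 0"
    proof (rule multilinear_ext[where f = "\<lambda>p. u (p @ s) - foldl brk (u p) s"])
      show "multilinear (\<lambda>p. u (p @ s) - foldl brk (u p) s)"
        unfolding multilinear_def
      proof (intro allI linear_compose_sub)
        fix p t
        show "linear (\<lambda>X. u ((p @ X # t) @ s))" using u' by (simp add: multilinear_def)
        have "linear (\<lambda>X. u (p @ X # t))" using u' by (simp add: multilinear_def)
        from linear_compose[OF this linear_foldl]
        show "linear (\<lambda>X. foldl brk (u (p @ X # t)) s)" by (simp add: o_def)
      qed
      fix d w assume "hom_word d w" "length w = n"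
      moreover from this have "k < d" using length_le_degree[of d w] True unfolding n_def by linarith
      ultimately show "u (w @ s) - foldl brk (u w) s = 0"
        using prol_wordD(4)[OF u] by simp
    qed (rule p)
    then show ?thesis by simp
  next
    case False
    then show ?thesis using bound[of k u] u by simp
  qed
  show ?thesis
    unfolding prol_finite_dim_def
  proof (intro exI[of _ "e ` Q"] conjI ballI)
    show "finite (e ` Q)" using finQ by simp
    fix u assume "u \<in> prol_space brk V l"
    then obtain I w where I: "finite I" "\<And>i. i \<in> I \<Longrightarrow> prol brk V l i (w i)" "u = (\<lambda>xs. \<Sum>i\<in>I. w i xs)"
      unfolding prol_space_def by auto
    have w: "prol_word i (w i)" if "i \<in> I" for i using I(2)[OF that] by (rule prol_imp_prol_word)
    have u_fold: "u (p @ s) = foldl brk (u p) s" if "length p = n" for p s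
      unfolding I(3) linear_sum[OF linear_foldl] using fold[OF w that] by (intro sum.cong) auto
    have u_lin: "multilinear u"
      unfolding multilinear_def I(3)
      using prol_wordD(1)[OF w] by (intro allI linear_compose_sum) (auto simp: multilinear_def)
    define c where "c f = (\<Sum>(q, b)\<in>{i \<in> Q. e i = f}. u q \<bullet> b)" for f
    show "\<exists>c. u = (\<lambda>xs. \<Sum>f\<in>e ` Q. c f *\<^sub>R f xs)"
    proof (intro exI[of _ c] ext)
      fix x :: "'a list"
      define p where "p = take n x"
      define s where "s = drop n x"
      have "u x = foldl brk (u p) s"
      proof (cases "n \<le> length x")
        case True
        then have "u (p @ s) = foldl brk (u p) s" by (intro u_fold) (simp add: p_def)
        then show ?thesis by (simp add: p_def s_def)
      qed (simp add: p_def s_def)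
      also have "u p = (\<Sum>q\<in>{q. set q \<subseteq> Basis \<and> length q = length p}. word_coefficient p q *\<^sub>R u q)"
        using multilinear_expansion[OF u_lin, of "[]" p] by simp
      \<comment> \<open>The prefix p is shorter than n when x is; words q of another length
        contribute the coefficient 0.\<close>
      also have "\<dots> = (\<Sum>q\<in>{q. set q \<subseteq> Basis \<and> length q \<le> n}. word_coefficient p q *\<^sub>R u q)"
      proof (rule sum.mono_neutral_left)
        show "\<forall>q\<in>{q. set q \<subseteq> Basis \<and> length q \<le> n} - {q. set q \<subseteq> Basis \<and> length q = length p}.
           word_coefficient p q *\<^sub>R u q = 0"
          by (intro ballI) (auto simp: word_coefficient_length)
      qed (auto intro: finite_lists_length_le simp: p_def)
      also have "foldl brk \<dots> s = (\<Sum>q\<in>{q. set q \<subseteq> Basis \<and> length q \<le> n}. word_coefficient p q *\<^sub>R foldl brk (u q) s)"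
        by (simp add: linear_sum[OF linear_foldl] linear_scale[OF linear_foldl])
      also have "\<dots> = (\<Sum>q\<in>{q. set q \<subseteq> Basis \<and> length q \<le> n}. \<Sum>b\<in>Basis. (u q \<bullet> b) *\<^sub>R e (q, b) x)"
      proof (rule sum.cong[OF refl])
        fix q
        have "foldl brk (u q) s = foldl brk (\<Sum>b\<in>Basis. (u q \<bullet> b) *\<^sub>R b) s"
          by (simp add: euclidean_representation)
        also have "\<dots> = (\<Sum>b\<in>Basis. (u q \<bullet> b) *\<^sub>R foldl brk b s)"
          by (simp add: linear_sum[OF linear_foldl] linear_scale[OF linear_foldl])
        finally show "word_coefficient p q *\<^sub>R foldl brk (u q) s = (\<Sum>b\<in>Basis. (u q \<bullet> b) *\<^sub>R e (q, b) x)"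
          by (simp add: e_def p_def s_def scaleR_sum_right mult.commute)
      qed
      also have "\<dots> = (\<Sum>(q, b)\<in>Q. (u q \<bullet> b) *\<^sub>R e (q, b) x)"
        unfolding Q_def by (simp add: sum.cartesian_product)
      also have "\<dots> = (\<Sum>f\<in>e ` Q. \<Sum>i\<in>{i \<in> Q. e i = f}. case i of (q, b) \<Rightarrow> (u q \<bullet> b) *\<^sub>R e (q, b) x)"
        by (rule sum.image_gen[OF finQ])
      also have "\<dots> = (\<Sum>f\<in>e ` Q. c f *\<^sub>R f x)"
        unfolding c_def scaleR_sum_left by (intro sum.cong refl) auto
      finally show "u x = (\<Sum>f\<in>e ` Q. c f *\<^sub>R f x)" .
    qed
  qed
qed

end

section \<open>Contraction with derivations\<close>

context stratified begin

text \<open>This encodes the bracket [u, T], with T regarded as an element of degree 0: [[u, T], X]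
  = [[u, X], T] + [u, T X], and the negative component of [u, T] is -T applied to that of u.\<close>

fun lie_derivative :: "('a \<Rightarrow> 'a) \<Rightarrow> ('a list \<Rightarrow> 'a) \<Rightarrow> 'a list \<Rightarrow> 'a" where
  "lie_derivative T u [] = - T (u [])"
| "lie_derivative T u (X # w) = lie_derivative T (\<lambda>s. u (X # s)) w + u (T X # w)"

abbreviation "lie_pow T N \<equiv> lie_derivative T ^^ N"

definition graded_derivation :: "('a \<Rightarrow> 'a) \<Rightarrow> bool" where
  "graded_derivation T \<longleftrightarrow> linear T \<and> (\<forall>X Y. T (brk X Y) = brk (T X) Y + brk X (T Y)) \<and>
     (\<forall>i X. X \<in> S i \<longrightarrow> T X \<in> S i)"

lemma graded_derivationD:
  assumes "graded_derivation T"
  shows "linear T" "T (brk X Y) = brk (T X) Y + brk X (T Y)" "X \<in> S i \<Longrightarrow> T X \<in> S i"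
  using assms unfolding graded_derivation_def by blast+

context
  fixes T assumes T: "graded_derivation T"
begin

lemmas T_simps = linear_add[OF graded_derivationD(1)[OF T]] linear_scale[OF graded_derivationD(1)[OF T]]
  linear_diff[OF graded_derivationD(1)[OF T]] linear_0[OF graded_derivationD(1)[OF T]]
  linear_neg[OF graded_derivationD(1)[OF T]]

lemma lie_derivative_add:
  "lie_derivative T (\<lambda>s. f s + g s) w = lie_derivative T f w + lie_derivative T g w"
  by (induction w arbitrary: f g) (simp_all add: T_simps)

lemma lie_derivative_diff:
  "lie_derivative T (\<lambda>s. f s - g s) w = lie_derivative T f w - lie_derivative T g w"
  by (induction w arbitrary: f g) (simp_all add: T_simps)

lemma lie_derivative_scale:
  "lie_derivative T (\<lambda>s. a *\<^sub>R f s) w = a *\<^sub>R lie_derivative T f w"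
  by (induction w arbitrary: f) (simp_all add: T_simps scaleR_add_right)

lemma lie_derivative_zero: "lie_derivative T (\<lambda>s. 0) = (\<lambda>s. 0)"
  using lie_derivative_scale[of 0 "\<lambda>_. 0"] by (simp add: fun_eq_iff)

lemma lie_derivative_foldl: "lie_derivative T (\<lambda>s. foldl brk X s) w = foldl brk (- T X) w"
proof (induction w arbitrary: X)
  case (Cons Z w)
  have "- T (brk X Z) + brk X (T Z) = brk (- T X) Z"
    by (simp add: graded_derivationD(2)[OF T] brk_linear_simps)
  then show ?case using Cons[of "brk X Z"] linear_add[OF linear_foldl, of "- T (brk X Z)" "brk X (T Z)" w]
    by simp
qed simp

lemma lie_derivative_multilinear:
  assumes "multilinear u"
  shows "multilinear (lie_derivative T u)"
  unfolding multilinear_def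
proof (intro allI)
  fix p s
  show "linear (\<lambda>X. lie_derivative T u (p @ X # s))"
    using assms
  proof (induction p arbitrary: u)
    case Nil
    have lin: "linear (\<lambda>X. u (X # s))" for s
      using Nil unfolding multilinear_def by (auto dest: spec[of _ "[]"])
    show ?case
      by (rule linearI)
        (simp_all add: linear_add[OF lin] linear_scale[OF lin] lie_derivative_add lie_derivative_scale
          T_simps algebra_simps)
  next
    case (Cons Z p)
    have "linear (\<lambda>X. lie_derivative T (\<lambda>s. u (Z # s)) (p @ X # s))"
      by (rule Cons.IH[OF multilinear_Cons[OF Cons.prems]])
    moreover have "linear (\<lambda>X. u ((T Z # p) @ X # s))"
      using Cons.prems unfolding multilinear_def by blast
    ultimately show ?case by (simp add: linear_compose_add)
  qed
qed

lemma lie_derivative_commuting: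
  assumes "multilinear u" "commuting u"
  shows "commuting (lie_derivative T u)"
  unfolding commuting_def
proof (intro allI)
  fix p X Y s
  show "lie_derivative T u (p @ brk X Y # s) =
     lie_derivative T u (p @ X # Y # s) - lie_derivative T u (p @ Y # X # s)"
    using assms
  proof (induction p arbitrary: u)
    case Nil
    have lin: "linear (\<lambda>X. u (X # s))" for s
      using Nil(1) unfolding multilinear_def by (auto dest: spec[of _ "[]"])
    have com: "u (brk X Y # s) = u (X # Y # s) - u (Y # X # s)" for X Y s
      using commutingD[OF Nil(2), of "[]"] by simp
    show ?case
      by (simp add: graded_derivationD(2)[OF T] linear_add[OF lin] com lie_derivative_diff)
  next
    case (Cons Z p)
    then show ?case
      using Cons.IH[OF multilinear_Cons[OF Cons.prems(1)] commuting_Cons[OF Cons.prems(2)]]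
        commutingD[OF Cons.prems(2), of "T Z # p"] by simp
  qed
qed

lemma lie_derivative_prol_word:
  assumes "prol_word k u"
  shows "prol_word k (lie_derivative T u)"
  unfolding prol_word_def
proof (intro conjI allI impI)
  show "multilinear (lie_derivative T u)" using lie_derivative_multilinear prol_wordD(1)[OF assms] .
  show "commuting (lie_derivative T u)"
    using lie_derivative_commuting prol_wordD(1,2)[OF assms] by blast
  fix d w assume "hom_word d w"
  then show "lie_derivative T u w \<in> S (d - k)"
    using assms
  proof (induction w arbitrary: d k u)
    case Nil
    then have "- T (u []) \<in> S (d - k)"
      by (intro subspace_neg[OF subspace_S] graded_derivationD(3)[OF T] prol_wordD(3)) auto
    then show ?case by simp
  next
    case (Cons X w)
    then obtain i where i: "1 \<le> i" "X \<in> S i" "hom_word (d - i) w" by auto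
    have "lie_derivative T (\<lambda>s. u (X # s)) w \<in> S ((d - i) - (k - i))"
      using Cons.IH[OF i(3) prol_word_Cons[OF Cons.prems(2) i(1,2)]] .
    moreover have "u (T X # w) \<in> S (d - k)"
      using i graded_derivationD(3)[OF T i(2)] by (intro prol_wordD(3)[OF Cons.prems(2)]) auto
    ultimately show ?case using subspace_add[OF subspace_S] by simp
  qed
next
  fix d w s assume "hom_word d w \<and> k < d"
  then have "hom_word d w" "k < d" by auto
  then show "lie_derivative T u (w @ s) = foldl brk (lie_derivative T u w) s"
    using assms
  proof (induction w arbitrary: d k u)
    case Nil
    define X where "X = u []"
    have "u ([] @ s) = foldl brk (u []) s" for s
      by (rule prol_wordD(4)[OF Nil.prems(3)]) (use Nil in auto)
    then have u_eq: "u = (\<lambda>s. foldl brk X s)" unfolding X_def append_Nil by (rule ext)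
    show ?case unfolding u_eq by (simp add: lie_derivative_foldl)
  next
    case (Cons X w)
    then obtain i where i: "1 \<le> i" "X \<in> S i" "hom_word (d - i) w" by auto
    have "lie_derivative T (\<lambda>s. u (X # s)) (w @ s) = foldl brk (lie_derivative T (\<lambda>s. u (X # s)) w) s"
      by (rule Cons.IH[OF i(3) _ prol_word_Cons[OF Cons.prems(3) i(1,2)]]) (use Cons.prems in auto)
    moreover have "u ((T X # w) @ s) = foldl brk (u (T X # w)) s"
      using i graded_derivationD(3)[OF T i(2)] Cons.prems(2) by (intro prol_wordD(4)[OF Cons.prems(3), of d]) auto
    ultimately show ?case by (simp add: linear_add[OF linear_foldl])
  qed
qed

lemma lie_pow_prol_word: "prol_word k u \<Longrightarrow> prol_word k (lie_pow T N u)"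
  by (induction N) (simp_all add: lie_derivative_prol_word)

lemma lie_pow_zero: "lie_pow T N (\<lambda>_. 0) = (\<lambda>_. 0)"
  by (induction N) (simp_all add: lie_derivative_zero)

end

text \<open>A binomial formula: each Lie derivative either passes the letter X or turns it into T X,
  and since T squares to zero the latter happens at most once, in N ways. For N = 0 the truncated
  exponent N - 1 carries the coefficient 0.\<close>

lemma lie_pow_Cons:
  assumes T: "graded_derivation T" and nil: "\<And>X. T (T X) = 0" and u: "multilinear u"
  shows "lie_pow T N u (X # w) =
    lie_pow T N (\<lambda>s. u (X # s)) w +
    real N *\<^sub>R lie_pow T (N - 1) (\<lambda>s. u (T X # s)) w"
proof (induction N arbitrary: X w)
  case (Suc N)
  have zero: "(\<lambda>s. u (0 # s)) = (\<lambda>_. 0)" using multilinear_0[OF u, of "[]"] by (simp add: fun_eq_iff)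
  have 1: "lie_pow T N u (T X # w) = lie_pow T N (\<lambda>s. u (T X # s)) w" for w
    unfolding Suc.IH[of "T X"] nil zero lie_pow_zero[OF T] by simp
  have "lie_pow T (Suc N) u (X # w) =
     lie_derivative T (\<lambda>s. lie_pow T N u (X # s)) w + lie_pow T N u (T X # w)"
    by simp
  also have "lie_derivative T (\<lambda>s. lie_pow T N u (X # s)) w =
     lie_pow T (Suc N) (\<lambda>s. u (X # s)) w +
     real N *\<^sub>R lie_derivative T (lie_pow T (N - 1) (\<lambda>s. u (T X # s))) w"
    unfolding Suc.IH lie_derivative_add[OF T] lie_derivative_scale[OF T] by simp
  also have "real N *\<^sub>R lie_derivative T (lie_pow T (N - 1) (\<lambda>s. u (T X # s))) w =
     real N *\<^sub>R lie_pow T N (\<lambda>s. u (T X # s)) w"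
    by (cases N) simp_all
  finally show ?case unfolding 1 by (simp add: scaleR_add_left)
qed simp

text \<open>In negative degree the second power of the Lie derivative vanishes, and contracting with a
  word of length \<open>r\<close> uses up at most \<open>r\<close> of the factors.\<close>

lemma lie_pow_vanishes:
  assumes T: "graded_derivation T" and nil: "\<And>X. T (T X) = 0"
  shows "prol_word k u \<Longrightarrow> hom_word d w \<Longrightarrow> length w + 2 \<le> N \<Longrightarrow> lie_pow T N u w = 0"
proof (induction w arbitrary: k u d N)
  case Nil
  show ?case
  proof (cases "k < 0")
    case True
    define X where "X = u []"
    have "u ([] @ s) = foldl brk (u []) s" for s
      by (rule prol_wordD(4)[OF Nil.prems(1)]) (use True in auto)
    then have u_eq: "u = (\<lambda>s. foldl brk X s)" unfolding X_def append_Nil by (rule ext)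
    have ld: "lie_derivative T (foldl brk X) = foldl brk (- T X)" for X
      using lie_derivative_foldl[OF T, of X] by (simp add: fun_eq_iff)
    have "lie_pow T 2 u = foldl brk (- T (- T X))"
      unfolding u_eq by (simp add: numeral_2_eq_2 ld)
    also have "\<dots> = (\<lambda>_. 0)"
      by (simp add: linear_neg[OF graded_derivationD(1)[OF T]] nil fun_eq_iff)
    finally have two: "lie_pow T 2 u = (\<lambda>_. 0)" .
    have N: "N = (N - 2) + 2" using Nil.prems(3) by simp
    show ?thesis by (subst N) (simp only: funpow_add o_apply two lie_pow_zero[OF T])
  next
    case False
    have "lie_pow T N u [] \<in> S (0 - k)"
      by (rule prol_wordD(3)[OF lie_pow_prol_word[OF T Nil.prems(1)]]) simp
    then show ?thesis using False by (simp add: S_def)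
  qed
next
  case (Cons X w)
  then obtain i where i: "1 \<le> i" "X \<in> S i" "hom_word (d - i) w" by auto
  have "lie_pow T N (\<lambda>s. u (X # s)) w = 0"
    by (rule Cons.IH[OF prol_word_Cons[OF Cons.prems(1) i(1,2)] i(3)]) (use Cons.prems in auto)
  moreover have "lie_pow T (N - 1) (\<lambda>s. u (T X # s)) w = 0"
    by (rule Cons.IH[OF prol_word_Cons[OF Cons.prems(1) i(1) graded_derivationD(3)[OF T i(2)]] i(3)])
      (use Cons.prems in auto)
  ultimately show ?case
    unfolding lie_pow_Cons[OF T nil prol_wordD(1)[OF Cons.prems(1)]] by simp
qed

text \<open>Words of at most N - 2 letters are covered by \<open>lie_pow_vanishes\<close>. A longer
  word has a prefix of N - 2 letters, of degree at least N - 2 > k, so its value is an iterated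
  bracket that starts from the value on this prefix, which is 0.\<close>

lemma lie_pow_eq_0:
  assumes T: "graded_derivation T" and nil: "\<And>X. T (T X) = 0" and u: "prol_word k u"
    and N: "2 \<le> N" "k < int N - 2"
  shows "lie_pow T N u = (\<lambda>_. 0)"
proof (rule multilinear_ext_all)
  let ?f = "lie_pow T N u"
  have f: "prol_word k ?f" using lie_pow_prol_word[OF T u] .
  show "multilinear ?f" using prol_wordD(1)[OF f] .
  fix d w assume w: "hom_word d w"
  show "?f w = 0"
  proof (cases "length w + 2 \<le> N")
    case True then show ?thesis using lie_pow_vanishes[OF T nil u w] by simp
  next
    case False
    define p s where "p = take (N - 2) w" and "s = drop (N - 2) w"
    have ps: "w = p @ s" "length p = N - 2" using False by (auto simp: p_def s_def)
    obtain e where e: "hom_word e p" using hom_word_appendE w ps(1) by metis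
    have "k < e" using length_le_degree[OF e] ps(2) N by simp
    then have "?f w = foldl brk (?f p) s" unfolding ps(1) using prol_wordD(4)[OF f e] by blast
    also have "?f p = 0" using lie_pow_vanishes[OF T nil u e] ps(2) N(1) by simp
    finally show ?thesis by simp
  qed
qed

end

section \<open>Prolongation of the semidirect product\<close>

lemma stratified_semidirect:
  assumes "stratified_lie_algebra brk V l"
  shows "stratified_lie_algebra (semidirect_bracket brk) (semidirect_strata V) l"
proof -
  interpret stratified brk V l by unfold_locales (rule assms)
  let ?b = "semidirect_bracket brk" and ?V = "semidirect_strata V"
  have b: "?b (A, B) (C, D) = (brk A D + brk B C, brk B D)" for A B C D
    by (simp add: semidirect_bracket_def)
  have lin: "linear (?b P)" "linear (\<lambda>Q. ?b Q P)" for P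
    by (cases P; rule linearI; clarsimp simp: b brk_linear_simps algebra_simps)+
  have "?b P P = 0" for P
    using brk_antisym[of "fst P" "snd P"] by (cases P) (simp add: b zero_prod_def)
  moreover have "?b P (?b Q R) + ?b Q (?b R P) + ?b R (?b P Q) = 0" for P Q R
  proof -
    obtain A B C D E F where PQR: "P = (A, B)" "Q = (C, D)" "R = (E, F)" by (metis surj_pair)
    \<comment> \<open>The first component is a sum of parts linear in A, in C and in E, and each
      part is a Jacobi identity of the original algebra.\<close>
    have "?b P (?b Q R) + ?b Q (?b R P) + ?b R (?b P Q) =
      ((brk A (brk D F) + brk D (brk F A) + brk F (brk A D)) +
       (brk B (brk C F) + brk C (brk F B) + brk F (brk B C)) +
       (brk B (brk D E) + brk D (brk E B) + brk E (brk B D)),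
       brk B (brk D F) + brk D (brk F B) + brk F (brk B D))"
      unfolding PQR b by (simp add: brk_linear_simps algebra_simps)
    then show ?thesis by (simp add: jacobi_cyclic zero_prod_def)
  qed
  ultimately have lie': "lie_algebra ?b" unfolding lie_algebra_def using lin by blast
  have sub: "subspace (?V j)" if "j \<in> {1..l}" for j
    using subspace_Times[OF subspace_V[OF that] subspace_V[OF that]] by (simp add: semidirect_strata_def)
  have decomp: "\<exists>!x. (\<forall>j\<in>{1..l}. x j \<in> ?V j) \<and> (\<forall>j. j \<notin> {1..l} \<longrightarrow> x j = 0) \<and> P = (\<Sum>j=1..l. x j)" for P
  proof (rule ex1I)
    show "(\<forall>j\<in>{1..l}. (component j (fst P), component j (snd P)) \<in> ?V j) \<and>
        (\<forall>j. j \<notin> {1..l} \<longrightarrow> (component j (fst P), component j (snd P)) = 0) \<and>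
        P = (\<Sum>j=1..l. (component j (fst P), component j (snd P)))"
    proof (intro conjI)
      show "P = (\<Sum>j=1..l. (component j (fst P), component j (snd P)))"
        by (rule prod_eqI) (simp_all only: fst_sum snd_sum fst_conv snd_conv sum_component)
    qed (use component_props in \<open>auto simp: semidirect_strata_def zero_prod_def\<close>)
    fix x assume x: "(\<forall>j\<in>{1..l}. x j \<in> ?V j) \<and> (\<forall>j. j \<notin> {1..l} \<longrightarrow> x j = 0) \<and> P = (\<Sum>j=1..l. x j)"
    show "x = (\<lambda>j. (component j (fst P), component j (snd P)))"
    proof
      fix j
      have "component j (fst P) = fst (x j)"
        by (rule component_unique) (use x in \<open>auto simp: semidirect_strata_def mem_Times_iff fst_sum\<close>)
      moreover have "component j (snd P) = snd (x j)"
        by (rule component_unique) (use x in \<open>auto simp: semidirect_strata_def mem_Times_iff snd_sum\<close>)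
      ultimately show "x j = (component j (fst P), component j (snd P))" by simp
    qed
  qed
  have span: "span {?b P Q | P Q. P \<in> ?V j \<and> Q \<in> ?V 1} = ?V (Suc j)" (is "span ?B = _")
    if j: "j \<in> {1..l}" for j
  proof
    have sV: "subspace (V (Suc j))" unfolding span_brk_V[OF j, symmetric] by (rule subspace_span)
    have in_V: "brk A B \<in> V (Suc j)" if "A \<in> V j" "B \<in> V 1" for A B
      unfolding span_brk_V[OF j, symmetric] by (intro span_base) (use that in blast)
    have in_V': "brk A B \<in> V (Suc j)" if "B \<in> V j" "A \<in> V 1" for A B
      using subspace_neg[OF sV in_V[OF that]] brk_antisym[of A B] by simp
    show "span ?B \<subseteq> ?V (Suc j)"
    proof (rule span_minimal)
      show "subspace (?V (Suc j))" using subspace_Times[OF sV sV] by (simp add: semidirect_strata_def)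
      show "?B \<subseteq> ?V (Suc j)"
        using in_V in_V' subspace_add[OF sV] by (auto simp: semidirect_strata_def b)
    qed
    have V0: "0 \<in> V j" "0 \<in> V 1" using subspace_0[OF subspace_V[OF j]] subspace_0[OF subspace_V[of 1]] l_ge_1 by auto
    let ?G = "{brk A B | A B. A \<in> V j \<and> B \<in> V 1}"
    \<comment> \<open>Either copy of the algebra is embedded linearly by h; it is enough that h
      sends the generating brackets of the next stratum to brackets of the product.\<close>
    have emb: "h ` V (Suc j) \<subseteq> span ?B"
      if lin: "linear h" and h: "\<And>A B. A \<in> V j \<Longrightarrow> B \<in> V 1 \<Longrightarrow> h (brk A B) \<in> ?B" for h
    proof -
      have "h ` V (Suc j) = h ` span ?G" by (simp only: span_brk_V[OF j])
      also have "\<dots> = span (h ` ?G)" by (rule linear_span_image[OF lin, symmetric])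
      also have "\<dots> \<subseteq> span ?B" using h by (intro span_mono) blast
      finally show ?thesis .
    qed
    have emb1: "(\<lambda>A. (A, 0)) ` V (Suc j) \<subseteq> span ?B"
    proof (rule emb)
      show "linear (\<lambda>A::'a. (A, 0 :: 'a))" by (rule linearI) auto
      fix A B assume "A \<in> V j" "B \<in> V 1"
      then have "(brk A B, 0) = ?b (A, 0) (0, B)" "(A, 0) \<in> ?V j" "(0, B) \<in> ?V 1"
        using V0 by (auto simp: b semidirect_strata_def)
      then show "(brk A B, 0) \<in> ?B" by blast
    qed
    have emb2: "(\<lambda>A. (0, A)) ` V (Suc j) \<subseteq> span ?B"
    proof (rule emb)
      show "linear (\<lambda>A::'a. (0 :: 'a, A))" by (rule linearI) auto
      fix A B assume "A \<in> V j" "B \<in> V 1"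
      then have "(0, brk A B) = ?b (0, A) (0, B)" "(0, A) \<in> ?V j" "(0, B) \<in> ?V 1"
        using V0 by (auto simp: b semidirect_strata_def)
      then show "(0, brk A B) \<in> ?B" by blast
    qed
    show "?V (Suc j) \<subseteq> span ?B"
    proof
      fix P assume "P \<in> ?V (Suc j)"
      then have "(fst P, 0) \<in> span ?B" "(0, snd P) \<in> span ?B"
        using emb1 emb2 by (auto simp: semidirect_strata_def)
      from span_add[OF this] show "P \<in> span ?B" by simp
    qed
  qed
  have "?V l \<noteq> {0}"
  proof -
    have "V l \<noteq> {0}" using assms unfolding stratified_lie_algebra_def by blast
    moreover have "0 \<in> V l" using subspace_0[OF subspace_V[of l]] l_ge_1 by auto
    ultimately obtain A where "A \<in> V l" "A \<noteq> 0" by blast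
    then have "(A, A) \<in> ?V l" "(A, A) \<noteq> 0" by (auto simp: semidirect_strata_def zero_prod_def)
    then show ?thesis by blast
  qed
  moreover have "?V (Suc l) = {0}" using V_Suc_l by (simp add: semidirect_strata_def zero_prod_def)
  moreover have "3 \<le> DIM('a \<times> 'a)" using assms by (simp add: stratified_lie_algebra_def)
  ultimately show ?thesis
    unfolding stratified_lie_algebra_def using lie' l_ge_1 sub decomp span by blast
qed

locale tangent_algebra = stratified brk V l for brk :: "'a::euclidean_space \<Rightarrow> 'a \<Rightarrow> 'a" and V l
begin

sublocale h: stratified "semidirect_bracket brk" "semidirect_strata V" l
  by unfold_locales (rule stratified_semidirect[OF stratified])

lemma semidirect_bracket_simp [simp]:
  "semidirect_bracket brk (A, B) (C, D) = (brk A D + brk B C, brk B D)"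
  by (simp add: semidirect_bracket_def)

lemma h_S: "h.S i = S i \<times> S i"
  by (auto simp: h.S_def S_def semidirect_strata_def zero_prod_def)

text \<open>The map from Z to \<epsilon>Z alone is in general not a derivation, since both summands
  of the Leibniz rule contribute the full bracket. The degree factor repairs this, and it is
  invertible on every stratum.\<close>

definition eps_grading :: "'a \<times> 'a \<Rightarrow> 'a \<times> 'a" where
  "eps_grading P = (grading (snd P), 0)"

lemma eps_grading: "h.graded_derivation eps_grading"
  unfolding h.graded_derivation_def
proof (intro conjI allI impI)
  show "linear eps_grading"
    by (rule linearI) (auto simp: eps_grading_def linear_add[OF linear_grading] linear_scale[OF linear_grading])
  fix P Q
  show "eps_grading (semidirect_bracket brk P Q) =
     semidirect_bracket brk (eps_grading P) Q + semidirect_bracket brk P (eps_grading Q)"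
    by (cases P; cases Q) (simp add: eps_grading_def grading_brk)
next
  fix i P assume "P \<in> h.S i"
  then show "eps_grading P \<in> h.S i"
    using grading_S[of "snd P" i] subspace_scale[OF subspace_S] by (auto simp: h_S eps_grading_def)
qed

lemma eps_grading_nilpotent: "eps_grading (eps_grading P) = 0"
  by (simp add: eps_grading_def linear_0[OF linear_grading] zero_prod_def)

abbreviation "hbrk \<equiv> semidirect_bracket brk"
abbreviation "Z_word w \<equiv> map (Pair (0::'a)) w"
abbreviation "positive_letters w \<equiv> set w \<subseteq> (\<Union>i\<in>{1..}. S i)"

abbreviation x_pow :: "nat \<Rightarrow> (('a \<times> 'a) list \<Rightarrow> 'a \<times> 'a) \<Rightarrow> ('a \<times> 'a) list \<Rightarrow> 'a \<times> 'a" where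
  "x_pow N \<equiv> h.lie_derivative eps_grading ^^ N"

lemma hom_word_Z: "hom_word d w \<Longrightarrow> h.hom_word d (Z_word w)"
  by (induction w arbitrary: d) (auto simp: h_S)

lemma foldl_Z: "foldl hbrk P (Z_word w) = (foldl brk (fst P) w, foldl brk (snd P) w)"
  by (induction w arbitrary: P) (auto simp: semidirect_bracket_def case_prod_beta)

text \<open>The map p stands for \<open>fst\<close> or \<open>snd\<close>. Under right brackets with
  elements (0, Z) both components of h are copies of the adjoint module of g, so each component of
  u, restricted to words in g, belongs to the prolongation of g.\<close>

lemma prol_word_restrict:
  assumes u: "h.prol_word k u" and p: "linear p" "\<And>P s. p (foldl hbrk P (Z_word s)) = foldl brk (p P) s"
    "\<And>i P. P \<in> h.S i \<Longrightarrow> p P \<in> S i"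
  shows "prol_word k (\<lambda>w. p (u (Z_word w)))"
  unfolding prol_word_def
proof (intro conjI allI impI)
  have emb: "linear (Pair (0::'a) :: 'a \<Rightarrow> 'a \<times> 'a)" by (rule linearI) auto
  show "multilinear (\<lambda>w. p (u (Z_word w)))"
    unfolding multilinear_def
  proof (intro allI)
    fix r s
    have "linear (\<lambda>P. u (Z_word r @ P # Z_word s))"
      using h.prol_wordD(1)[OF u] unfolding h.multilinear_def by blast
    from linear_compose[OF linear_compose[OF emb this] p(1)]
    show "linear (\<lambda>X. p (u (Z_word (r @ X # s))))" by (simp add: o_def)
  qed
  show "commuting (\<lambda>w. p (u (Z_word w)))"
    unfolding commuting_def
  proof (intro allI)
    fix r X Y s
    have "u (Z_word r @ hbrk (0, X) (0, Y) # Z_word s) =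
       u (Z_word r @ (0, X) # (0, Y) # Z_word s) -
       u (Z_word r @ (0, Y) # (0, X) # Z_word s)"
      by (rule h.commutingD[OF h.prol_wordD(2)[OF u]])
    then show "p (u (Z_word (r @ brk X Y # s))) =
       p (u (Z_word (r @ X # Y # s))) - p (u (Z_word (r @ Y # X # s)))"
      by (simp add: linear_diff[OF p(1)])
  qed
  fix d w assume w: "hom_word d w"
  show "p (u (Z_word w)) \<in> S (d - k)"
    by (rule p(3)[OF h.prol_wordD(3)[OF u hom_word_Z[OF w]]])
next
  fix d w s assume w: "hom_word d w \<and> k < d"
  then have "u (Z_word w @ Z_word s) =
     foldl hbrk (u (Z_word w)) (Z_word s)"
    using h.prol_wordD(4)[OF u hom_word_Z] by blast
  then show "p (u (Z_word (w @ s))) = foldl brk (p (u (Z_word w))) s"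
    by (simp add: p(2))
qed

lemma Z_words_vanish:
  assumes bound: "\<forall>k u. m < k \<longrightarrow> prol_word k u \<longrightarrow> u = (\<lambda>_. 0)"
    and u: "h.prol_word k u" "m < k"
  shows "u (Z_word w) = 0"
proof -
  have "prol_word k (\<lambda>w. fst (u (Z_word w)))"
    by (rule prol_word_restrict[OF u(1)]) (auto simp: linear_fst foldl_Z h_S)
  moreover have "prol_word k (\<lambda>w. snd (u (Z_word w)))"
    by (rule prol_word_restrict[OF u(1)]) (auto simp: linear_snd foldl_Z h_S)
  ultimately have "fst (u (Z_word w)) = 0" "snd (u (Z_word w)) = 0"
    using bound u(2) by meson+
  then show ?thesis by (simp add: prod_eq_iff)
qed

lemma x_pow_Z_words_vanish:
  assumes bound: "\<forall>k u. m < k \<longrightarrow> prol_word k u \<longrightarrow> u = (\<lambda>_. 0)"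
    and u: "h.prol_word k u" and N: "2 \<le> N" "m + 2 < int N"
  shows "x_pow N u (Z_word w) = 0"
proof (cases "k < int N - 2")
  case True
  then show ?thesis using h.lie_pow_eq_0[OF eps_grading eps_grading_nilpotent u N(1)] by simp
next
  case False
  then have "m < k" using N by simp
  then show ?thesis
    using Z_words_vanish[OF bound h.lie_pow_prol_word[OF eps_grading u]] by blast
qed

section \<open>Sorting words: letters of the abelian ideal first, letters of g last\<close>

definition Y_letter :: "'a \<times> 'a \<Rightarrow> bool" where
  "Y_letter y \<longleftrightarrow> (\<exists>i\<ge>1. \<exists>Y\<in>S i. y = (Y, 0))"

lemma Y_letterI: "1 \<le> i \<Longrightarrow> Y \<in> S i \<Longrightarrow> Y_letter (Y, 0)"
  unfolding Y_letter_def by blast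

abbreviation Y_word :: "('a \<times> 'a) list \<Rightarrow> bool" where
  "Y_word ys \<equiv> (\<forall>y\<in>set ys. Y_letter y)"

text \<open>A nonzero letter has degree at most l, and a zero letter may be counted with degree 1.
  The resulting bound on the degree enters the final estimate.\<close>

lemma Y_word_homogeneous:
  assumes "Y_word ys"
  obtains d where "h.hom_word d ys" "d \<le> int (length ys * l)"
proof -
  have "\<exists>d. h.hom_word d ys \<and> d \<le> int (length ys * l)"
    using assms
  proof (induction ys)
    case (Cons y ys)
    then obtain d where d: "h.hom_word d ys" "d \<le> int (length ys * l)" by auto
    obtain i Y where y: "1 \<le> i" "Y \<in> S i" "y = (Y, 0)" using Cons.prems by (auto simp: Y_letter_def)
    obtain j where j: "1 \<le> j" "j \<le> int l" "Y \<in> S j"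
    proof (cases "i \<le> int l")
      case True then show ?thesis using that y by blast
    next
      case False
      then have "Y \<in> S 1" using y(2) by (simp add: S_def[of i])
      then show ?thesis using that[of 1] l_ge_1 by simp
    qed
    have "h.hom_word (j + d) (y # ys)"
      using j d(1) by (auto simp: y(3) h_S intro!: exI[of _ j])
    moreover have "j + d \<le> int (length (y # ys) * l)" using j d(2) by (simp add: algebra_simps)
    ultimately show ?case by blast
  qed auto
  then show ?thesis using that by blast
qed

text \<open>Z y = y Z + [Z, y], and [Z, y] is again a letter of the abelian ideal. The term with
  [Z, y] is already sorted and has r such letters; in the other one Z has fewer letters left to
  pass.\<close>

lemma move_Z_right:
  assumes com: "h.commuting f" and zero: "\<And>ys w. Y_word ys \<Longrightarrow> length ys = r \<Longrightarrow> f (ys @ Z_word w) = 0"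
    and Z: "Z \<in> S i" "1 \<le> i"
  shows "Y_word p \<Longrightarrow> Y_word ys \<Longrightarrow> length p + length ys = r \<Longrightarrow> f (p @ (0, Z) # ys @ Z_word w) = 0"
proof (induction ys arbitrary: p)
  case Nil
  have "f (p @ Z_word (Z # w)) = 0" using Nil by (intro zero) auto
  then show ?case by simp
next
  case (Cons y ys)
  obtain j Y where y: "1 \<le> j" "Y \<in> S j" "y = (Y, 0)" using Cons.prems by (auto simp: Y_letter_def)
  have br: "hbrk (0, Z) y = (brk Z Y, 0)" by (simp add: y(3))
  have YZ: "brk Z Y \<in> S (i + j)" using brk_S[OF Z(1) y(2)] .
  have "f ((p @ [y]) @ (0, Z) # ys @ Z_word w) = 0"
    using Cons.prems by (intro Cons.IH) auto
  moreover have "f ((p @ (brk Z Y, 0) # ys) @ Z_word w) = 0"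
    using Cons.prems Y_letterI[OF _ YZ] y(1) Z(2) by (intro zero) auto
  moreover have "f (p @ hbrk (0, Z) y # ys @ Z_word w) =
     f (p @ (0, Z) # y # ys @ Z_word w) - f (p @ y # (0, Z) # ys @ Z_word w)"
    by (rule h.commutingD[OF com])
  ultimately show ?case by (simp add: br)
qed

text \<open>The derivation kills every letter of \<open>ys\<close>, so the second term of
  \<open>lie_pow_Cons\<close> drops out each time.\<close>

lemma x_pow_Y_word:
  assumes "Y_word ys" "h.multilinear u"
  shows "x_pow N u (ys @ w) = x_pow N (\<lambda>s. u (ys @ s)) w"
  using assms
proof (induction ys arbitrary: u)
  case (Cons y ys)
  obtain j Y where y: "y = (Y, 0)" using Cons.prems by (auto simp: Y_letter_def)
  have y0: "eps_grading y = 0" by (simp add: y eps_grading_def linear_0[OF linear_grading] zero_prod_def)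
  have "(\<lambda>s. u (0 # s)) = (\<lambda>_. 0)" using h.multilinear_0[OF Cons.prems(2), of "[]"] by (simp add: fun_eq_iff)
  then have "x_pow N u (y # ys @ w) = x_pow N (\<lambda>s. u (y # s)) (ys @ w)"
    unfolding h.lie_pow_Cons[OF eps_grading eps_grading_nilpotent Cons.prems(2)]
    by (simp add: y0 h.lie_pow_zero[OF eps_grading])
  then show ?case using Cons.IH[OF _ h.multilinear_Cons[OF Cons.prems(2)]] Cons.prems(1) by simp
qed simp

text \<open>Trading a factor of the Lie derivative for a contraction with an element of the abelian ideal,
  using \<open>\<epsilon>Z = T(Z) / i\<close> for \<open>Z\<close> of degree \<open>-i\<close>.\<close>

lemma x_pow_contractions_vanish:
  assumes bound: "\<forall>k u. m < k \<longrightarrow> prol_word k u \<longrightarrow> u = (\<lambda>_. 0)"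
    and N0: "2 \<le> N0" "m + 2 < int N0"
  shows "r \<le> N0 \<Longrightarrow> h.prol_word k u \<Longrightarrow> Y_word ys \<Longrightarrow> length ys = r \<Longrightarrow>
    x_pow (N0 - r) u (ys @ Z_word w) = 0"
proof (induction r arbitrary: k u ys w)
  case 0
  then show ?case using x_pow_Z_words_vanish[OF bound _ N0] by simp
next
  case (Suc r)
  obtain y ys' where ys: "ys = y # ys'" "length ys' = r" "Y_word ys'"
    using Suc.prems by (cases ys) auto
  obtain i Z where y: "1 \<le> i" "Z \<in> S i" "y = (Z, 0)" using Suc.prems(3) ys(1) by (auto simp: Y_letter_def)
  define N where "N = N0 - r"
  have N: "N0 - Suc r = N - 1" "1 \<le> N" using Suc.prems(1) by (auto simp: N_def)
  have IH: "x_pow N u (ys @ Z_word w) = 0" if "h.prol_word k u" "Y_word ys" "length ys = r" for k u ys w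
    using Suc.IH[OF _ that] Suc.prems(1) by (simp add: N_def)
  have Z: "(0, Z) \<in> h.S i" using y(2) by (simp add: h_S)
  have ml: "h.multilinear u" using h.prol_wordD(1)[OF Suc.prems(2)] .
  \<comment> \<open>With Z in place of y the word has only r letters of the abelian ideal, so the
    induction hypothesis applies once Z has been moved behind them.\<close>
  have "x_pow N u ([] @ (0, Z) # ys' @ Z_word w) = 0"
    by (rule move_Z_right[OF h.prol_wordD(2)[OF h.lie_pow_prol_word[OF eps_grading Suc.prems(2)]] IH[OF Suc.prems(2)] y(2,1)])
      (use ys in auto)
  moreover have "x_pow N (\<lambda>s. u ((0, Z) # s)) (ys' @ Z_word w) = 0"
    by (rule IH[OF h.prol_word_Cons[OF Suc.prems(2) y(1) Z] ys(3,2)])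
  \<comment> \<open>Two of the three terms in \<open>lie_pow_Cons\<close> vanish, and the
    coefficient N of the third is positive.\<close>
  ultimately have "x_pow (N - 1) (\<lambda>s. u (eps_grading (0, Z) # s)) (ys' @ Z_word w) = 0"
    using N(2) h.lie_pow_Cons[OF eps_grading eps_grading_nilpotent ml, of N "(0, Z)"] by simp
  moreover have "eps_grading (0, Z) = of_int i *\<^sub>R y"
    using grading_S[OF y(2)] by (simp add: eps_grading_def y(3))
  moreover have "(\<lambda>s. u (of_int i *\<^sub>R y # s)) = (\<lambda>s. of_int i *\<^sub>R u (y # s))"
  proof
    fix s
    have "linear (\<lambda>P. u ([] @ P # s))" using ml unfolding h.multilinear_def by blast
    from linear_scale[OF this] show "u (of_int i *\<^sub>R y # s) = of_int i *\<^sub>R u (y # s)" by simp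
  qed
  moreover have "x_pow (N - 1) (\<lambda>s. a *\<^sub>R f s) = (\<lambda>s. a *\<^sub>R x_pow (N - 1) f s)" for a f
  proof -
    have "h.lie_derivative eps_grading (\<lambda>s. a *\<^sub>R f s) = (\<lambda>s. a *\<^sub>R h.lie_derivative eps_grading f s)" for f
      by (rule ext) (rule h.lie_derivative_scale[OF eps_grading])
    then have "x_pow M (\<lambda>s. a *\<^sub>R f s) = (\<lambda>s. a *\<^sub>R x_pow M f s)" for M
      by (induction M) simp_all
    then show ?thesis .
  qed
  ultimately have "x_pow (N - 1) (\<lambda>s. u (y # s)) (ys' @ Z_word w) = 0"
    using y(1) by simp
  then have "x_pow (N - 1) (\<lambda>s. u (ys @ s)) (Z_word w) = 0"
    using x_pow_Y_word[OF ys(3) h.multilinear_Cons[OF ml], of "N - 1" y] by (simp add: ys(1))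
  then show ?case using x_pow_Y_word[OF Suc.prems(3) ml] by (simp add: N(1))
qed

text \<open>Moving Y to the left past the last letter Z of w produces the extra letter [Z, Y] of the
  abelian ideal. In both resulting words fewer letters of g stand before the letter to be moved,
  while the tail v stays unsorted.\<close>

lemma normal_ordering:
  assumes com: "h.commuting f" and zero: "\<And>ys w. Y_word ys \<Longrightarrow> positive_letters w \<Longrightarrow> f (ys @ Z_word w @ v) = 0"
    and y: "1 \<le> j" "Y \<in> S j"
  shows "Y_word ys \<Longrightarrow> positive_letters w \<Longrightarrow> positive_letters w' \<Longrightarrow>
    f (ys @ Z_word w @ (Y, 0) # Z_word w' @ v) = 0"
  using y
proof (induction w arbitrary: w' Y j rule: rev_induct)
  case Nil
  have "f ((ys @ [(Y, 0)]) @ Z_word w' @ v) = 0"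
    using Nil Y_letterI by (intro zero) auto
  then show ?case by simp
next
  case (snoc Z w)
  obtain i where i: "1 \<le> i" "Z \<in> S i" using snoc.prems by auto
  have "f (ys @ Z_word w @ (Y, 0) # Z_word (Z # w') @ v) = 0"
    using snoc.prems by (intro snoc.IH) auto
  moreover have "f (ys @ Z_word w @ (brk Z Y, 0) # Z_word w' @ v) = 0"
    by (rule snoc.IH[OF _ _ _ _ brk_S[OF i(2) snoc.prems(5)]]) (use snoc.prems i in auto)
  moreover have "f ((ys @ Z_word w) @ hbrk (0, Z) (Y, 0) # Z_word w' @ v) =
     f ((ys @ Z_word w) @ (0, Z) # (Y, 0) # Z_word w' @ v) -
     f ((ys @ Z_word w) @ (Y, 0) # (0, Z) # Z_word w' @ v)"
    by (rule h.commutingD[OF com])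
  ultimately show ?case by simp
qed

text \<open>Induction on the unsorted tail: its first letter is split into (Y, 0) and (0, Z); the
  latter joins the block of letters of g, and the former is moved in front of that block by
  \<open>normal_ordering\<close>.\<close>

lemma vanishes_if_normal_words_vanish:
  assumes f: "h.multilinear f" "h.commuting f"
    and zero: "\<And>ys w. Y_word ys \<Longrightarrow> f (ys @ Z_word w) = 0"
  shows "f = (\<lambda>_. 0)"
proof (rule h.multilinear_ext_all[OF f(1)])
  fix d v assume "h.hom_word d v"
  have "h.hom_word d v \<Longrightarrow> Y_word ys \<Longrightarrow> positive_letters w \<Longrightarrow>
    f (ys @ Z_word w @ v) = 0" for ys w d
  proof (induction v arbitrary: ys w d)
    case Nil
    then show ?case using zero by simp
  next
    case (Cons P v)
    then obtain i where i: "1 \<le> i" "P \<in> h.S i" "h.hom_word (d - i) v" by auto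
    obtain Y Z where P: "P = (Y, 0) + (0, Z)" "Y \<in> S i" "Z \<in> S i" using i(2) by (auto simp: h_S)
    have lin: "linear (\<lambda>P. f ((ys @ Z_word w) @ P # v))"
      using f(1) unfolding h.multilinear_def by blast
    have "f (ys @ Z_word (w @ [Z]) @ v) = 0"
      using Cons.prems P(3) i by (intro Cons.IH[of "d - i"]) auto
    moreover have "f (ys @ Z_word w @ (Y, 0) # Z_word [] @ v) = 0"
      by (rule normal_ordering[OF f(2) Cons.IH[OF i(3)] i(1) P(2)]) (use Cons.prems in auto)
    ultimately show ?case using linear_add[OF lin, of "(Y, 0)" "(0, Z)"] by (simp add: P(1))
  qed
  from this[of d "[]" "[]"] show "f v = 0" using \<open>h.hom_word d v\<close> by simp
qed

theorem prol_finite_dim_semidirect: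
  assumes "prol_finite_dim brk V l"
  shows "prol_finite_dim (semidirect_bracket brk) (semidirect_strata V) l"
proof -
  obtain m where m: "0 \<le> m" and bound: "\<forall>k u. m < k \<longrightarrow> prol_word k u \<longrightarrow> u = (\<lambda>_. 0)"
    using prol_finite_dim_imp_degree_bound[OF assms] by metis
  define N0 where "N0 = nat (m + 3)"
  have N0: "2 \<le> N0" "m + 2 < int N0" using m by (auto simp: N0_def)
  show ?thesis
  proof (rule h.degree_bound_imp_prol_finite_dim)
    \<comment> \<open>Up to N0 letters of the abelian ideal lower the degree by at most N0 l, so the
      contracted element still has degree above m and vanishes on words in g.\<close>
    fix k u assume k: "m + int (N0 * l) < k" and u: "h.prol_word k u"
    show "u = (\<lambda>_. 0)"
    proof (rule vanishes_if_normal_words_vanish[OF h.prol_wordD(1,2)[OF u]])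
      fix ys w assume ys: "Y_word ys"
      show "u (ys @ Z_word w) = 0"
      proof (cases "length ys \<le> N0")
        case True
        obtain d where d: "h.hom_word d ys" "d \<le> int (length ys * l)"
          using Y_word_homogeneous[OF ys] by blast
        have "int (length ys * l) \<le> int (N0 * l)" using True by (simp add: mult_right_mono)
        then have "m < k - d" using k d(2) by linarith
        from Z_words_vanish[OF bound h.prol_word_append[OF u d(1)] this] show ?thesis by simp
      next
        case False
        define p q where "p = take (length ys - N0) ys" and "q = drop (length ys - N0) ys"
        have pq: "ys = p @ q" "length q = N0" using False by (auto simp: p_def q_def)
        have "Y_word p" "Y_word q" using ys unfolding pq(1) by auto
        obtain d where d: "h.hom_word d p" using Y_word_homogeneous[OF \<open>Y_word p\<close>] by blast
        \<comment> \<open>N0 contractions use up all N0 factors of the Lie derivative, so the zeroth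
          power, the element itself, vanishes.\<close>
        have "x_pow (N0 - N0) (\<lambda>s. u (p @ s)) (q @ Z_word w) = 0"
          by (rule x_pow_contractions_vanish[OF bound N0 order_refl h.prol_word_append[OF u d] \<open>Y_word q\<close> pq(2)])
        then show ?thesis by (simp add: pq(1))
      qed
    qed
  qed
qed

end

section \<open>Smooth maps\<close>

abbreviation der :: "('a::real_normed_vector \<Rightarrow> 'b::real_normed_vector) \<Rightarrow> 'a \<Rightarrow> 'a \<Rightarrow> 'b" where
  "der f x \<equiv> frechet_derivative f (at x)"

lemma C_k_SucI:
  assumes "\<And>x. (f has_derivative f' x) (at x)" "\<And>v. C_k k (\<lambda>x. f' x v)"
  shows "C_k (Suc k) f"
proof -
  have "der f x = f' x" for x using frechet_derivative_at[OF assms(1)] by simp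
  then show ?thesis using assms unfolding C_k.simps by (auto intro: differentiableI)
qed

lemma C_k_SucD:
  assumes "C_k (Suc k) f"
  shows "(f has_derivative der f x) (at x)"
    "C_k k (\<lambda>x. der f x v)"
  using assms frechet_derivative_works by auto

lemma C_k_Suc_imp: "C_k (Suc k) f \<Longrightarrow> C_k k f"
proof (induction k arbitrary: f)
  case 0
  then show ?case
    using differentiable_imp_continuous_on[of f UNIV] by (simp add: differentiable_on_def)
next
  case (Suc k)
  show ?case
    by (rule C_k_SucI[OF C_k_SucD(1)[OF Suc.prems]]) (rule Suc.IH[OF C_k_SucD(2)[OF Suc.prems]])
qed

lemma C_k_continuous: "C_k k f \<Longrightarrow> continuous_on UNIV f"
  by (induction k arbitrary: f) (simp, metis C_k_Suc_imp)

lemma C_k_const: "C_k k (\<lambda>x. c)"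
  by (induction k arbitrary: c) (simp, rule C_k_SucI[OF has_derivative_const], simp)

lemma C_k_bounded_linear: "bounded_linear f \<Longrightarrow> C_k k f"
proof (cases k)
  case 0
  assume "bounded_linear f"
  then show ?thesis using 0 linear_continuous_on by auto
next
  case (Suc j)
  assume f: "bounded_linear f"
  show ?thesis unfolding Suc
    by (rule C_k_SucI[OF bounded_linear_imp_has_derivative[OF f]]) (rule C_k_const)
qed

lemma C_k_add: "C_k k f \<Longrightarrow> C_k k g \<Longrightarrow> C_k k (\<lambda>x. f x + g x)"
proof (induction k arbitrary: f g)
  case (Suc k)
  show ?case
    by (rule C_k_SucI[OF has_derivative_add[OF C_k_SucD(1)[OF Suc.prems(1)] C_k_SucD(1)[OF Suc.prems(2)]]])
      (rule Suc.IH[OF C_k_SucD(2)[OF Suc.prems(1)] C_k_SucD(2)[OF Suc.prems(2)]])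
qed (simp add: continuous_on_add)

lemma C_k_sum: "(\<And>i. i \<in> I \<Longrightarrow> C_k k (f i)) \<Longrightarrow> C_k k (\<lambda>x. \<Sum>i\<in>I. f i x)"
  by (induction I rule: infinite_finite_induct) (auto intro: C_k_add C_k_const)

lemma C_k_scaleR: "C_k k f \<Longrightarrow> C_k k g \<Longrightarrow> C_k k (\<lambda>x. f x *\<^sub>R g x)"
proof (induction k arbitrary: f g)
  case (Suc k)
  show ?case
    by (rule C_k_SucI[OF has_derivative_scaleR[OF C_k_SucD(1)[OF Suc.prems(1)] C_k_SucD(1)[OF Suc.prems(2)]]])
      (intro C_k_add Suc.IH C_k_SucD(2)[OF Suc.prems(1)] C_k_SucD(2)[OF Suc.prems(2)]
        C_k_Suc_imp[OF Suc.prems(1)] C_k_Suc_imp[OF Suc.prems(2)])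
qed (simp add: continuous_on_scaleR)

lemma C_k_linear_compose: "bounded_linear h \<Longrightarrow> C_k k f \<Longrightarrow> C_k k (\<lambda>x. h (f x))"
proof (induction k arbitrary: f)
  case 0
  then show ?case using bounded_linear.continuous_on by auto
next
  case (Suc k)
  show ?case
    by (rule C_k_SucI[OF bounded_linear.has_derivative[OF Suc.prems(1) C_k_SucD(1)[OF Suc.prems(2)]]])
      (rule Suc.IH[OF Suc.prems(1) C_k_SucD(2)[OF Suc.prems(2)]])
qed

text \<open>\<open>C_k\<close> differentiates in fixed directions, whereas the direction
  \<open>der g x v\<close> varies with x; it is expanded in the basis before the induction
  hypothesis is applied.\<close>

lemma C_k_compose:
  fixes f :: "'b::euclidean_space \<Rightarrow> 'c::real_normed_vector" and g :: "'a::real_normed_vector \<Rightarrow> 'b"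
  shows "C_k k f \<Longrightarrow> C_k k g \<Longrightarrow> C_k k (\<lambda>x. f (g x))"
proof (induction k arbitrary: f g)
  case 0
  then show ?case by (auto intro: continuous_on_compose2)
next
  case (Suc k)
  show ?case
  proof (rule C_k_SucI)
    fix x
    show "((\<lambda>x. f (g x)) has_derivative
       (\<lambda>v. der f (g x) (der g x v))) (at x)"
      by (rule has_derivative_compose[OF C_k_SucD(1)[OF Suc.prems(2)] C_k_SucD(1)[OF Suc.prems(1)]])
  next
    fix v
    have lin: "linear (der f y)" for y
      using C_k_SucD(1)[OF Suc.prems(1)] has_derivative_linear by blast
    have "der f (g x) (der g x v) =
      (\<Sum>b\<in>Basis. (der g x v \<bullet> b) *\<^sub>R der f (g x) b)" for x
      by (subst euclidean_representation[symmetric, of "der g x v"])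
        (simp only: linear_sum[OF lin] linear_scale[OF lin])
    moreover have "C_k k (\<lambda>x. \<Sum>b\<in>Basis. (der g x v \<bullet> b) *\<^sub>R der f (g x) b)"
      by (intro C_k_sum C_k_scaleR Suc.IH C_k_SucD(2)[OF Suc.prems(1)] C_k_Suc_imp[OF Suc.prems(2)]
          C_k_linear_compose[OF bounded_linear_inner_left C_k_SucD(2)[OF Suc.prems(2)]])
    ultimately show "C_k k (\<lambda>x. der f (g x) (der g x v))" by simp
  qed
qed

lemma smooth_C_k: "smooth f \<Longrightarrow> C_k k f"
  unfolding smooth_def by blast

lemma smooth_has_derivative:
  "smooth f \<Longrightarrow> (f has_derivative der f x) (at x)"
  by (rule C_k_SucD(1)[OF smooth_C_k])

lemma smooth_linear_derivative: "smooth f \<Longrightarrow> linear (der f x)"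
  using smooth_has_derivative has_derivative_linear by blast

lemma smooth_derivative: "smooth f \<Longrightarrow> smooth (\<lambda>x. der f x v)"
  unfolding smooth_def using C_k_SucD(2) by blast

lemma smooth_continuous: "smooth f \<Longrightarrow> continuous_on UNIV f"
  using smooth_C_k C_k_continuous by blast

lemma smooth_const: "smooth (\<lambda>x. c)"
  unfolding smooth_def by (simp add: C_k_const)

lemma smooth_id: "smooth (\<lambda>x. x)"
  unfolding smooth_def by (simp add: C_k_bounded_linear bounded_linear_ident)

lemma smooth_add: "smooth f \<Longrightarrow> smooth g \<Longrightarrow> smooth (\<lambda>x. f x + g x)"
  unfolding smooth_def by (simp add: C_k_add)

lemma smooth_sum: "(\<And>i. i \<in> I \<Longrightarrow> smooth (f i)) \<Longrightarrow> smooth (\<lambda>x. \<Sum>i\<in>I. f i x)"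
  unfolding smooth_def by (simp add: C_k_sum)

lemma smooth_scaleR: "smooth f \<Longrightarrow> smooth g \<Longrightarrow> smooth (\<lambda>x. f x *\<^sub>R g x)"
  unfolding smooth_def by (simp add: C_k_scaleR)

lemma smooth_bounded_linear: "bounded_linear h \<Longrightarrow> smooth f \<Longrightarrow> smooth (\<lambda>x. h (f x))"
  unfolding smooth_def by (simp add: C_k_linear_compose)

lemma smooth_linear:
  fixes h :: "'b::euclidean_space \<Rightarrow> 'c::real_normed_vector"
  shows "linear h \<Longrightarrow> smooth f \<Longrightarrow> smooth (\<lambda>x. h (f x))"
  by (rule smooth_bounded_linear) (simp only: linear_conv_bounded_linear[symmetric])

lemma smooth_compose:
  fixes f :: "'b::euclidean_space \<Rightarrow> 'c::real_normed_vector"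
  shows "smooth f \<Longrightarrow> smooth g \<Longrightarrow> smooth (\<lambda>x. f (g x))"
  unfolding smooth_def by (simp add: C_k_compose)

lemma smooth_Pair:
  assumes "smooth f" "smooth g"
  shows "smooth (\<lambda>x. (f x, g x))"
proof -
  have "bounded_linear (\<lambda>y. (y, 0::'c))" "bounded_linear (\<lambda>y. (0::'b, y))"
    by (auto intro!: bounded_linear_Pair bounded_linear_ident bounded_linear_zero)
  from smooth_add[OF smooth_bounded_linear[OF this(1) assms(1)] smooth_bounded_linear[OF this(2) assms(2)]]
  show ?thesis by simp
qed

lemma smooth_fst: "smooth f \<Longrightarrow> smooth (\<lambda>x. fst (f x))"
  by (rule smooth_bounded_linear[OF bounded_linear_fst])

lemma smooth_snd: "smooth f \<Longrightarrow> smooth (\<lambda>x. snd (f x))"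
  by (rule smooth_bounded_linear[OF bounded_linear_snd])

lemmas smooth_intros = smooth_const smooth_id smooth_add smooth_scaleR smooth_Pair smooth_fst smooth_snd

lemma form_expansion:
  fixes \<alpha> :: "'b::euclidean_space \<Rightarrow> 'c::real_vector"
  assumes "linear \<alpha>"
  shows "\<alpha> \<xi> = (\<Sum>b\<in>Basis. (\<xi> \<bullet> b) *\<^sub>R \<alpha> b)"
  by (subst euclidean_representation[symmetric, of \<xi>]) (simp only: linear_sum[OF assms] linear_scale[OF assms])

lemma form_has_derivative:
  fixes \<alpha> :: "'a::euclidean_space \<Rightarrow> 'b::euclidean_space \<Rightarrow> 'c::real_normed_vector"
  assumes sm: "\<And>\<xi>. smooth (\<lambda>z. \<alpha> z \<xi>)" and lin: "\<And>z. linear (\<alpha> z)"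
    and a: "(a has_derivative a') (at x)" and b: "(b has_derivative b') (at x)"
  shows "((\<lambda>x. \<alpha> (a x) (b x)) has_derivative
    (\<lambda>v. der (\<lambda>z. \<alpha> z (b x)) (a x) (a' v) + \<alpha> (a x) (b' v))) (at x)"
proof -
  note expand = form_expansion[OF lin]
  have d: "((\<lambda>x. \<alpha> (a x) i) has_derivative (\<lambda>v. der (\<lambda>z. \<alpha> z i) (a x) (a' v))) (at x)" for i
    by (rule has_derivative_compose[OF a smooth_has_derivative[OF sm]])
  have "((\<lambda>x. \<Sum>i\<in>Basis. (b x \<bullet> i) *\<^sub>R \<alpha> (a x) i) has_derivative
     (\<lambda>v. \<Sum>i\<in>Basis. (b x \<bullet> i) *\<^sub>R der (\<lambda>z. \<alpha> z i) (a x) (a' v) + (b' v \<bullet> i) *\<^sub>R \<alpha> (a x) i)) (at x)"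
    by (intro has_derivative_sum has_derivative_scaleR d bounded_linear.has_derivative[OF bounded_linear_inner_left b])
  moreover have "der (\<lambda>z. \<alpha> z (b x)) (a x) =
     (\<lambda>v. \<Sum>i\<in>Basis. (b x \<bullet> i) *\<^sub>R der (\<lambda>z. \<alpha> z i) (a x) v)"
  proof -
    have "((\<lambda>z. \<Sum>i\<in>Basis. (b x \<bullet> i) *\<^sub>R \<alpha> z i) has_derivative
       (\<lambda>v. \<Sum>i\<in>Basis. (b x \<bullet> i) *\<^sub>R der (\<lambda>z. \<alpha> z i) (a x) v)) (at (a x))"
      by (intro has_derivative_sum has_derivative_scaleR_right smooth_has_derivative sm)
    then show ?thesis
      unfolding expand[of _ "b x", symmetric] by (rule frechet_derivative_at[symmetric])
  qed
  ultimately show ?thesis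
    by (simp only: expand[of _ "b _", symmetric] expand[of _ "b' _", symmetric] sum.distrib)
qed

lemma smooth_form:
  fixes \<alpha> :: "'a::euclidean_space \<Rightarrow> 'b::euclidean_space \<Rightarrow> 'c::real_normed_vector"
  assumes sm: "\<And>\<xi>. smooth (\<lambda>z. \<alpha> z \<xi>)" and lin: "\<And>z. linear (\<alpha> z)" and a: "smooth a" and b: "smooth b"
  shows "smooth (\<lambda>x. \<alpha> (a x) (b x))"
proof -
  note expand = form_expansion[OF lin]
  show ?thesis
    unfolding expand[of _ "b _"]
    by (intro smooth_sum smooth_scaleR smooth_bounded_linear[OF bounded_linear_inner_left b] smooth_compose[OF sm a])
qed

lemma frechet_derivative_expansion:
  fixes f :: "'a::euclidean_space \<Rightarrow> 'b::real_normed_vector"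
  assumes "smooth f"
  shows "der f x v = (\<Sum>b\<in>Basis. (v \<bullet> b) *\<^sub>R der f x b)"
  by (rule form_expansion[OF smooth_linear_derivative[OF assms]])

lemma smooth_derivative_joint:
  fixes f :: "'a::euclidean_space \<Rightarrow> 'b::real_normed_vector"
  assumes "smooth f" "smooth a" "smooth b"
  shows "smooth (\<lambda>x. der f (a x) (b x))"
  by (rule smooth_form[OF smooth_derivative[OF assms(1)] smooth_linear_derivative[OF assms(1)] assms(2,3)])

lemma derivative_joint_has_derivative:
  fixes f :: "'a::euclidean_space \<Rightarrow> 'b::real_normed_vector"
  assumes "smooth f" "(a has_derivative a') (at x)" "(b has_derivative b') (at x)"
  shows "((\<lambda>x. der f (a x) (b x)) has_derivative
    (\<lambda>v. der (\<lambda>y. der f y (b x)) (a x) (a' v) +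
      der f (a x) (b' v))) (at x)"
  by (rule form_has_derivative[OF smooth_derivative[OF assms(1)] smooth_linear_derivative[OF assms(1)] assms(2,3)])

lemma has_vector_derivative_smooth_compose:
  assumes "smooth f" "(g has_vector_derivative g') (at t within S)"
  shows "((\<lambda>t. f (g t)) has_vector_derivative der f (g t) g') (at t within S)"
proof -
  have lin: "linear (der f (g t))" using smooth_linear_derivative[OF assms(1)] .
  have "((\<lambda>t. f (g t)) has_derivative (\<lambda>h. der f (g t) (h *\<^sub>R g'))) (at t within S)"
    using assms(2) unfolding has_vector_derivative_def
    by (rule has_derivative_compose[OF _ smooth_has_derivative[OF assms(1)]])
  then show ?thesis unfolding has_vector_derivative_def linear_scale[OF lin] .
qed

lemma smooth_line:
  assumes "smooth f"
  shows "((\<lambda>t. f (x + t *\<^sub>R w)) has_vector_derivative der f (x + t *\<^sub>R w) w) (at t within S)"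
  by (rule has_vector_derivative_smooth_compose[OF assms]) (auto intro!: derivative_eq_intros)

text \<open>The increment of f along t w is an integral of its w-derivative. Differentiating this
  identity in direction v under the integral sign and then in t at 0 gives the two orders of
  differentiation.\<close>

lemma mixed_derivatives_commute:
  fixes f :: "'a::euclidean_space \<Rightarrow> 'b::euclidean_space"
  assumes f: "smooth f"
  shows "der (\<lambda>y. der f y w) x v =
    der (\<lambda>y. der f y v) x w"
proof -
  let ?Dv = "\<lambda>y. der f y v" and ?Dw = "\<lambda>y. der f y w"
  let ?vw = "\<lambda>y. der ?Dw y v"
  have sm: "smooth ?Dv" "smooth ?Dw" "smooth ?vw" using f by (auto intro: smooth_derivative)
  have cont: "continuous_on A (\<lambda>z. g (h z))" if "smooth g" "continuous_on A h" for g h and A :: "'z::topological_space set"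
    using continuous_on_compose2[OF smooth_continuous[OF that(1)] that(2)] by auto
  have cont_vw: "continuous_on A (\<lambda>t. ?vw (x + t *\<^sub>R w))" for A
    by (rule cont[OF sm(3)]) (intro continuous_intros)
  have ftc: "integral (cbox 0 t) (\<lambda>t. ?Dw (x + s *\<^sub>R v + t *\<^sub>R w)) = f (x + s *\<^sub>R v + t *\<^sub>R w) - f (x + s *\<^sub>R v)"
    if "0 \<le> t" for s t
    using integral_unique[OF fundamental_theorem_of_calculus[OF that smooth_line[OF f, of "x + s *\<^sub>R v" w]]] by simp
  have eq: "?Dv (x + t *\<^sub>R w) - ?Dv x = integral {0..t} (\<lambda>t. ?vw (x + t *\<^sub>R w))" if t: "0 \<le> t" for t
  proof -
    have "((\<lambda>s. integral (cbox 0 t) (\<lambda>t. ?Dw (x + s *\<^sub>R v + t *\<^sub>R w))) has_vector_derivative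
       integral (cbox 0 t) (\<lambda>t. ?vw (x + 0 *\<^sub>R v + t *\<^sub>R w))) (at 0 within UNIV)"
    proof (rule leibniz_rule_vector_derivative[where fx = "\<lambda>s t. ?vw (x + s *\<^sub>R v + t *\<^sub>R w)"])
      fix s t
      show "((\<lambda>s. ?Dw (x + s *\<^sub>R v + t *\<^sub>R w)) has_vector_derivative ?vw (x + s *\<^sub>R v + t *\<^sub>R w)) (at s within UNIV)"
        using smooth_line[OF sm(2), of "x + t *\<^sub>R w" v s] by (simp add: algebra_simps)
      show "(\<lambda>t. ?Dw (x + s *\<^sub>R v + t *\<^sub>R w)) integrable_on cbox 0 t'" for t'
        by (rule integrable_continuous, rule cont[OF sm(2)]) (intro continuous_intros)
      show "continuous_on (UNIV \<times> cbox 0 t') (\<lambda>(s, t). ?vw (x + s *\<^sub>R v + t *\<^sub>R w))" for t'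
        unfolding split_beta by (rule cont[OF sm(3)]) (intro continuous_intros)
    qed auto
    moreover have "((\<lambda>s. f (x + t *\<^sub>R w + s *\<^sub>R v) - f (x + s *\<^sub>R v)) has_vector_derivative
        ?Dv (x + t *\<^sub>R w + 0 *\<^sub>R v) - ?Dv (x + 0 *\<^sub>R v)) (at 0)"
      by (intro has_vector_derivative_diff smooth_line f)
    then have "((\<lambda>s. integral (cbox 0 t) (\<lambda>t. ?Dw (x + s *\<^sub>R v + t *\<^sub>R w))) has_vector_derivative
        ?Dv (x + t *\<^sub>R w) - ?Dv x) (at 0)"
      unfolding ftc[OF t] by (simp add: algebra_simps)
    ultimately show ?thesis using vector_derivative_unique_at by fastforce
  qed
  \<comment> \<open>The integral formula is available for t \<ge> 0 only, so derivatives at 0 are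
    taken within {0..1}.\<close>
  have "((\<lambda>t. integral {0..t} (\<lambda>t. ?vw (x + t *\<^sub>R w))) has_vector_derivative ?vw (x + 0 *\<^sub>R w)) (at 0 within {0..1})"
    by (rule integral_has_vector_derivative[OF cont_vw]) auto
  then have int: "((\<lambda>t. integral {0..t} (\<lambda>t. ?vw (x + t *\<^sub>R w))) has_vector_derivative ?vw x) (at 0 within {0..1})"
    by simp
  have "((\<lambda>t. ?Dv (x + t *\<^sub>R w) - ?Dv x) has_vector_derivative ?vw x) (at 0 within {0..1})"
    by (rule has_vector_derivative_transform[OF _ _ int]) (use eq in auto)
  moreover have "((\<lambda>t. ?Dv (x + t *\<^sub>R w) - ?Dv x) has_vector_derivative
      der ?Dv (x + 0 *\<^sub>R w) w - 0) (at 0 within {0..1})"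
    by (intro has_vector_derivative_diff smooth_line sm has_vector_derivative_const)
  ultimately show ?thesis
    using vector_derivative_unique_within_closed_interval[of 0 1 0] by fastforce
qed

section \<open>Lie groups\<close>

locale smooth_group =
  fixes G :: "'a::euclidean_space monoid"
  assumes lie_group: "lie_group G"
begin

sublocale group G
  using lie_group unfolding lie_group_def by blast

lemma carrier [simp]: "x \<in> carrier G"
  using lie_group unfolding lie_group_def by blast

abbreviation mul (infixl "\<cdot>" 70) where "p \<cdot> q \<equiv> p \<otimes>\<^bsub>G\<^esub> q"
abbreviation e where "e \<equiv> \<one>\<^bsub>G\<^esub>"
abbreviation iv where "iv p \<equiv> inv\<^bsub>G\<^esub> p"
abbreviation L where "L \<equiv> left_inv_field G"

definition M :: "'a \<times> 'a \<Rightarrow> 'a" where "M = (\<lambda>(p, q). p \<cdot> q)"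

lemma smooth_M: "smooth M" and smooth_iv: "smooth (\<lambda>p. iv p)"
  using lie_group unfolding lie_group_def M_def by blast+

lemma smooth_mul: "smooth f \<Longrightarrow> smooth g \<Longrightarrow> smooth (\<lambda>x. f x \<cdot> g x)"
  using smooth_compose[OF smooth_M smooth_Pair] by (simp add: M_def)

lemma smooth_inv: "smooth f \<Longrightarrow> smooth (\<lambda>x. iv (f x))"
  by (rule smooth_compose[OF smooth_iv])

text \<open>The differential of right translation by \<open>q\<close> at \<open>p\<close>, and of left translation by \<open>p\<close> at \<open>q\<close>.\<close>

definition Rt :: "'a \<Rightarrow> 'a \<Rightarrow> 'a \<Rightarrow> 'a" where
  "Rt p q \<xi> = der M (p, q) (\<xi>, 0)"

definition Lt :: "'a \<Rightarrow> 'a \<Rightarrow> 'a \<Rightarrow> 'a" where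
  "Lt p q \<eta> = der M (p, q) (0, \<eta>)"

lemma derivative_M: "der M (p, q) (\<xi>, \<eta>) = Rt p q \<xi> + Lt p q \<eta>"
  unfolding Rt_def Lt_def using linear_add[OF smooth_linear_derivative[OF smooth_M], of _ "(\<xi>, 0)" "(0, \<eta>)"] by simp

lemma linear_Rt: "linear (Rt p q)" and linear_Lt: "linear (Lt p q)"
proof -
  have l: "linear (\<lambda>\<xi>::'a. (\<xi>, 0 :: 'a))" "linear (\<lambda>\<xi>::'a. (0 :: 'a, \<xi>))" by (auto intro!: linearI)
  from linear_compose[OF l(1) smooth_linear_derivative[OF smooth_M]]
    linear_compose[OF l(2) smooth_linear_derivative[OF smooth_M]]
  show "linear (Rt p q)" "linear (Lt p q)" unfolding Rt_def[abs_def] Lt_def[abs_def] o_def by blast+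
qed

lemmas RL_simps = linear_add[OF linear_Rt] linear_add[OF linear_Lt] linear_scale[OF linear_Rt]
  linear_scale[OF linear_Lt] linear_diff[OF linear_Rt] linear_diff[OF linear_Lt]
  linear_neg[OF linear_Rt] linear_neg[OF linear_Lt] linear_0[OF linear_Rt] linear_0[OF linear_Lt]

lemma mul_has_derivative:
  assumes "(f has_derivative f') (at x within A)" "(g has_derivative g') (at x within A)"
  shows "((\<lambda>x. f x \<cdot> g x) has_derivative (\<lambda>v. Rt (f x) (g x) (f' v) + Lt (f x) (g x) (g' v))) (at x within A)"
  using has_derivative_compose[OF has_derivative_Pair[OF assms] smooth_has_derivative[OF smooth_M]]
  by (simp add: derivative_M) (simp add: M_def)

lemma smooth_Rt: "smooth f \<Longrightarrow> smooth g \<Longrightarrow> smooth h \<Longrightarrow> smooth (\<lambda>x. Rt (f x) (g x) (h x))"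
  and smooth_Lt: "smooth f \<Longrightarrow> smooth g \<Longrightarrow> smooth h \<Longrightarrow> smooth (\<lambda>x. Lt (f x) (g x) (h x))"
  unfolding Rt_def Lt_def by (intro smooth_derivative_joint[OF smooth_M] smooth_Pair smooth_const; assumption)+

lemma assoc: "(p \<cdot> q) \<cdot> r = p \<cdot> (q \<cdot> r)"
  by (simp add: m_assoc)

lemma mul_left_has_derivative: "((\<lambda>q. p \<cdot> q) has_derivative Lt p q) (at q)"
  using mul_has_derivative[OF has_derivative_const[of p] has_derivative_ident, of q] by (simp add: RL_simps)

lemma mul_right_has_derivative: "((\<lambda>p. p \<cdot> q) has_derivative Rt p q) (at p)"
  using mul_has_derivative[OF has_derivative_ident has_derivative_const[of q], of p] by (simp add: RL_simps)

lemma Rt_e [simp]: "Rt p e \<xi> = \<xi>"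
proof -
  have "((\<lambda>p. p) has_derivative Rt p e) (at p)" using mul_right_has_derivative[of e p] by simp
  from fun_cong[OF has_derivative_unique[OF this has_derivative_ident]] show ?thesis .
qed

lemma Lt_e [simp]: "Lt e p \<xi> = \<xi>"
proof -
  have "((\<lambda>p. p) has_derivative Lt e p) (at p)" using mul_left_has_derivative[of e p] by simp
  from fun_cong[OF has_derivative_unique[OF this has_derivative_ident]] show ?thesis .
qed

lemma Lt_Lt: "Lt p (q \<cdot> r) (Lt q r \<eta>) = Lt (p \<cdot> q) r \<eta>"
  by (rule fun_cong[OF has_derivative_unique[OF has_derivative_compose[OF mul_left_has_derivative
        mul_left_has_derivative] mul_left_has_derivative[of "p \<cdot> q", unfolded assoc]]])

lemma Rt_Rt: "Rt (p \<cdot> q) r (Rt p q \<xi>) = Rt p (q \<cdot> r) \<xi>"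
  by (rule fun_cong[OF has_derivative_unique[OF has_derivative_compose[OF mul_right_has_derivative
        mul_right_has_derivative, unfolded assoc] mul_right_has_derivative]])

lemma Rt_Lt: "Rt (p \<cdot> q) r (Lt p q \<xi>) = Lt p (q \<cdot> r) (Rt q r \<xi>)"
  by (rule fun_cong[OF has_derivative_unique[OF has_derivative_compose[OF mul_left_has_derivative
        mul_right_has_derivative, unfolded assoc] has_derivative_compose[OF mul_right_has_derivative mul_left_has_derivative]]])

lemma left_inv_field_eq: "L X p = Lt p e X"
  unfolding left_inv_field_def by (rule fun_cong[OF frechet_derivative_at[OF mul_left_has_derivative, symmetric]])

lemma left_trivialize_eq: "left_trivialize G p \<xi> = Lt (iv p) p \<xi>"
  unfolding left_trivialize_def by (rule fun_cong[OF frechet_derivative_at[OF mul_left_has_derivative, symmetric]])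

lemma Ad_eq: "Ad G z Y = Rt z (iv z) (Lt z e Y)"
  using fun_cong[OF frechet_derivative_at[OF has_derivative_compose[OF mul_left_has_derivative
        mul_right_has_derivative]], of z e "iv z" Y]
  unfolding Ad_def by simp

lemma left_trivialize_left_inv_field [simp]: "left_trivialize G p (L X p) = X"
  using Lt_Lt[of "iv p" p e X] by (simp add: left_trivialize_eq left_inv_field_eq)

lemma left_inv_field_left_trivialize [simp]: "L (left_trivialize G p \<xi>) p = \<xi>"
  using Lt_Lt[of p "iv p" p \<xi>] by (simp add: left_trivialize_eq left_inv_field_eq)

lemma linear_Ad: "linear (Ad G z)"
  using linear_compose[OF linear_Lt linear_Rt] unfolding Ad_eq[abs_def] o_def .

lemma linear_left_inv_field: "linear (\<lambda>X. L X p)"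
  using linear_Lt by (simp add: left_inv_field_eq[abs_def])

lemma linear_left_trivialize: "linear (left_trivialize G p)"
  using linear_Lt by (simp add: left_trivialize_eq[abs_def])

lemma smooth_left_inv_field: "smooth f \<Longrightarrow> smooth g \<Longrightarrow> smooth (\<lambda>x. L (g x) (f x))"
  unfolding left_inv_field_eq by (intro smooth_Lt smooth_const)

lemma smooth_left_inv_field_const: "smooth (L X)"
  using smooth_left_inv_field[OF smooth_id smooth_const, of X] by simp

lemma smooth_left_trivialize: "smooth f \<Longrightarrow> smooth g \<Longrightarrow> smooth (\<lambda>x. left_trivialize G (f x) (g x))"
  unfolding left_trivialize_eq by (intro smooth_Lt smooth_inv)

lemma smooth_Ad: "smooth f \<Longrightarrow> smooth g \<Longrightarrow> smooth (\<lambda>x. Ad G (f x) (g x))"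
  unfolding Ad_eq by (intro smooth_Lt smooth_Rt smooth_const smooth_inv)

lemma Ad_e [simp]: "Ad G e X = X"
  by (simp add: Ad_eq)

lemma Rt_Ad: "Rt e z (Ad G z X) = L X z"
  using Rt_Rt[of z "iv z" z "Lt z e X"] by (simp add: Ad_eq left_inv_field_eq)

lemma Rt_inverse: "Rt z (iv z) (Rt e z X) = X"
  using Rt_Rt[of e z "iv z" X] by simp

lemma Rt_inverse': "Rt e z (Rt z (iv z) X) = X"
  using Rt_Rt[of z "iv z" z X] by simp

lemma Ad_mult: "Ad G (z \<cdot> w) X = Ad G z (Ad G w X)"
proof -
  have "Ad G (z \<cdot> w) X = Rt (z \<cdot> w) (iv w \<cdot> iv z) (Lt (z \<cdot> w) e X)"
    by (simp add: Ad_eq inv_mult_group)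
  also have "\<dots> = Rt z (iv z) (Rt (z \<cdot> w) (iv w) (Lt z w (Lt w e X)))"
    using Rt_Rt[of "z \<cdot> w" "iv w" "iv z"] Lt_Lt[of z w e X] by (simp add: assoc)
  also have "Rt (z \<cdot> w) (iv w) (Lt z w (Lt w e X)) = Lt z e (Rt w (iv w) (Lt w e X))"
    using Rt_Lt[of z w "iv w"] by simp
  finally show ?thesis by (simp add: Ad_eq)
qed

lemma Ad_inverse [simp]: "Ad G z (Ad G (iv z) X) = X" "Ad G (iv z) (Ad G z X) = X"
  by (simp_all flip: Ad_mult)

text \<open>The mixed derivative of \<open>a z b\<close> in \<open>a\<close> and \<open>b\<close>, computed in both orders, gives the bracket of a
  field with a left-invariant one in the right trivialization.\<close>

lemma vf_bracket_left_inv_field: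
  assumes \<omega>: "smooth \<omega>"
  defines "F \<equiv> \<lambda>z. Rt z (iv z) (\<omega> z)"
  shows "vf_bracket \<omega> (L B) z =
    - Rt e z (der F z (L B z))"
proof -
  let ?D = "\<lambda>f x. der f x"
  define \<Psi> where "\<Psi> = (\<lambda>x. M (fst x, M (z, snd x)))"
  \<comment> \<open>By associativity there are two forms: one suits the derivative in the left
    variable, the other the derivative in the right variable.\<close>
  have \<Psi>': "\<Psi> = (\<lambda>x. M (M (fst x, z), snd x))" by (simp add: \<Psi>_def M_def assoc)
  have M0: "?D M x (0, 0) = 0" for x
    using linear_0[OF smooth_linear_derivative[OF smooth_M]] by (simp add: zero_prod_def)
  have smF: "smooth F" unfolding F_def by (intro smooth_Rt smooth_inv smooth_id \<omega>)
  have "smooth \<Psi>" unfolding \<Psi>_def by (intro smooth_compose[OF smooth_M] smooth_intros)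
  have "(\<Psi> has_derivative (\<lambda>v. ?D M (fst x, M (z, snd x)) (fst v, ?D M (z, snd x) (0, snd v)))) (at x)" for x
    unfolding \<Psi>_def
    by (rule has_derivative_compose[OF _ smooth_has_derivative[OF smooth_M]],
        intro has_derivative_Pair has_derivative_fst has_derivative_ident,
        rule has_derivative_compose[OF _ smooth_has_derivative[OF smooth_M]],
        intro has_derivative_Pair has_derivative_snd has_derivative_ident has_derivative_const)
  from fun_cong[OF frechet_derivative_at[OF this], of _ "(_, 0)"] have D\<Psi>: "?D \<Psi> x (\<xi>, 0) = ?D M (fst x, M (z, snd x)) (\<xi>, 0)" for x \<xi>
    by (simp add: M0)
  have "(\<Psi> has_derivative (\<lambda>v. ?D M (M (fst x, z), snd x) (?D M (fst x, z) (fst v, 0), snd v))) (at x)" for x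
    unfolding \<Psi>'
    by (rule has_derivative_compose[OF _ smooth_has_derivative[OF smooth_M]],
        intro has_derivative_Pair has_derivative_snd has_derivative_ident,
        rule has_derivative_compose[OF _ smooth_has_derivative[OF smooth_M]],
        intro has_derivative_Pair has_derivative_fst has_derivative_ident has_derivative_const)
  from fun_cong[OF frechet_derivative_at[OF this], of _ "(0, _)"] have D\<Psi>': "?D \<Psi> x (0, \<eta>) = ?D M (M (fst x, z), snd x) (0, \<eta>)" for x \<eta>
    by (simp add: M0)
  define \<xi> where "\<xi> = F z"
  have "((\<lambda>x. ?D M (fst x, M (z, snd x)) (\<xi>, 0)) has_derivative
     (\<lambda>v. ?D (\<lambda>y. ?D M y (\<xi>, 0)) (fst (e, e), M (z, snd (e, e))) (fst v, ?D M (z, snd (e, e)) (0, snd v)))) (at (e, e))"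
    by (rule has_derivative_compose[OF _ smooth_has_derivative[OF smooth_derivative[OF smooth_M]]],
        intro has_derivative_Pair has_derivative_fst has_derivative_ident,
        rule has_derivative_compose[OF _ smooth_has_derivative[OF smooth_M]],
        intro has_derivative_Pair has_derivative_snd has_derivative_ident has_derivative_const)
  from fun_cong[OF frechet_derivative_at[OF this], of "(0, B)"]
  have 1: "?D (\<lambda>x. ?D \<Psi> x (\<xi>, 0)) (e, e) (0, B) = ?D (\<lambda>y. ?D M y (\<xi>, 0)) (e, z) (0, Lt z e B)"
    unfolding D\<Psi> by (simp add: Lt_def) (simp add: M_def)
  have "((\<lambda>x. ?D M (M (fst x, z), snd x) (0, B)) has_derivative
     (\<lambda>v. ?D (\<lambda>y. ?D M y (0, B)) (M (fst (e, e), z), snd (e, e)) (?D M (fst (e, e), z) (fst v, 0), snd v))) (at (e, e))"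
    by (rule has_derivative_compose[OF _ smooth_has_derivative[OF smooth_derivative[OF smooth_M]]],
        intro has_derivative_Pair has_derivative_snd has_derivative_ident,
        rule has_derivative_compose[OF _ smooth_has_derivative[OF smooth_M]],
        intro has_derivative_Pair has_derivative_fst has_derivative_ident has_derivative_const)
  from fun_cong[OF frechet_derivative_at[OF this], of "(\<xi>, 0)"]
  have 2: "?D (\<lambda>x. ?D \<Psi> x (0, B)) (e, e) (\<xi>, 0) = ?D (\<lambda>y. ?D M y (0, B)) (z, e) (Rt e z \<xi>, 0)"
    unfolding D\<Psi>' by (simp add: Rt_def) (simp add: M_def)
  \<comment> \<open>Written as the right translate of F, \<omega> has a derivative with two parts:
    one with F frozen at its value \<xi>, and one that contains the derivative of F.\<close>
  have \<omega>_eq: "\<omega> = (\<lambda>p. ?D M (e, p) (F p, 0))"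
    using Rt_inverse'[of _ "\<omega> _"] by (simp add: F_def fun_eq_iff Rt_def)
  have "(\<omega> has_derivative (\<lambda>v. ?D (\<lambda>y. ?D M y (F z, 0)) (e, z) (0, v) + ?D M (e, z) (?D F z v, 0))) (at z)"
    by (subst \<omega>_eq, rule derivative_joint_has_derivative[OF smooth_M])
      (intro has_derivative_Pair has_derivative_const has_derivative_ident smooth_has_derivative smF)+
  from fun_cong[OF frechet_derivative_at[OF this], of "Lt z e B"]
  have D\<omega>: "?D \<omega> z (Lt z e B) = ?D (\<lambda>y. ?D M y (\<xi>, 0)) (e, z) (0, Lt z e B) + Rt e z (?D F z (Lt z e B))"
    unfolding \<xi>_def by (simp add: Rt_def)
  have "((\<lambda>p. ?D M (p, e) (0, B)) has_derivative (\<lambda>v. ?D (\<lambda>y. ?D M y (0, B)) (z, e) (v, 0))) (at z)"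
    by (rule has_derivative_compose[OF _ smooth_has_derivative[OF smooth_derivative[OF smooth_M]]])
      (intro has_derivative_Pair has_derivative_const has_derivative_ident)
  then have "(L B has_derivative (\<lambda>v. ?D (\<lambda>y. ?D M y (0, B)) (z, e) (v, 0))) (at z)"
    by (simp add: left_inv_field_eq[abs_def] Lt_def)
  from fun_cong[OF frechet_derivative_at[OF this], of "\<omega> z"]
  have DL: "?D (L B) z (\<omega> z) = ?D (\<lambda>y. ?D M y (0, B)) (z, e) (Rt e z \<xi>, 0)"
    unfolding \<xi>_def F_def Rt_inverse' by simp
  \<comment> \<open>Both sides are mixed second derivatives of \<Psi> at the identity. Hence in the
    bracket the derivative of \<open>L B\<close> along \<omega> cancels the part with F
    frozen.\<close>
  have "?D (L B) z (\<omega> z) = ?D (\<lambda>y. ?D M y (\<xi>, 0)) (e, z) (0, Lt z e B)"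
    unfolding DL 1[symmetric] 2[symmetric] by (rule mixed_derivatives_commute[OF \<open>smooth \<Psi>\<close>])
  then show ?thesis unfolding vf_bracket_def left_inv_field_eq[of B z] D\<omega> by simp
qed

end

section \<open>The group of the semidirect product\<close>

locale carnot = smooth_group G + tangent_algebra brk V l
  for G :: "'a::euclidean_space monoid" and brk :: "'a \<Rightarrow> 'a \<Rightarrow> 'a" and V l +
  assumes vf_bracket_e: "vf_bracket (L X) (L Y) e = brk X Y"
begin

abbreviation "H \<equiv> semidirect_group G"

lemma left_inv_field_e [simp]: "L X e = X"
  by (simp add: left_inv_field_eq)

text \<open>This is the preceding bracket formula for the field \<open>L A\<close>, whose right
  trivialization is z \<mapsto> Ad z A.\<close>

lemma Ad_derivative_e: "der (\<lambda>z. Ad G z A) e B = brk B A"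
proof -
  have "smooth (L A)"
    by (rule smooth_left_inv_field_const)
  from vf_bracket_left_inv_field[OF this, of B e]
  show ?thesis using brk_antisym[of A B] by (simp add: vf_bracket_e left_inv_field_eq flip: Ad_eq)
qed

lemma Ad_derivative:
  "der (\<lambda>z. Ad G z A) z (L B z) = Ad G z (brk B A)"
proof -
  have sm: "smooth (\<lambda>z. Ad G z A)" by (intro smooth_Ad smooth_id smooth_const)
  have "((\<lambda>q. Ad G (z \<cdot> q) A) has_derivative
      (\<lambda>v. der (\<lambda>z. Ad G z A) (z \<cdot> e) (Lt z e v))) (at e)"
    by (rule has_derivative_compose[OF mul_left_has_derivative smooth_has_derivative[OF sm]])
  moreover have "((\<lambda>q. Ad G (z \<cdot> q) A) has_derivative
      (\<lambda>v. Ad G z (der (\<lambda>z. Ad G z A) e v))) (at e)"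
    unfolding Ad_mult
    by (rule bounded_linear.has_derivative[OF _ smooth_has_derivative[OF sm]])
      (simp only: linear_conv_bounded_linear[symmetric] linear_Ad)
  ultimately have "(\<lambda>v. der (\<lambda>z. Ad G z A) (z \<cdot> e) (Lt z e v)) =
     (\<lambda>v. Ad G z (der (\<lambda>z. Ad G z A) e v))"
    by (rule has_derivative_unique)
  from fun_cong[OF this, of B] show ?thesis
    by (simp add: Ad_derivative_e left_inv_field_eq)
qed

text \<open>\<open>vf_bracket_e\<close> prescribes the bracket at the identity; the derivative of Ad
  carries it to every point.\<close>

lemma vf_bracket_left_inv_fields:
  "vf_bracket (L A) (L B) z = L (brk A B) z"
proof -
  have sm: "smooth (L A)"
    by (rule smooth_left_inv_field_const)
  have "vf_bracket (L A) (L B) z = - Rt e z (Ad G z (brk B A))"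
    unfolding vf_bracket_left_inv_field[OF sm]
    by (simp only: left_inv_field_eq[of A] Ad_eq[symmetric] Ad_derivative)
  also have "\<dots> = L (brk A B) z"
    unfolding Rt_Ad brk_antisym[of A B] linear_neg[OF linear_left_inv_field] ..
  finally show ?thesis .
qed

lemma semidirect_mult [simp]: "(Y, z) \<otimes>\<^bsub>H\<^esub> (Y', z') = (Y + Ad G z Y', z \<cdot> z')"
  and semidirect_one: "\<one>\<^bsub>H\<^esub> = (0, e)" and semidirect_carrier [simp]: "carrier H = UNIV"
  by (simp_all add: semidirect_group_def)

lemma group_semidirect: "group H"
proof (rule groupI)
  fix p q r :: "'a \<times> 'a"
  show "p \<otimes>\<^bsub>H\<^esub> q \<otimes>\<^bsub>H\<^esub> r = p \<otimes>\<^bsub>H\<^esub> (q \<otimes>\<^bsub>H\<^esub> r)"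
    by (cases p; cases q; cases r) (simp add: Ad_mult linear_add[OF linear_Ad] assoc add.assoc)
  show "\<one>\<^bsub>H\<^esub> \<otimes>\<^bsub>H\<^esub> p = p" by (cases p) (simp add: semidirect_one)
  obtain Y z where p: "p = (Y, z)" by (cases p)
  have "(- Ad G (iv z) Y, iv z) \<otimes>\<^bsub>H\<^esub> p = \<one>\<^bsub>H\<^esub>" by (simp add: p semidirect_one)
  then show "\<exists>q\<in>carrier H. q \<otimes>\<^bsub>H\<^esub> p = \<one>\<^bsub>H\<^esub>" by auto
qed auto

lemma lie_group_semidirect: "lie_group H"
  unfolding lie_group_def
proof (intro conjI group_semidirect semidirect_carrier)
  have "(\<lambda>(p, q). p \<otimes>\<^bsub>H\<^esub> q) =
    (\<lambda>x. (fst (fst x) + Ad G (snd (fst x)) (fst (snd x)), snd (fst x) \<cdot> snd (snd x)))"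
    by (auto simp: fun_eq_iff)
  moreover have "smooth (\<lambda>x :: ('a \<times> 'a) \<times> ('a \<times> 'a).
      (fst (fst x) + Ad G (snd (fst x)) (fst (snd x)), snd (fst x) \<cdot> snd (snd x)))"
    by (intro smooth_Pair smooth_add smooth_Ad smooth_mul smooth_fst smooth_snd smooth_id)
  ultimately show "smooth (\<lambda>(p, q). p \<otimes>\<^bsub>H\<^esub> q)" by simp
  have "inv\<^bsub>H\<^esub> p = (- Ad G (iv (snd p)) (fst p), iv (snd p))" for p
    by (rule group.inv_equality[OF group_semidirect]) (cases p, simp_all add: semidirect_one)
  moreover have "smooth (\<lambda>p :: 'a \<times> 'a. ((- 1) *\<^sub>R Ad G (iv (snd p)) (fst p), iv (snd p)))"
    by (intro smooth_Pair smooth_scaleR smooth_const smooth_Ad smooth_inv smooth_fst smooth_snd smooth_id)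
  ultimately show "smooth (\<lambda>p. inv\<^bsub>H\<^esub> p)" by simp
qed

sublocale H: smooth_group "semidirect_group G"
  by unfold_locales (rule lie_group_semidirect)

lemma left_inv_field_semidirect:
  "left_inv_field H (A, B) (Y, z) = (Ad G z A, L B z)"
proof -
  have "((\<lambda>q. (Y + Ad G z (fst q), z \<cdot> snd q)) has_derivative
    (\<lambda>v. (0 + Ad G z (fst v), Rt z (snd (0::'a, e)) 0 + Lt z (snd (0::'a, e)) (snd v)))) (at (0, e))"
    by (intro has_derivative_Pair has_derivative_add has_derivative_const mul_has_derivative
        has_derivative_snd has_derivative_ident
        bounded_linear.has_derivative[OF _ has_derivative_fst[OF has_derivative_ident]])
      (simp only: linear_conv_bounded_linear[symmetric] linear_Ad)
  moreover have "(\<lambda>q. (Y, z) \<otimes>\<^bsub>H\<^esub> q) = (\<lambda>q. (Y + Ad G z (fst q), z \<cdot> snd q))"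
    by (auto simp: fun_eq_iff)
  ultimately have "((\<lambda>q. (Y, z) \<otimes>\<^bsub>H\<^esub> q) has_derivative
    (\<lambda>v. (0 + Ad G z (fst v), Rt z (snd (0::'a, e)) 0 + Lt z (snd (0::'a, e)) (snd v)))) (at \<one>\<^bsub>H\<^esub>)"
    by (simp only: semidirect_one)
  from fun_cong[OF frechet_derivative_at[OF this], of "(A, B)"] show ?thesis
    unfolding left_inv_field_def[of H] by (simp add: left_inv_field_eq RL_simps)
qed

lemma vf_bracket_semidirect_e:
  "vf_bracket (left_inv_field H P) (left_inv_field H Q) \<one>\<^bsub>H\<^esub> = semidirect_bracket brk P Q"
proof -
  obtain A B A' B' where PQ: "P = (A, B)" "Q = (A', B')" by (cases P; cases Q)
  have eq: "left_inv_field H (A, B) = (\<lambda>h. (Ad G (snd h) A, L B (snd h)))" for A B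
    by (auto simp: fun_eq_iff left_inv_field_semidirect)
  have d: "der (left_inv_field H (A, B)) (0, e) v =
    (brk (snd v) A, der (L B) e (snd v))" for A B v
  proof -
    have snd: "(snd has_derivative snd) (at (0::'a, e))"
      by (rule bounded_linear_imp_has_derivative[OF bounded_linear_snd])
    have "smooth (\<lambda>z. Ad G z A)" by (intro smooth_Ad smooth_id smooth_const)
    note 1 = has_derivative_compose[OF snd smooth_has_derivative[OF this]]
    have "smooth (L B)"
      by (rule smooth_left_inv_field_const)
    note 2 = has_derivative_compose[OF snd smooth_has_derivative[OF this]]
    from fun_cong[OF frechet_derivative_at[OF has_derivative_Pair[OF 1 2]], of v] show ?thesis
      unfolding eq by (simp add: Ad_derivative_e)
  qed
  show ?thesis
    unfolding vf_bracket_def semidirect_one PQ d left_inv_field_semidirect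
    using vf_bracket_e[of B B', unfolded vf_bracket_def] brk_antisym[of B' A]
    by simp
qed

lemma carnot_group_semidirect: "carnot_group H (semidirect_bracket brk) (semidirect_strata V) l"
  unfolding carnot_group_def
  using h.stratified lie_group_semidirect vf_bracket_semidirect_e by blast

text \<open>\<open>C = Ad (z\<inverse>) (B F)(z)\<close> is the horizontal component, in the abelian ideal, that the shear
  \<open>(Y, z) \<mapsto> (Y + t F z, z)\<close> adds to the horizontal direction \<open>B\<close>.\<close>

lemma precontact_right_trivialization:
  assumes \<omega>: "precontact G (V 1) \<omega>" and B: "B \<in> V 1"
  defines "F \<equiv> \<lambda>z. Rt z (iv z) (\<omega> z)"
  obtains C where "C \<in> V 1" "der F z (L B z) = Ad G z C"
proof -
  have sm: "smooth \<omega>" using \<omega> unfolding precontact_def by blast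
  have "smooth (L B)"
    by (rule smooth_left_inv_field_const)
  moreover have "\<forall>p. L B p \<in> horizontal G (V 1) p"
    using B by (simp add: horizontal_def)
  ultimately have "vf_bracket \<omega> (L B) z \<in> horizontal G (V 1) z"
    using \<omega> unfolding precontact_def by blast
  then obtain C where C: "C \<in> V 1" "vf_bracket \<omega> (L B) z = L C z"
    unfolding horizontal_def by blast
  have "der F z (L B z) =
     Rt z (iv z) (Rt e z (der F z (L B z)))"
    by (simp only: Rt_inverse)
  also have "\<dots> = Rt z (iv z) (- L C z)"
    using vf_bracket_left_inv_field[OF sm, of B z] C(2) unfolding F_def by (metis minus_minus)
  also have "\<dots> = Ad G z (- C)"
    by (simp add: Ad_eq left_inv_field_eq RL_simps)
  finally show ?thesis
    using that[of "- C"] C(1) subspace_neg subspace_V l_ge_1 by auto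
qed

end

section \<open>Closed forms and the abelianization\<close>

text \<open>The primitive integrates \<alpha> along the segment from 0 to z. Closedness turns the
  derivative of the integrand in direction v into the t-derivative of
  \<open>t *\<^sub>R \<alpha> (t *\<^sub>R z) v\<close>, which integrates to
  \<open>\<alpha> z v\<close>.\<close>

lemma poincare_lemma:
  fixes \<alpha> :: "'a::euclidean_space \<Rightarrow> 'a \<Rightarrow> 'b::euclidean_space"
  assumes sm: "\<And>\<xi>. smooth (\<lambda>z. \<alpha> z \<xi>)" and lin: "\<And>z. linear (\<alpha> z)"
    and closed: "\<And>z \<xi> \<zeta>. der (\<lambda>z. \<alpha> z \<xi>) z \<zeta> = der (\<lambda>z. \<alpha> z \<zeta>) z \<xi>"
  obtains \<psi> where "smooth \<psi>" "\<And>z. (\<psi> has_derivative \<alpha> z) (at z)"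
proof -
  define \<psi> where "\<psi> z = integral (cbox 0 1) (\<lambda>t::real. \<alpha> (t *\<^sub>R z) z)" for z
  define d where "d z t v = der (\<lambda>y. \<alpha> y z) (t *\<^sub>R z) (t *\<^sub>R v) + \<alpha> (t *\<^sub>R z) v" for z t v
  have D: "((\<lambda>z. \<alpha> (t *\<^sub>R z) z) has_derivative d z t) (at z)" for t z
    unfolding d_def by (rule form_has_derivative[OF sm lin]) (auto intro!: derivative_eq_intros)
  have d_closed: "d z t v = t *\<^sub>R der (\<lambda>y. \<alpha> y v) (t *\<^sub>R z) z + \<alpha> (t *\<^sub>R z) v" for z t v
    unfolding d_def linear_scale[OF smooth_linear_derivative[OF sm]] by (simp add: closed)
  have sm_d: "smooth (\<lambda>x. d (fst x) (snd x) v)" for v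
  proof -
    have s: "smooth (\<lambda>x::'a \<times> real. snd x *\<^sub>R fst x)" by (intro smooth_intros)
    show ?thesis
      unfolding d_closed
      by (intro smooth_add smooth_scaleR smooth_snd smooth_id smooth_compose[OF sm s]
          smooth_derivative_joint[OF sm s] smooth_fst)
  qed
  have cont_d: "continuous_on A (\<lambda>x. d (fst x) (snd x) v)" for A v
    using continuous_on_subset[OF smooth_continuous[OF sm_d]] by blast
  have bl: "bounded_linear (d z t)" for z t using D has_derivative_bounded_linear by blast
  \<comment> \<open>\<open>leibniz_rule\<close> asks for a derivative that is continuous in operator
    norm; continuity is reduced to single vectors by finite dimension.\<close>
  let ?d = "\<lambda>z t. Blinfun (d z t)"
  have app: "blinfun_apply (?d z t) = d z t" for z t using bl by (rule bounded_linear_Blinfun_apply)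
  have contB: "continuous_on (UNIV \<times> cbox 0 1) (\<lambda>(z, t). ?d z t)"
    by (rule continuous_on_blinfun_componentwise) (use cont_d in \<open>simp add: app split_beta\<close>)
  have sm_\<alpha>: "smooth (\<lambda>t. \<alpha> (t *\<^sub>R z) w)" for z w
  proof -
    have "smooth (\<lambda>t::real. t *\<^sub>R z)" by (intro smooth_intros)
    from smooth_compose[OF sm this] show ?thesis .
  qed
  have der: "(\<psi> has_derivative blinfun_apply (integral (cbox 0 1) (?d z))) (at z within UNIV)" for z
    unfolding \<psi>_def[abs_def]
  proof (rule leibniz_rule[OF _ _ contB])
    show "((\<lambda>z. \<alpha> (t *\<^sub>R z) z) has_derivative blinfun_apply (?d z t)) (at z within UNIV)" for z t
      unfolding app using D by simp
    show "(\<lambda>t. \<alpha> (t *\<^sub>R z) z) integrable_on cbox 0 1" for z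
      by (intro integrable_continuous continuous_on_subset[OF smooth_continuous[OF sm_\<alpha>]]) simp
  qed auto
  have int: "blinfun_apply (integral (cbox 0 1) (?d z)) v = \<alpha> z v" for z v
  proof -
    have "continuous_on (cbox 0 1) (?d z)"
      by (rule continuous_on_blinfun_componentwise)
        (simp add: app, rule continuous_on_compose2[OF cont_d[of UNIV], of _ "\<lambda>t. (z, t)", simplified],
          auto intro!: continuous_intros)
    then have "blinfun_apply (integral (cbox 0 1) (?d z)) v = integral (cbox 0 1) (\<lambda>t. d z t v)"
      by (subst blinfun_apply_integral[OF integrable_continuous]) (simp_all add: app)
    also have "((\<lambda>t. d z t v) has_integral 1 *\<^sub>R \<alpha> (1 *\<^sub>R z) v - 0 *\<^sub>R \<alpha> (0 *\<^sub>R z) v) {0..1}"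
    proof (rule fundamental_theorem_of_calculus)
      fix t :: real
      have "((\<lambda>t. \<alpha> (t *\<^sub>R z) v) has_vector_derivative der (\<lambda>y. \<alpha> y v) (t *\<^sub>R z) z) (at t within {0..1})"
        using smooth_line[OF sm[of v], of 0 z] by simp
      from has_vector_derivative_scaleR[OF DERIV_ident this]
      show "((\<lambda>t. t *\<^sub>R \<alpha> (t *\<^sub>R z) v) has_vector_derivative d z t v) (at t within {0..1})"
        by (simp add: d_closed)
    qed simp
    then have "integral (cbox 0 1) (\<lambda>t. d z t v) = \<alpha> z v" by (simp add: integral_unique)
    finally show ?thesis .
  qed
  have "blinfun_apply (integral (cbox 0 1) (?d z)) = \<alpha> z" for z using int by (rule ext)
  then have der': "(\<psi> has_derivative \<alpha> z) (at z)" for z using der[of z] by simp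
  have "C_k k \<psi>" for k
    by (rule C_k_Suc_imp, rule C_k_SucI[OF der']) (use sm in \<open>simp add: smooth_C_k\<close>)
  then have "smooth \<psi>" unfolding smooth_def by blast
  then show ?thesis using der' that by blast
qed

context smooth_group
begin

lemma constant_if_left_derivatives_vanish:
  assumes "smooth f" "\<And>z B. der f z (L B z) = 0"
  shows "f z = f e"
proof -
  have "der f z v = 0" for z v
    using assms(2)[of z "left_trivialize G z v"] by simp
  then have "der f z = (\<lambda>v. 0)" for z by (rule ext)
  then have "(f has_derivative (\<lambda>v. 0)) (at z within UNIV)" for z
    using smooth_has_derivative[OF assms(1), of z] by simp
  from has_derivative_zero_unique[OF convex_UNIV this, of e z] show ?thesis by simp
qed

end

section \<open>The abelianization of the group\<close>

context stratified
begin

text \<open>The projection to the abelianization of the algebra: in a stratified algebra the derived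
  algebra is the sum of the strata above the first.\<close>

definition proj_1 :: "'a \<Rightarrow> 'a" where "proj_1 = component 1"

lemma linear_proj_1: "linear proj_1"
  unfolding proj_1_def by (rule linear_component)

lemma bounded_linear_proj_1: "bounded_linear proj_1"
  using linear_proj_1 by (simp only: linear_conv_bounded_linear)

lemma proj_1_S: "X \<in> S i \<Longrightarrow> proj_1 X = (if i = 1 then X else 0)"
  using component_S[of X i 1] by (auto simp: proj_1_def)

lemma proj_1_V_1: "X \<in> V 1 \<Longrightarrow> proj_1 X = X"
  using proj_1_S[of X 1] S_1 by simp

lemma proj_1_in_V_1: "proj_1 X \<in> V 1"
  using component_in_S[of 1 X] S_1 by (simp add: proj_1_def)

end

context carnot
begin

lemma proj_1_brk: "proj_1 (brk A B) = 0"
proof -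
  have hom: "proj_1 (brk A B) = 0" if "A \<in> S i" "1 \<le> i" "B \<in> S j" "1 \<le> j" for A B i j
    using proj_1_S[OF brk_S[OF that(1,3)]] that by auto
  have lin: "linear (\<lambda>A. proj_1 (brk A B))" "linear (\<lambda>B. proj_1 (brk A B))" for A B
    using linear_compose[OF linear_brk_left linear_proj_1] linear_compose[OF linear_brk_right linear_proj_1]
    by (simp_all add: o_def)
  have "(\<lambda>B. proj_1 (brk A B)) = (\<lambda>B. 0)" if "A \<in> S i" "1 \<le> i" for A i
    by (rule linear_ext[OF lin(2) linear_zero]) (use hom that in blast)
  then have "(\<lambda>A. proj_1 (brk A B)) = (\<lambda>A. 0)" for B
    by (intro linear_ext[OF lin(1) linear_zero]) (metis)
  then show ?thesis by metis
qed

lemma proj_1_Ad_derivative: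
  "der (\<lambda>z. proj_1 (Ad G z A)) z (L B z) = proj_1 (Ad G z (brk B A))"
proof -
  have "((\<lambda>z. proj_1 (Ad G z A)) has_derivative
     (\<lambda>v. proj_1 (der (\<lambda>z. Ad G z A) z v))) (at z)"
    by (rule bounded_linear.has_derivative[OF _ smooth_has_derivative])
      (simp only: linear_conv_bounded_linear[symmetric] linear_proj_1, intro smooth_Ad smooth_id smooth_const)
  from fun_cong[OF frechet_derivative_at[OF this], of "L B z"]
  show ?thesis by (simp add: Ad_derivative)
qed

lemma smooth_proj_1_Ad: "smooth (\<lambda>z. proj_1 (Ad G z A))"
  by (intro smooth_linear[OF linear_proj_1] smooth_Ad smooth_id smooth_const)

lemma proj_1_Ad_linear: "linear (\<lambda>B. proj_1 (Ad G z (brk B A)))"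
  using linear_compose[OF linear_brk_left linear_compose[OF linear_Ad linear_proj_1]] by (simp add: o_def)

text \<open>Downward induction on j. Along \<open>L B\<close> the function z \<mapsto> proj_1 (Ad z
  A) has derivative proj_1 (Ad z [B, A]), and [B, A] lies in higher strata; so the function is
  constant, and its value at the identity is 0.\<close>

lemma proj_1_Ad_higher: "2 \<le> j \<Longrightarrow> A \<in> S j \<Longrightarrow> proj_1 (Ad G z A) = 0"
proof (induction "nat (int l + 1 - j)" arbitrary: j A z rule: less_induct)
  case less
  show ?case
  proof (cases "j \<le> int l")
    case True
    have "proj_1 (Ad G z (brk B A)) = 0" for B z
    proof -
      have "(\<lambda>B. proj_1 (Ad G z (brk B A))) = (\<lambda>B. 0)"
      proof (rule linear_ext[OF proj_1_Ad_linear linear_zero])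
        fix i B assume "1 \<le> i" "B \<in> S i"
        then show "proj_1 (Ad G z (brk B A)) = 0"
          using less.hyps[of "i + j" "brk B A" z] brk_S[of B i A j] less.prems True by auto
      qed
      then show ?thesis by metis
    qed
    then have "proj_1 (Ad G z A) = proj_1 (Ad G e A)"
      by (intro constant_if_left_derivatives_vanish[OF smooth_proj_1_Ad]) (simp add: proj_1_Ad_derivative)
    then show ?thesis using proj_1_S[OF less.prems(2)] less.prems(1) by simp
  next
    case False
    then have "A = 0" using less.prems by (simp add: S_def)
    then show ?thesis by (simp add: linear_0[OF linear_Ad] linear_0[OF linear_proj_1])
  qed
qed

lemma proj_1_Ad: "proj_1 (Ad G z A) = proj_1 A"
proof -
  have hom: "proj_1 (Ad G z A) = proj_1 A" if "1 \<le> j" "A \<in> S j" for A j z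
  proof -
    have "proj_1 (Ad G z (brk B A)) = 0" for B z
    proof -
      have "(\<lambda>B. proj_1 (Ad G z (brk B A))) = (\<lambda>B. 0)"
      proof (rule linear_ext[OF proj_1_Ad_linear linear_zero])
        fix i B assume "1 \<le> i" "B \<in> S i"
        then show "proj_1 (Ad G z (brk B A)) = 0"
          using brk_S[of B i A j] that by (intro proj_1_Ad_higher[of "i + j"]) auto
      qed
      then show ?thesis by metis
    qed
    then have "proj_1 (Ad G z A) = proj_1 (Ad G e A)"
      by (intro constant_if_left_derivatives_vanish[OF smooth_proj_1_Ad]) (simp add: proj_1_Ad_derivative)
    then show ?thesis by simp
  qed
  have "(\<lambda>A. proj_1 (Ad G z A)) = proj_1"
    by (rule linear_ext[OF _ linear_proj_1])
      (use linear_compose[OF linear_Ad linear_proj_1] hom in \<open>auto simp: o_def\<close>)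
  then show ?thesis by metis
qed

text \<open>The first-stratum part of the left Maurer-Cartan form is closed, since its differential
  is given by brackets, which \<open>proj_1\<close> kills. A primitive of it plays the role of the
  projection of the group to its abelianization.\<close>

lemma abelianization:
  obtains \<psi> where "smooth \<psi>" "\<And>z A. der \<psi> z (L A z) = proj_1 A"
proof -
  define \<alpha> where "\<alpha> z \<xi> = proj_1 (left_trivialize G z \<xi>)" for z \<xi>
  have sm: "smooth (\<lambda>z. \<alpha> z \<xi>)" for \<xi>
    unfolding \<alpha>_def by (intro smooth_linear[OF linear_proj_1] smooth_left_trivialize smooth_id smooth_const)
  have lin: "linear (\<alpha> z)" for z
    unfolding \<alpha>_def[abs_def] using linear_compose[OF linear_left_trivialize linear_proj_1] by (simp add: o_def)
  let ?D = "\<lambda>\<xi> z. der (\<lambda>z. \<alpha> z \<xi>) z"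
  \<comment> \<open>The form is constant on every left-invariant field, so its derivative can be
    traded for the derivative of the field.\<close>
  have *: "?D (L B z) z (L A z) =
     - \<alpha> z (der (L B) z (L A z))" for A B z
  proof -
    have smB: "smooth (L B)" by (rule smooth_left_inv_field_const)
    have "((\<lambda>z. \<alpha> z (L B z)) has_derivative
      (\<lambda>v. ?D (L B z) z v + \<alpha> z (der (L B) z v))) (at z)"
      by (rule form_has_derivative[OF sm lin has_derivative_ident smooth_has_derivative[OF smB]])
    moreover have "((\<lambda>z. \<alpha> z (L B z)) has_derivative (\<lambda>v. 0)) (at z)"
      by (simp add: \<alpha>_def)
    ultimately have "(\<lambda>v. ?D (L B z) z v + \<alpha> z (der (L B) z v)) = (\<lambda>v. 0)"
      by (rule has_derivative_unique)
    from fun_cong[OF this] show ?thesis by (simp add: eq_neg_iff_add_eq_0)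
  qed
  have closed: "?D \<xi> z \<zeta> = ?D \<zeta> z \<xi>" for z \<xi> \<zeta>
  proof -
    obtain A B where AB: "\<xi> = L A z" "\<zeta> = L B z"
      by (metis left_inv_field_left_trivialize)
    have "?D \<xi> z \<zeta> - ?D \<zeta> z \<xi> = \<alpha> z (vf_bracket (L A) (L B) z)"
      unfolding AB * vf_bracket_def linear_diff[OF lin] by simp
    also have "\<dots> = 0"
      unfolding vf_bracket_left_inv_fields \<alpha>_def by (simp add: proj_1_brk)
    finally show ?thesis by simp
  qed
  obtain \<psi> where \<psi>: "smooth \<psi>" "\<And>z. (\<psi> has_derivative \<alpha> z) (at z)"
    using poincare_lemma[OF sm lin closed] by blast
  show ?thesis
    by (rule that[OF \<psi>(1)]) (simp add: frechet_derivative_at[OF \<psi>(2), symmetric] \<alpha>_def)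
qed

end

section \<open>Integral curves and the Carnot--Caratheodory distance\<close>

lemma smooth_lipschitz_on_cball:
  fixes f :: "'a::euclidean_space \<Rightarrow> 'b::euclidean_space"
  assumes f: "smooth f"
  obtains K where "1 \<le> K" "\<And>x y. x \<in> cball p r \<Longrightarrow> y \<in> cball p r \<Longrightarrow> norm (f x - f y) \<le> K * norm (x - y)"
proof -
  let ?h = "\<lambda>x. \<Sum>b\<in>Basis. norm (der f x b)"
  have "continuous_on UNIV ?h"
    by (intro continuous_on_sum continuous_on_norm smooth_continuous smooth_derivative f)
  then have "compact (?h ` cball p r)"
    by (intro compact_continuous_image compact_cball) (rule continuous_on_subset, auto)
  then obtain B where B': "\<forall>y\<in>?h ` cball p r. norm y \<le> B"
    using compact_imp_bounded bounded_iff by blast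
  have B: "?h x \<le> B" if "x \<in> cball p r" for x
  proof -
    have "norm (?h x) \<le> B" using B' that by blast
    then show ?thesis by (simp only: real_norm_def abs_le_iff)
  qed
  have on: "onorm (der f x) \<le> max 1 B" if "x \<in> cball p r" for x
  proof (rule onorm_le)
    fix v
    have "norm (der f x v) \<le> (\<Sum>b\<in>Basis. norm ((v \<bullet> b) *\<^sub>R der f x b))"
      unfolding frechet_derivative_expansion[OF f, of x v] by (rule norm_sum)
    also have "\<dots> \<le> (\<Sum>b\<in>Basis. norm v * norm (der f x b))"
      by (intro sum_mono) (auto simp: Basis_le_norm intro!: mult_right_mono)
    also have "\<dots> = norm v * ?h x" by (simp add: sum_distrib_left)
    also have "\<dots> \<le> norm v * max 1 B" using B[OF that] by (intro mult_left_mono) auto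
    finally show "norm (der f x v) \<le> max 1 B * norm v" by (simp add: mult.commute)
  qed
  show ?thesis
  proof (rule that[of "max 1 B"])
    fix x y assume "x \<in> cball p r" "y \<in> cball p r"
    then show "norm (f x - f y) \<le> max 1 B * norm (x - y)"
      by (intro differentiable_bound[OF convex_cball has_derivative_at_withinI[OF smooth_has_derivative[OF f]] on])
  qed simp
qed

text \<open>Picard iteration on bounded continuous functions of the whole line. The clamp
  \<open>c\<close> keeps the time in [0, a], so that the iterates are defined everywhere.\<close>

lemma local_integral_curve:
  fixes f :: "'a::euclidean_space \<Rightarrow> 'a"
  assumes f: "smooth f"
  obtains a \<gamma> where "0 < a" "\<gamma> 0 = p"
    "\<And>t. t \<in> {0..a} \<Longrightarrow> (\<gamma> has_vector_derivative f (\<gamma> t)) (at t within {0..a})"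
proof -
  obtain K where K: "1 \<le> K"
    "\<And>x y. x \<in> cball p 1 \<Longrightarrow> y \<in> cball p 1 \<Longrightarrow> norm (f x - f y) \<le> K * norm (x - y)"
    using smooth_lipschitz_on_cball[OF f] by blast
  define B where "B = norm (f p) + K"
  have B: "norm (f x) \<le> B" if "x \<in> cball p 1" for x
  proof -
    have "norm (f x - f p) \<le> K * norm (x - p)" using K(2)[of x p] that by simp
    also have "\<dots> \<le> K * 1" using that K(1) by (intro mult_left_mono) (auto simp: dist_norm norm_minus_commute)
    finally show ?thesis using norm_triangle_ineq2[of "f x" "f p"] by (simp add: B_def)
  qed
  \<comment> \<open>B * a \<le> 1 keeps the iterates in the unit ball about p, and K * a \<le> 1 / 2
    makes the iteration a contraction.\<close>
  define a where "a = 1 / (2 * (B + K))"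
  have BK: "1 \<le> B" using K(1) norm_ge_zero[of "f p"] unfolding B_def by linarith
  have a: "0 < a" "B * a \<le> 1" "K * a \<le> 1 / 2"
    using BK K(1) by (auto simp: a_def field_simps)
  define c where "c t = max 0 (min t a)" for t
  have c: "0 \<le> c t" "c t \<le> a" "t \<in> {0..a} \<Longrightarrow> c t = t" for t using a by (auto simp: c_def)
  have contc: "continuous_on UNIV c" unfolding c_def by (intro continuous_intros)
  define S where "S = PiC UNIV (\<lambda>_::real. cball p 1)"
  define P where "P \<phi> t = p + integral {0..c t} (\<lambda>\<tau>. f (\<phi> \<tau>))" for \<phi> :: "real \<Rightarrow>\<^sub>C 'a" and t
  have contf: "continuous_on A (\<lambda>\<tau>. f (\<phi> \<tau>))" for A and \<phi> :: "real \<Rightarrow>\<^sub>C 'a"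
    by (rule continuous_on_compose2[OF smooth_continuous[OF f] continuous_on_apply_bcontfun]) auto
  have S: "apply_bcontfun \<phi> t \<in> cball p 1" if "\<phi> \<in> S" for \<phi> t
    using that by (auto simp: S_def mem_PiC_iff)
  have P_cball: "P \<phi> t \<in> cball p 1" if "\<phi> \<in> S" for \<phi> t
  proof -
    have "norm (integral {0..c t} (\<lambda>\<tau>. f (\<phi> \<tau>))) \<le> B * (c t - 0)"
      by (intro integral_bound contf c) (use B S that in blast)
    also have "\<dots> \<le> B * a" using c BK by (intro mult_left_mono) auto
    finally show ?thesis using a by (simp add: P_def dist_norm)
  qed
  have P_b: "P \<phi> \<in> bcontfun" if "\<phi> \<in> S" for \<phi>
    unfolding bcontfun_def
  proof (intro CollectI conjI)
    have "continuous_on {0..a} (\<lambda>x. integral {0..x} (\<lambda>\<tau>. f (\<phi> \<tau>)))"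
      by (intro indefinite_integral_continuous_1 integrable_continuous_real contf)
    then have "continuous_on UNIV (\<lambda>t. integral {0..c t} (\<lambda>\<tau>. f (\<phi> \<tau>)))"
      by (rule continuous_on_compose2[OF _ contc]) (use c in auto)
    then show "continuous_on UNIV (P \<phi>)" unfolding P_def[abs_def] by (intro continuous_intros)
    show "bounded (range (P \<phi>))"
      by (rule bounded_subset[OF bounded_cball[of p 1]]) (use P_cball[OF that] in blast)
  qed
  define Q where "Q \<phi> = Bcontfun (P \<phi>)" for \<phi>
  have Q: "apply_bcontfun (Q \<phi>) = P \<phi>" if "\<phi> \<in> S" for \<phi>
    unfolding Q_def by (rule Bcontfun_inverse[OF P_b[OF that]])
  have "\<exists>!\<phi>\<in>S. Q \<phi> = \<phi>"
  proof (rule Banach_fix[where c = "1 / 2"])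
    show "complete S" unfolding S_def by (simp add: complete_eq_closed closed_PiC)
    have "const_bcontfun p \<in> S" by (simp add: S_def mem_PiC_iff const_bcontfun.rep_eq)
    then show "S \<noteq> {}" by blast
    show "Q ` S \<subseteq> S" using P_cball by (auto simp: S_def mem_PiC_iff Q[unfolded S_def])
    fix \<phi> \<psi> assume \<phi>: "\<phi> \<in> S" and \<psi>: "\<psi> \<in> S"
    show "dist (Q \<phi>) (Q \<psi>) \<le> 1 / 2 * dist \<phi> \<psi>"
    proof (rule dist_bound)
      fix t
      have "P \<phi> t - P \<psi> t = integral {0..c t} (\<lambda>\<tau>. f (\<phi> \<tau>) - f (\<psi> \<tau>))"
        unfolding P_def by (subst integral_diff) (auto intro!: integrable_continuous_real contf)
      also have "norm \<dots> \<le> (K * dist \<phi> \<psi>) * (c t - 0)"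
      proof (intro integral_bound c continuous_on_diff contf)
        fix \<tau>
        have "norm (f (\<phi> \<tau>) - f (\<psi> \<tau>)) \<le>
           K * norm (\<phi> \<tau> - \<psi> \<tau>)"
          by (rule K(2)[OF S[OF \<phi>] S[OF \<psi>]])
        also have "\<dots> \<le> K * dist \<phi> \<psi>"
          using dist_bounded[of \<phi> \<tau> \<psi>] K(1) by (intro mult_left_mono) (auto simp: dist_norm)
        finally show "norm (f (\<phi> \<tau>) - f (\<psi> \<tau>)) \<le> K * dist \<phi> \<psi>" .
      qed
      also have "\<dots> \<le> (K * dist \<phi> \<psi>) * a" using c K(1) by (intro mult_left_mono) auto
      also have "\<dots> = (K * a) * dist \<phi> \<psi>" by simp
      also have "\<dots> \<le> 1 / 2 * dist \<phi> \<psi>" using a(3) by (intro mult_right_mono) auto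
      finally show "dist (apply_bcontfun (Q \<phi>) t) (apply_bcontfun (Q \<psi>) t) \<le> 1 / 2 * dist \<phi> \<psi>"
        by (simp add: Q[OF \<phi>] Q[OF \<psi>] dist_norm)
    qed
  qed auto
  then obtain \<phi> where \<phi>: "\<phi> \<in> S" "Q \<phi> = \<phi>" by blast
  define \<gamma> where "\<gamma> = apply_bcontfun \<phi>"
  have \<gamma>: "\<gamma> t = p + integral {0..t} (\<lambda>\<tau>. f (\<gamma> \<tau>))" if "t \<in> {0..a}" for t
  proof -
    have "apply_bcontfun \<phi> = P \<phi>" using Q[OF \<phi>(1)] unfolding \<phi>(2) .
    from fun_cong[OF this, of t] show ?thesis unfolding P_def c(3)[OF that] \<gamma>_def .
  qed
  show ?thesis
  proof (rule that[OF a(1)])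
    show "\<gamma> 0 = p" using \<gamma>[of 0] a(1) by simp
    fix t assume t: "t \<in> {0..a}"
    have "((\<lambda>t. p + integral {0..t} (\<lambda>\<tau>. f (\<gamma> \<tau>))) has_vector_derivative 0 + f (\<gamma> t)) (at t within {0..a})"
      by (intro has_vector_derivative_add has_vector_derivative_const integral_has_vector_derivative t)
        (simp add: \<gamma>_def contf)
    then have I: "((\<lambda>t. p + integral {0..t} (\<lambda>\<tau>. f (\<gamma> \<tau>))) has_vector_derivative f (\<gamma> t)) (at t within {0..a})"
      by simp
    show "(\<gamma> has_vector_derivative f (\<gamma> t)) (at t within {0..a})"
      by (rule has_vector_derivative_transform[OF t _ I]) (rule \<gamma>)
  qed
qed

text \<open>A parametrization of \<open>[0, R]\<close>, traversed backwards on the unit interval, that is defined and smooth on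
  the whole line without leaving \<open>[0, R]\<close>: curves defined only on \<open>[0, R]\<close> become smooth in the sense of
  \<open>smooth\<close>, and they end, rather than start, at their base point.\<close>

definition swing :: "real \<Rightarrow> real \<Rightarrow> real" where "swing R t = R * (1 + cos (pi * t)) / 2"
definition swing' :: "real \<Rightarrow> real \<Rightarrow> real" where "swing' R t = - (R * pi / 2) * sin (pi * t)"

lemma swing_0 [simp]: "swing R 0 = R" and swing_1 [simp]: "swing R 1 = 0"
  by (simp_all add: swing_def)

lemma swing_bounds:
  assumes "0 \<le> R"
  shows "swing R t \<in> {0..R}"
proof -
  have "0 \<le> 1 + cos (pi * t)" "1 + cos (pi * t) \<le> 2"
    using cos_ge_minus_one[of "pi * t"] cos_le_one[of "pi * t"] by linarith+
  then have "0 \<le> R * (1 + cos (pi * t))" "R * (1 + cos (pi * t)) \<le> R * 2"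
    using assms by (intro mult_nonneg_nonneg mult_left_mono; simp)+
  then show ?thesis by (simp add: swing_def)
qed

lemma swing_derivative: "(swing R has_vector_derivative swing' R t) (at t within A)"
  unfolding swing_def[abs_def] swing'_def has_real_derivative_iff_has_vector_derivative[symmetric]
  by (auto intro!: derivative_eq_intros)

lemma swing'_nonpos: "0 \<le> R \<Longrightarrow> t \<in> {0..1} \<Longrightarrow> swing' R t \<le> 0"
  by (auto simp: swing'_def mult_le_cancel_left1 intro!: mult_nonneg_nonneg sin_ge_zero)

lemma C_k_sin_cos: "C_k k (\<lambda>t::real. a * sin (b * t) + c * cos (b * t))"
proof (induction k arbitrary: a c)
  case (Suc k)
  show ?case
  proof (rule C_k_SucI)
    fix t :: real
    show "((\<lambda>t::real. a * sin (b * t) + c * cos (b * t)) has_derivative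
      (\<lambda>v. v *\<^sub>R ((- c * b) * sin (b * t) + (a * b) * cos (b * t)))) (at t)"
      by (auto intro!: derivative_eq_intros simp: algebra_simps)
    show "C_k k (\<lambda>t. v *\<^sub>R ((- c * b) * sin (b * t) + (a * b) * cos (b * t)))" for v
      by (intro C_k_scaleR C_k_const Suc)
  qed
qed (auto intro!: continuous_intros)

lemma smooth_swing': "smooth (swing' R)"
  unfolding smooth_def swing'_def using C_k_sin_cos[of _ "- (R * pi / 2)" pi 0] by simp

text \<open>Bootstrapping: by the equation, the derivative of g is as regular as g itself.\<close>

lemma smooth_time_dependent_curve:
  fixes f :: "'a::euclidean_space \<Rightarrow> 'a"
  assumes f: "smooth f" and \<theta>: "smooth \<theta>" and g: "\<And>t. (g has_vector_derivative \<theta> t *\<^sub>R f (g t)) (at t)"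
  shows "smooth g"
proof -
  have "C_k k g" for k
  proof (induction k)
    case 0
    show ?case using g has_vector_derivative_continuous continuous_at_imp_continuous_on by (simp, blast)
  next
    case (Suc k)
    show ?case
    proof (rule C_k_SucI)
      show "(g has_derivative (\<lambda>v. v *\<^sub>R (\<theta> t *\<^sub>R f (g t)))) (at t)" for t
        using g[of t] by (simp only: has_vector_derivative_def)
      show "C_k k (\<lambda>t. v *\<^sub>R (\<theta> t *\<^sub>R f (g t)))" for v
        by (intro C_k_scaleR C_k_const smooth_C_k[OF \<theta>] C_k_compose[OF smooth_C_k[OF f]] Suc)
    qed
  qed
  then show ?thesis unfolding smooth_def by blast
qed

lemma integrable_on_pieces:
  fixes f :: "real \<Rightarrow> real"
  assumes S: "finite S"
    and pieces: "\<And>a b. 0 \<le> a \<Longrightarrow> a < b \<Longrightarrow> b \<le> 1 \<Longrightarrow> {a<..<b} \<inter> S = {} \<Longrightarrow> f integrable_on {a..b}"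
  shows "f integrable_on {0..1}"
proof -
  have "0 \<le> a \<Longrightarrow> a \<le> b \<Longrightarrow> b \<le> 1 \<Longrightarrow> f integrable_on {a..b}" for a b
  proof (induction "card ({a<..<b} \<inter> S)" arbitrary: a b rule: less_induct)
    case less
    show ?case
    proof (cases "{a<..<b} \<inter> S = {}")
      case True
      then show ?thesis using pieces[of a b] less.prems integrable_on_refl[of f a] by (cases "a = b") auto
    next
      case False
      then obtain s where s: "s \<in> S" "a < s" "s < b" by auto
      have "card ({a<..<s} \<inter> S) < card ({a<..<b} \<inter> S)" "card ({s<..<b} \<inter> S) < card ({a<..<b} \<inter> S)"
        using s S by (auto intro!: psubset_card_mono)
      then have "f integrable_on {a..s}" "f integrable_on {s..b}"
        using less.hyps less.prems s by auto
      then show ?thesis using s by (intro Henstock_Kurzweil_Integration.integrable_combine[of a s b f]) auto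
    qed
  qed
  then show ?thesis by simp
qed

section \<open>Upper and lower bounds for the Carnot-Caratheodory distance\<close>

locale scalar_product =
  fixes ip :: "'a::euclidean_space \<Rightarrow> 'a \<Rightarrow> real"
  assumes bilinear_ip: "bilinear ip" and ip_commute: "ip X Y = ip Y X" and ip_pos: "X \<noteq> 0 \<Longrightarrow> 0 < ip X X"
begin

definition ip_norm :: "'a \<Rightarrow> real" where "ip_norm X = sqrt (ip X X)"

lemma ip_linear: "linear (ip X)" "linear (\<lambda>X. ip X Y)"
  using bilinear_ip unfolding bilinear_def by blast+

lemmas ip_simps = linear_add[OF ip_linear(1)] linear_add[OF ip_linear(2)] linear_diff[OF ip_linear(1)]
  linear_diff[OF ip_linear(2)] linear_scale[OF ip_linear(1)] linear_scale[OF ip_linear(2)]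
  linear_0[OF ip_linear(1)] linear_0[OF ip_linear(2)]

lemma ip_nonneg: "0 \<le> ip X X"
  using ip_pos[of X] by (cases "X = 0") (auto simp: ip_simps less_imp_le)

lemma ip_norm_pos: "X \<noteq> 0 \<Longrightarrow> 0 < ip_norm X"
  unfolding ip_norm_def using ip_pos by simp

lemma ip_norm_nonneg: "0 \<le> ip_norm X"
  unfolding ip_norm_def using ip_nonneg by simp

lemma ip_norm_square: "ip_norm X * ip_norm X = ip X X"
  unfolding ip_norm_def using ip_nonneg by simp

lemma ip_norm_scale: "ip_norm (c *\<^sub>R X) = \<bar>c\<bar> * ip_norm X"
  unfolding ip_norm_def by (simp add: ip_simps real_sqrt_mult flip: power2_eq_square mult.assoc)

lemma cauchy_schwarz: "ip X Y \<le> ip_norm X * ip_norm Y"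
proof (cases "Y = 0")
  case False
  define c where "c = ip X Y / ip Y Y"
  have Y: "0 < ip Y Y" using ip_pos[OF False] .
  have "0 \<le> ip (X - c *\<^sub>R Y) (X - c *\<^sub>R Y)" by (rule ip_nonneg)
  also have "\<dots> = ip X X - 2 * c * ip X Y + c * c * ip Y Y"
    using ip_commute[of Y X] by (simp add: ip_simps algebra_simps)
  also have "\<dots> = ip X X - ip X Y * ip X Y / ip Y Y"
    using Y by (simp add: c_def field_simps)
  finally have "(ip X Y)\<^sup>2 \<le> ip X X * ip Y Y" using Y by (simp add: field_simps power2_eq_square)
  then have "\<bar>ip X Y\<bar> \<le> sqrt (ip X X * ip Y Y)" by (simp add: real_le_rsqrt)
  then show ?thesis by (simp add: ip_norm_def real_sqrt_mult)
qed (simp add: ip_simps ip_norm_def)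

lemma continuous_ip_norm: "continuous_on A g \<Longrightarrow> continuous_on A (\<lambda>x. ip_norm (g x))"
proof -
  assume g: "continuous_on A g"
  have "smooth (\<lambda>x. ip x x)"
    by (rule smooth_form[OF smooth_linear[OF ip_linear(2) smooth_id] ip_linear(1) smooth_id smooth_id])
  from continuous_on_compose2[OF smooth_continuous[OF this] g]
  show ?thesis unfolding ip_norm_def by (intro continuous_on_real_sqrt) auto
qed

end

locale sub_riemannian = smooth_group G + scalar_product ip
  for G :: "'a::euclidean_space monoid" and ip :: "'a \<Rightarrow> 'a \<Rightarrow> real" +
  fixes V1 :: "'a set"
  assumes subspace_V1: "subspace V1"
begin

text \<open>Along a horizontal curve the velocity of its image under \<psi> is its left-trivialized
  velocity. Pairing with d = \<psi> q - \<psi> p and integrating gives |d|^2 \<le> |d| times the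
  length, by Cauchy-Schwarz.\<close>

lemma cc_dist_ge:
  assumes \<chi>: "smooth \<psi>" "\<And>p X. X \<in> V1 \<Longrightarrow> der \<psi> p (L X p) = X"
  shows "ennreal (ip_norm (\<psi> q - \<psi> p)) \<le> cc_dist G V1 ip p q"
  unfolding cc_dist_def
proof (rule INF_greatest, clarify)
  fix \<gamma> assume hc: "horizontal_curve G V1 \<gamma>" and pq: "p = pathstart \<gamma>" "q = pathfinish \<gamma>"
  have path: "continuous_on {0..1} \<gamma>" using hc unfolding horizontal_curve_def path_def by (elim conjE)
  obtain S where S': "finite S \<and>
        (\<forall>a b. 0 \<le> a \<and> a < b \<and> b \<le> 1 \<and> {a<..<b} \<inter> S = {} \<longrightarrow>
           (\<exists>g. smooth g \<and> (\<forall>t\<in>{a..b}. \<gamma> t = g t))) \<and>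
        (\<forall>t\<in>{0<..<1} - S. vector_derivative \<gamma> (at t) \<in> horizontal G V1 (\<gamma> t))"
    using hc[unfolded horizontal_curve_def, THEN conjunct2] by (rule exE)
  then have S: "finite S" by (elim conjE)
  have pieces: "\<exists>g. smooth g \<and> (\<forall>t\<in>{a..b}. \<gamma> t = g t)"
    if "0 \<le> a" "a < b" "b \<le> 1" "{a<..<b} \<inter> S = {}" for a b
    using S'[THEN conjunct2, THEN conjunct1, THEN spec[of _ a], THEN spec[of _ b], THEN mp] that by simp
  have hor: "vector_derivative \<gamma> (at t) \<in> horizontal G V1 (\<gamma> t)" if "t \<in> {0<..<1} - S" for t
    using S' that by (elim conjE) (rule bspec)
  define \<omega> where "\<omega> t = left_trivialize G (\<gamma> t) (vector_derivative \<gamma> (at t))" for t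
  have len: "curve_length G ip \<gamma> = integral {0..1} (\<lambda>t. ip_norm (\<omega> t))"
    unfolding curve_length_def \<omega>_def ip_norm_def Let_def ..
  \<comment> \<open>The integral of a nonintegrable function is 0 by convention, so a lower bound
    for the length requires integrability of the speed.\<close>
  have int: "(\<lambda>t. ip_norm (\<omega> t)) integrable_on {0..1}"
  proof (rule integrable_on_pieces[OF S])
    fix a b :: real assume ab: "0 \<le> a" "a < b" "b \<le> 1" "{a<..<b} \<inter> S = {}"
    obtain g where g: "smooth g" "\<And>t. t \<in> {a..b} \<Longrightarrow> \<gamma> t = g t" using pieces[OF ab] by blast
    have "smooth (\<lambda>t. left_trivialize G (g t) (der g t 1))"
      by (intro smooth_left_trivialize smooth_derivative g(1))
    then have "(\<lambda>t. ip_norm (left_trivialize G (g t) (der g t 1))) integrable_on {a..b}"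
      by (intro integrable_continuous_real continuous_ip_norm continuous_on_subset[OF smooth_continuous]) auto
    then show "(\<lambda>t. ip_norm (\<omega> t)) integrable_on {a..b}"
    \<comment> \<open>At a and b the curve agrees with g on one side only, so its two-sided
      derivative is read off in the interior and the endpoints are discarded.\<close>
    proof (rule integrable_spike_finite[of "{a, b}", rotated 2])
      fix t assume "t \<in> {a..b} - {a, b}"
      then have t: "a < t" "t < b" by auto
      have "(g has_vector_derivative der g t 1) (at t)"
        using smooth_line[OF g(1), of 0 1 t] by simp
      then have "(\<gamma> has_vector_derivative der g t 1) (at t)"
        by (rule has_vector_derivative_transform_within_open[of _ _ _ "{a<..<b}"]) (use t g(2) in auto)
      then show "ip_norm (\<omega> t) = ip_norm (left_trivialize G (g t) (der g t 1))"
        using g(2)[of t] t by (simp add: \<omega>_def vector_derivative_at)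
    qed simp
  qed
  define d where "d = \<psi> q - \<psi> p"
  have "((\<lambda>t. ip d (\<omega> t)) has_integral ip d (\<psi> (\<gamma> 1)) - ip d (\<psi> (\<gamma> 0))) {0..1}"
  proof (rule fundamental_theorem_of_calculus_interior_strong[OF S])
    show "continuous_on {0..1} (\<lambda>t. ip d (\<psi> (\<gamma> t)))"
      by (rule continuous_on_compose2[OF smooth_continuous[OF smooth_linear[OF ip_linear(1) \<chi>(1)]] path]) simp
    fix t :: real assume t: "t \<in> {0<..<1} - S"
    \<comment> \<open>A closed interval around t that avoids S is needed to replace the curve by a
      smooth one near t.\<close>
    have "open ({0<..<1} - S)" using finite_imp_closed[OF S] by (intro open_Diff) auto
    then obtain \<epsilon> where \<epsilon>: "0 < \<epsilon>" "cball t \<epsilon> \<subseteq> {0<..<1} - S"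
      using t open_contains_cball by blast
    define a b where "a = t - \<epsilon>" and "b = t + \<epsilon>"
    have in_ball: "{a..b} \<subseteq> cball t \<epsilon>" by (auto simp: a_def b_def dist_real_def)
    have t': "a < t" "t < b" using \<epsilon>(1) by (auto simp: a_def b_def)
    have "{a..b} \<subseteq> {0<..<1}" "a \<in> {a..b}" "b \<in> {a..b}" using in_ball \<epsilon>(2) t' by auto
    then have "a \<in> {0<..<1}" "b \<in> {0<..<1}" by blast+
    then have ab: "0 \<le> a" "a < b" "b \<le> 1" using t' by auto
    have "{a<..<b} \<subseteq> {a..b}" by auto
    then have "{a<..<b} \<inter> S = {}" using in_ball \<epsilon>(2) by blast
    then obtain g where g: "smooth g" "\<And>t. t \<in> {a..b} \<Longrightarrow> \<gamma> t = g t" using pieces[OF ab] by blast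
    have "(g has_vector_derivative der g t 1) (at t)"
      using smooth_line[OF g(1), of 0 1 t] by simp
    then have "(\<gamma> has_vector_derivative der g t 1) (at t)"
      by (rule has_vector_derivative_transform_within_open[of _ _ _ "{a<..<b}"]) (use t' g(2) in auto)
    then have \<gamma>': "(\<gamma> has_vector_derivative vector_derivative \<gamma> (at t)) (at t)"
      by (simp add: vector_derivative_at)
    obtain X where X: "X \<in> V1" "vector_derivative \<gamma> (at t) = L X (\<gamma> t)"
      using hor[OF t] unfolding horizontal_def by blast
    have "((\<lambda>t. \<psi> (\<gamma> t)) has_vector_derivative X) (at t)"
      using has_vector_derivative_smooth_compose[OF \<chi>(1) \<gamma>'] \<chi>(2)[OF X(1)] by (simp add: X(2))
    from has_vector_derivative_smooth_compose[OF smooth_linear[OF ip_linear(1) smooth_id] this, of d]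
    have "((\<lambda>t. ip d (\<psi> (\<gamma> t))) has_vector_derivative der (ip d) (\<psi> (\<gamma> t)) X) (at t)" .
    moreover have "der (ip d) z = ip d" for z
      by (rule frechet_derivative_at[symmetric], rule bounded_linear_imp_has_derivative)
        (simp only: linear_conv_bounded_linear[symmetric] ip_linear(1))
    moreover have "\<omega> t = X" by (simp add: \<omega>_def X(2))
    ultimately show "((\<lambda>t. ip d (\<psi> (\<gamma> t))) has_vector_derivative ip d (\<omega> t)) (at t)" by simp
  qed simp
  moreover have "ip d (\<psi> (\<gamma> 1)) - ip d (\<psi> (\<gamma> 0)) = ip d d"
    unfolding d_def pq pathstart_def pathfinish_def by (simp add: ip_simps)
  ultimately have I: "((\<lambda>t. ip d (\<omega> t)) has_integral ip d d) {0..1}" by simp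
  have J: "((\<lambda>t. ip_norm d * ip_norm (\<omega> t)) has_integral ip_norm d * curve_length G ip \<gamma>) {0..1}"
    unfolding len by (intro has_integral_mult_right integrable_integral int)
  have "ip_norm d * ip_norm d \<le> ip_norm d * curve_length G ip \<gamma>"
    unfolding ip_norm_square by (rule has_integral_le[OF I J]) (rule cauchy_schwarz)
  moreover have "0 \<le> curve_length G ip \<gamma>"
    unfolding len by (rule integral_nonneg[OF int]) (rule ip_norm_nonneg)
  ultimately have "ip_norm d \<le> curve_length G ip \<gamma>"
    using ip_norm_nonneg[of d] by (cases "ip_norm d = 0") auto
  then show "ennreal (ip_norm (\<psi> (pathfinish \<gamma>) - \<psi> (pathstart \<gamma>))) \<le> ennreal (curve_length G ip \<gamma>)"
    unfolding d_def pq by (rule ennreal_leI)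
qed

text \<open>The curve follows \<open>L X\<close> with the signed speed \<open>swing'\<close>, whose
  absolute value has integral R over [0, 1] because \<open>swing R\<close> decreases from R to 0
  there.\<close>

lemma cc_dist_le:
  assumes X: "X \<in> V1" and R: "0 \<le> R"
    and \<gamma>: "\<And>t. (\<gamma> has_vector_derivative swing' R t *\<^sub>R L X (\<gamma> t)) (at t)"
  shows "cc_dist G V1 ip (\<gamma> 0) (\<gamma> 1) \<le> ennreal (R * ip_norm X)"
proof -
  have smX: "smooth (L X)" by (rule smooth_left_inv_field_const)
  have sm: "smooth \<gamma>" by (rule smooth_time_dependent_curve[OF smX smooth_swing' \<gamma>])
  have vd: "vector_derivative \<gamma> (at t) = L (swing' R t *\<^sub>R X) (\<gamma> t)" for t
    using vector_derivative_at[OF \<gamma>] by (simp add: linear_scale[OF linear_left_inv_field])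
  have "horizontal_curve G V1 \<gamma>"
    unfolding horizontal_curve_def
  proof (intro conjI exI[of _ "{}"] allI impI ballI)
    show "path \<gamma>" unfolding path_def using continuous_on_subset[OF smooth_continuous[OF sm]] by blast
    show "\<exists>g. smooth g \<and> (\<forall>t\<in>{a..b}. \<gamma> t = g t)" for a b using sm by blast
    show "vector_derivative \<gamma> (at t) \<in> horizontal G V1 (\<gamma> t)" for t
      unfolding vd horizontal_def using X subspace_scale[OF subspace_V1] by blast
  qed simp
  then have "cc_dist G V1 ip (\<gamma> 0) (\<gamma> 1) \<le> ennreal (curve_length G ip \<gamma>)"
    unfolding cc_dist_def by (intro INF_lower) (simp add: pathstart_def pathfinish_def)
  also have "curve_length G ip \<gamma> = integral {0..1} (\<lambda>t. \<bar>swing' R t\<bar> * ip_norm X)"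
    unfolding curve_length_def Let_def vd left_trivialize_left_inv_field ip_norm_def[symmetric] ip_norm_scale ..
  also have "\<dots> = integral {0..1} (\<lambda>t. swing' R t * - ip_norm X)"
    by (rule integral_cong) (simp add: abs_of_nonpos swing'_nonpos[OF R])
  also have "\<dots> = R * ip_norm X"
  proof (rule integral_unique)
    have "(swing' R has_integral swing R 1 - swing R 0) {0..1}"
      by (rule fundamental_theorem_of_calculus) (auto intro: swing_derivative)
    from has_integral_mult_left[OF this, of "- ip_norm X"]
    show "((\<lambda>t. swing' R t * - ip_norm X) has_integral R * ip_norm X) {0..1}" by simp
  qed
  finally show ?thesis .
qed

end

section \<open>Shears\<close>

lemma (in scalar_product) ip_norm_triangle: "ip_norm (X + Y) \<le> ip_norm X + ip_norm Y"
proof (rule power2_le_imp_le)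
  have "(ip_norm (X + Y))\<^sup>2 = ip X X + 2 * ip X Y + ip Y Y"
    using ip_commute[of Y X] by (simp add: power2_eq_square ip_norm_square ip_simps)
  also have "\<dots> \<le> ip X X + 2 * (ip_norm X * ip_norm Y) + ip Y Y" using cauchy_schwarz[of X Y] by simp
  also have "\<dots> = (ip_norm X + ip_norm Y)\<^sup>2"
    by (simp add: power2_eq_square algebra_simps flip: ip_norm_square)
  finally show "(ip_norm (X + Y))\<^sup>2 \<le> (ip_norm X + ip_norm Y)\<^sup>2" .
qed (simp add: ip_norm_nonneg)

context carnot
begin

abbreviation "H1 \<equiv> semidirect_strata V 1"

lemma H1_iff: "(A, B) \<in> H1 \<longleftrightarrow> A \<in> V 1 \<and> B \<in> V 1"
  by (simp add: semidirect_strata_def)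

lemma V_1_subspace: "subspace (V 1)"
  using subspace_V l_ge_1 by simp

lemma algebra_dilation_S:
  assumes "algebra_dilation V l s D" "X \<in> S i"
  shows "D X = s ^ nat i *\<^sub>R X"
proof (cases "1 \<le> i \<and> i \<le> int l")
  case True
  then have "nat i \<in> {1..l}" "X \<in> V (nat i)" using assms(2) by (auto simp: S_def)
  then show ?thesis using assms(1) unfolding algebra_dilation_def by blast
next
  case False
  then have "X = 0" using assms(2) by (auto simp: S_def)
  then show ?thesis using assms(1) linear_0 unfolding algebra_dilation_def by auto
qed

lemma algebra_dilation_component:
  assumes D: "algebra_dilation V l s D"
  shows "component j (D X) = s ^ j *\<^sub>R component j X"
proof -
  have linD: "linear D" using D unfolding algebra_dilation_def by blast
  have "(\<lambda>X. component j (D X)) = (\<lambda>X. s ^ j *\<^sub>R component j X)"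
  proof (rule linear_ext)
    show "linear (\<lambda>X. component j (D X))" using linear_compose[OF linD linear_component] by (simp add: o_def)
    show "linear (\<lambda>X. s ^ j *\<^sub>R component j X)"
      using linear_compose_scale_right[OF linear_component] by simp
    fix i X assume X: "1 \<le> i" "X \<in> S i"
    show "component j (D X) = s ^ j *\<^sub>R component j X"
      unfolding algebra_dilation_S[OF D X(2)] linear_scale[OF linear_component] component_S[OF X(2)] by auto
  qed
  then show ?thesis by (rule fun_cong)
qed

lemma homomorphism_derivative:
  assumes \<delta>: "\<delta> \<in> hom G G" "smooth \<delta>"
  shows "der \<delta> (p \<cdot> q) (Rt p q \<xi>) = Rt (\<delta> p) (\<delta> q) (der \<delta> p \<xi>)"
    and "der \<delta> (p \<cdot> q) (Lt p q \<eta>) = Lt (\<delta> p) (\<delta> q) (der \<delta> q \<eta>)"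
proof -
  have hom: "\<delta> (p \<cdot> q) = \<delta> p \<cdot> \<delta> q" for p q using hom_mult[OF \<delta>(1)] by simp
  have 1: "((\<lambda>p. \<delta> p \<cdot> \<delta> q) has_derivative (\<lambda>v. der \<delta> (p \<cdot> q) (Rt p q v))) (at p)"
    using has_derivative_compose[OF mul_right_has_derivative smooth_has_derivative[OF \<delta>(2)], of q p] by (simp add: hom)
  show "der \<delta> (p \<cdot> q) (Rt p q \<xi>) = Rt (\<delta> p) (\<delta> q) (der \<delta> p \<xi>)"
    by (rule fun_cong[OF has_derivative_unique[OF 1
          has_derivative_compose[OF smooth_has_derivative[OF \<delta>(2)] mul_right_has_derivative]]])
  have 2: "((\<lambda>q. \<delta> p \<cdot> \<delta> q) has_derivative (\<lambda>v. der \<delta> (p \<cdot> q) (Lt p q v))) (at q)"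
    using has_derivative_compose[OF mul_left_has_derivative smooth_has_derivative[OF \<delta>(2)], of p q] by (simp add: hom)
  show "der \<delta> (p \<cdot> q) (Lt p q \<eta>) = Lt (\<delta> p) (\<delta> q) (der \<delta> q \<eta>)"
    by (rule fun_cong[OF has_derivative_unique[OF 2
          has_derivative_compose[OF smooth_has_derivative[OF \<delta>(2)] mul_left_has_derivative]]])
qed

end

section \<open>The shear defined by a precontact field of degree one\<close>

locale precontact_field = carnot G brk V l
  for G :: "'a::euclidean_space monoid" and brk V l +
  fixes \<omega> :: "'a \<Rightarrow> 'a"
  assumes precontact: "precontact G (V 1) \<omega>"
    and homogeneous: "homogeneous_vf G V l 1 \<omega>"
    and nonzero: "\<omega> \<noteq> (\<lambda>_. 0)"
begin

lemma smooth_\<omega>: "smooth \<omega>"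
  using precontact unfolding precontact_def by blast

definition F :: "'a \<Rightarrow> 'a" where "F z = Rt z (iv z) (\<omega> z)"

lemma smooth_F: "smooth F"
  unfolding F_def by (intro smooth_Rt smooth_inv smooth_id smooth_\<omega>)

abbreviation DF :: "'a \<Rightarrow> 'a \<Rightarrow> 'a" where "DF z \<equiv> der F z"

text \<open>For B in V 1 this is C(z, B). As Ad acts trivially on the abelianization,
  \<open>proj_1\<close> recovers C(z, B) from Ad z C(z, B), with no inverse of Ad to
  differentiate.\<close>

definition twist :: "'a \<Rightarrow> 'a \<Rightarrow> 'a" where "twist z B = proj_1 (DF z (L B z))"

lemma DF_left_inv_field:
  assumes "B \<in> V 1"
  shows "twist z B \<in> V 1" "DF z (L B z) = Ad G z (twist z B)"
proof -
  obtain C where C: "C \<in> V 1" "DF z (L B z) = Ad G z C"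
    using precontact_right_trivialization[OF precontact assms] unfolding F_def by blast
  then have "twist z B = C" by (simp add: twist_def proj_1_Ad proj_1_V_1)
  then show "twist z B \<in> V 1" "DF z (L B z) = Ad G z (twist z B)" using C by auto
qed

text \<open>Degree one means F (\<delta> z) = s D (F z), where D is the differential of \<delta> at
  the identity and acts as s on the first stratum. So the first-stratum part of F scales by s^2, and
  since \<delta> maps \<open>L B\<close> to s times \<open>L B\<close>, one factor s is left for
  \<open>twist\<close>.\<close>

lemma dilation:
  assumes "0 < s"
  obtains \<delta> where "\<delta> e = e" "algebra_dilation V l s (der \<delta> e)"
    "\<And>z. F (\<delta> z) = s *\<^sub>R der \<delta> e (F z)"
    "\<And>z B. B \<in> V 1 \<Longrightarrow> twist (\<delta> z) B = s *\<^sub>R twist z B"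
proof -
  obtain \<delta> where \<delta>: "\<delta> \<in> iso G G" "smooth \<delta>" "algebra_dilation V l s (der \<delta> e)"
    and eq: "\<And>p. der \<delta> p (\<omega> p) = (s powi (- 1)) *\<^sub>R \<omega> (\<delta> p)"
    using homogeneous assms unfolding homogeneous_vf_def group_dilation_def by blast
  let ?D = "frechet_derivative \<delta>"
  have hom: "\<delta> \<in> hom G G" using \<delta>(1) by (simp add: iso_def)
  have group_hom: "group_hom G G \<delta>" using hom by unfold_locales
  have e: "\<delta> e = e" using group_hom.hom_one[OF group_hom] .
  have inv: "\<delta> (iv z) = iv (\<delta> z)" for z using group_hom.hom_inv[OF group_hom] by simp
  note D = homomorphism_derivative[OF hom \<delta>(2)]
  have \<omega>: "\<omega> (\<delta> z) = s *\<^sub>R ?D (at z) (\<omega> z)" for z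
    unfolding eq using assms by (simp add: power_int_minus)
  have F: "F (\<delta> z) = s *\<^sub>R ?D (at e) (F z)" for z
  proof -
    have "F (\<delta> z) = s *\<^sub>R Rt (\<delta> z) (\<delta> (iv z)) (?D (at z) (\<omega> z))"
      by (simp add: F_def \<omega> inv RL_simps)
    also have "\<dots> = s *\<^sub>R ?D (at (z \<cdot> iv z)) (Rt z (iv z) (\<omega> z))" by (simp only: D)
    finally show ?thesis by (simp add: F_def)
  qed
  have proj: "proj_1 (?D (at e) X) = s *\<^sub>R proj_1 X" for X
    using algebra_dilation_component[OF \<delta>(3), of 1 X] by (simp add: proj_1_def)
  have twist: "twist (\<delta> z) B = s *\<^sub>R twist z B" if B: "B \<in> V 1" for z B
  proof -
    have "?D (at (z \<cdot> e)) (Lt z e B) = Lt (\<delta> z) (\<delta> e) (?D (at e) B)" by (rule D)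
    then have LB: "?D (at z) (L B z) = s *\<^sub>R L B (\<delta> z)"
      using algebra_dilation_S[OF \<delta>(3), of B 1] B S_1
      by (simp add: e left_inv_field_eq RL_simps)
    have "((\<lambda>z. proj_1 (F (\<delta> z))) has_derivative (\<lambda>v. proj_1 (DF (\<delta> z) (?D (at z) v)))) (at z)"
      by (intro bounded_linear.has_derivative[OF bounded_linear_proj_1]
          has_derivative_compose[OF smooth_has_derivative[OF \<delta>(2)] smooth_has_derivative[OF smooth_F]])
    moreover have "(\<lambda>z. proj_1 (F (\<delta> z))) = (\<lambda>z. (s * s) *\<^sub>R proj_1 (F z))"
      by (simp add: F linear_scale[OF linear_proj_1] proj)
    ultimately have 1: "((\<lambda>z. (s * s) *\<^sub>R proj_1 (F z)) has_derivative (\<lambda>v. proj_1 (DF (\<delta> z) (?D (at z) v)))) (at z)"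
      by simp
    have 2: "((\<lambda>z. (s * s) *\<^sub>R proj_1 (F z)) has_derivative (\<lambda>v. (s * s) *\<^sub>R proj_1 (DF z v))) (at z)"
      by (intro has_derivative_scaleR_right bounded_linear.has_derivative[OF bounded_linear_proj_1] smooth_has_derivative[OF smooth_F])
    from fun_cong[OF has_derivative_unique[OF 1 2], of "L B z"]
    have "s *\<^sub>R twist (\<delta> z) B = (s * s) *\<^sub>R twist z B"
      unfolding LB twist_def linear_scale[OF smooth_linear_derivative[OF smooth_F]]
        linear_scale[OF linear_proj_1] .
    then show ?thesis using assms by (simp flip: scaleR_scaleR)
  qed
  show ?thesis using that e \<delta>(3) F twist by blast
qed

lemma twist_nonzero: "\<exists>z. \<exists>B\<in>V 1. twist z B \<noteq> 0"
proof (rule ccontr)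
  assume "\<not> ?thesis"
  then have tw: "twist z B = 0" if "B \<in> V 1" for z B using that by blast
  \<comment> \<open>The directions along which F is constant. They form a subalgebra, which is
    everything once it contains the generating stratum V 1.\<close>
  define T where "T = {B. \<forall>z. DF z (L B z) = 0}"
  have V1: "V 1 \<subseteq> T" using DF_left_inv_field(2) tw by (auto simp: T_def linear_0[OF linear_Ad])
  have subT: "subspace T"
    unfolding T_def subspace_def
    by (simp add: linear_0[OF linear_left_inv_field] linear_add[OF linear_left_inv_field]
        linear_scale[OF linear_left_inv_field] linear_0[OF smooth_linear_derivative[OF smooth_F]]
        linear_add[OF smooth_linear_derivative[OF smooth_F]] linear_scale[OF smooth_linear_derivative[OF smooth_F]])
  have brkT: "brk A B \<in> T" if A: "A \<in> T" and B: "B \<in> T" for A B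
  proof -
    \<comment> \<open>The derivative along \<open>L A\<close> of a function that vanishes
      identically. Antisymmetrizing in A and B removes the second derivative of F and leaves its
      derivative along the bracket.\<close>
    have *: "der (\<lambda>y. DF y (L B z)) z (L A z) +
       DF z (der (L B) z (L A z)) = 0"
      if B: "B \<in> T" for A B z
    proof -
      have smB: "smooth (L B)" by (rule smooth_left_inv_field_const)
      have 1: "((\<lambda>x. DF x (L B x)) has_derivative
        (\<lambda>v. der (\<lambda>y. DF y (L B z)) z v +
           DF z (der (L B) z v))) (at z)"
        by (rule derivative_joint_has_derivative[OF smooth_F has_derivative_ident smooth_has_derivative[OF smB]])
      have 2: "((\<lambda>x. DF x (L B x)) has_derivative (\<lambda>v. 0)) (at z)"
        using B by (simp add: T_def)
      from fun_cong[OF has_derivative_unique[OF 1 2]] show ?thesis .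
    qed
    have "DF z (L (brk A B) z) = 0" for z
    proof -
      have "DF z (vf_bracket (L A) (L B) z) =
        DF z (der (L B) z (L A z)) -
        DF z (der (L A) z (L B z))"
        unfolding vf_bracket_def by (rule linear_diff[OF smooth_linear_derivative[OF smooth_F]])
      also have "\<dots> = 0"
        using *[OF B, of z A] *[OF A, of z B]
          mixed_derivatives_commute[OF smooth_F, of "L B z" z "L A z"]
        by (simp add: add_eq_0_iff)
      finally show ?thesis unfolding vf_bracket_left_inv_fields .
    qed
    then show ?thesis unfolding T_def by blast
  qed
  have "S (int (Suc j)) \<subseteq> T" for j
  proof (induction j)
    case 0 then show ?case using V1 S_1 by simp
  next
    case (Suc j)
    show ?case
    proof (cases "int (Suc j) \<le> int l")
      case True
      have "S (int (Suc (Suc j))) = span {brk X Y | X Y. X \<in> S (int (Suc j)) \<and> Y \<in> S 1}"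
        using S_Suc[of "int (Suc j)"] True by (simp add: add.commute)
      also have "\<dots> \<subseteq> T" using Suc brkT V1 S_1 by (intro span_minimal subT) auto
      finally show ?thesis .
    next
      case False
      then show ?thesis using subspace_0[OF subT] by (simp add: S_def)
    qed
  qed
  then have ST: "S (int j) \<subseteq> T" if "1 \<le> j" for j using that by (cases j) auto
  have "B \<in> T" for B
  proof -
    have "(\<Sum>j=1..l. component j B) \<in> T"
      using ST component_in_S by (intro subspace_sum[OF subT]) (meson atLeastAtMost_iff subsetD)
    then show ?thesis by (simp only: sum_component)
  qed
  then have const: "F z = F e" for z
    by (intro constant_if_left_derivatives_vanish[OF smooth_F]) (auto simp: T_def)
  \<comment> \<open>With s = 2 the component of F e in stratum j would equal 2 * 2^j times itself,
    and this factor is never 1.\<close>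
  obtain \<delta> where \<delta>: "algebra_dilation V l 2 (der \<delta> e)"
    "F (\<delta> e) = 2 *\<^sub>R der \<delta> e (F e)"
    using dilation[of 2] by (metis zero_less_numeral)
  have "component j (F e) = 0" for j
  proof -
    have "component j (F e) = component j (2 *\<^sub>R der \<delta> e (F e))"
      using \<delta>(2) const by metis
    also have "\<dots> = (2 * 2 ^ j) *\<^sub>R component j (F e)"
      by (simp add: linear_scale[OF linear_component] algebra_dilation_component[OF \<delta>(1)])
    finally have "(2 * 2 ^ j - 1) *\<^sub>R component j (F e) = 0" by (simp add: algebra_simps)
    moreover have "(2 * 2 ^ j - 1 :: real) \<noteq> 0"
      using one_le_power[of "2::real" j] by linarith
    ultimately show ?thesis by simp
  qed
  then have "F e = 0" using sum_component[of "F e"] by simp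
  then have "\<omega> z = 0" for z
    using Rt_inverse'[of z "\<omega> z"] const[of z] by (simp add: F_def RL_simps)
  then show False using nonzero by blast
qed

definition shear_field :: "'a \<times> 'a \<Rightarrow> 'a \<times> 'a" where "shear_field h = (F (snd h), 0)"
definition shear :: "real \<Rightarrow> 'a \<times> 'a \<Rightarrow> 'a \<times> 'a" where "shear t h = (fst h + t *\<^sub>R F (snd h), snd h)"

lemma tau_field_eq:
  assumes "\<And>p. \<omega> p = (\<Sum>i=1..DIM('a). v i p *\<^sub>R L (X i) p)"
  shows "tau_field G X v = shear_field"
proof
  fix h :: "'a \<times> 'a"
  obtain Y z where h: "h = (Y, z)" by (cases h)
  have "F z = (\<Sum>i=1..DIM('a). v i z *\<^sub>R Ad G z (X i))"
    unfolding F_def assms linear_sum[OF linear_Rt] linear_scale[OF linear_Rt]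
    by (simp add: Ad_eq left_inv_field_eq)
  then show "tau_field G X v h = shear_field h"
    by (simp add: tau_field_def h shear_field_def left_inv_field_semidirect prod_eq_iff fst_sum snd_sum
        linear_0[OF linear_left_inv_field])
qed

lemma smooth_shear_field: "smooth shear_field"
  unfolding shear_field_def[abs_def]
  by (intro smooth_Pair smooth_const smooth_compose[OF smooth_F] smooth_snd smooth_id)

lemma smooth_shear: "smooth (shear t)"
  unfolding shear_def[abs_def]
  by (intro smooth_Pair smooth_add smooth_scaleR smooth_const smooth_compose[OF smooth_F] smooth_fst smooth_snd smooth_id)

lemma snd_has_derivative: "(snd has_derivative snd) (at h)"
  by (rule bounded_linear_imp_has_derivative[OF bounded_linear_snd])

lemma fst_has_derivative: "(fst has_derivative fst) (at h)"
  by (rule bounded_linear_imp_has_derivative[OF bounded_linear_fst])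

lemma F_snd_has_derivative: "((\<lambda>h. F (snd h)) has_derivative (\<lambda>v. DF (snd h) (snd v))) (at h)"
  by (rule has_derivative_compose[OF snd_has_derivative smooth_has_derivative[OF smooth_F]])

lemma shear_field_derivative: "der shear_field h v = (DF (snd h) (snd v), 0)"
proof -
  have "(shear_field has_derivative (\<lambda>v. (DF (snd h) (snd v), 0))) (at h)"
    unfolding shear_field_def[abs_def]
    by (intro has_derivative_Pair F_snd_has_derivative has_derivative_const)
  from fun_cong[OF frechet_derivative_at[OF this], of v] show ?thesis by simp
qed

lemma shear_derivative: "der (shear t) h v = (fst v + t *\<^sub>R DF (snd h) (snd v), snd v)"
proof -
  have "(shear t has_derivative (\<lambda>v. (fst v + t *\<^sub>R DF (snd h) (snd v), snd v))) (at h)"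
    unfolding shear_def[abs_def]
    by (intro has_derivative_Pair has_derivative_add has_derivative_scaleR_right
        fst_has_derivative snd_has_derivative F_snd_has_derivative)
  from fun_cong[OF frechet_derivative_at[OF this], of v] show ?thesis by simp
qed

lemma horizontal_semidirect:
  "horizontal H H1 (Y, z) = {(Ad G z A, L B z) | A B. A \<in> V 1 \<and> B \<in> V 1}"
proof -
  have "horizontal H H1 (Y, z) = {left_inv_field H (A, B) (Y, z) | A B. A \<in> V 1 \<and> B \<in> V 1}"
    unfolding horizontal_def semidirect_strata_def by blast
  then show ?thesis by (simp only: left_inv_field_semidirect)
qed

text \<open>The derivative of the shear field along a horizontal field E is (Ad z C, 0) with C in V
  1, hence horizontal. Conversely, the shear field points along a fibre of the projection to G, over
  which the horizontal space does not vary, so the derivative of E along it is horizontal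
  too.\<close>

lemma precontact_shear_field: "precontact H H1 shear_field"
  unfolding precontact_def
proof (intro conjI allI impI smooth_shear_field)
  fix E :: "'a \<times> 'a \<Rightarrow> 'a \<times> 'a" and p :: "'a \<times> 'a" assume E: "smooth E \<and> (\<forall>p. E p \<in> horizontal H H1 p)"
  obtain Y z where p: "p = (Y, z)" by (cases p)
  obtain A B where AB: "A \<in> V 1" "B \<in> V 1" "E p = (Ad G z A, L B z)"
  proof -
    have "E p \<in> horizontal H H1 (Y, z)" using E p by blast
    then show ?thesis using that unfolding horizontal_semidirect by blast
  qed
  have 1: "der shear_field p (E p) = (Ad G z (twist z B), 0)"
    unfolding shear_field_derivative AB(3) by (simp add: p DF_left_inv_field(2)[OF AB(2)])
  \<comment> \<open>A linear map whose kernel is the horizontal space at every point of the fibre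
    over z.\<close>
  define g where "g q = (proj_1 (Ad G (iv z) (fst q)) - Ad G (iv z) (fst q),
     proj_1 (left_trivialize G z (snd q)) - left_trivialize G z (snd q))" for q
  have ling: "linear g"
    unfolding g_def[abs_def]
    by (rule linearI) (simp_all add: linear_add[OF linear_Ad] linear_add[OF linear_left_trivialize]
      linear_add[OF linear_proj_1] linear_scale[OF linear_Ad] linear_scale[OF linear_left_trivialize]
      linear_scale[OF linear_proj_1] algebra_simps)
  have g_iff: "g q = 0 \<longleftrightarrow> q \<in> horizontal H H1 (Y', z)" for q Y'
  proof
    assume "g q = 0"
    then have "Ad G (iv z) (fst q) \<in> V 1" "left_trivialize G z (snd q) \<in> V 1"
      using proj_1_in_V_1[of "Ad G (iv z) (fst q)"] proj_1_in_V_1[of "left_trivialize G z (snd q)"]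
      by (simp_all add: g_def zero_prod_def)
    moreover have "q = (Ad G z (Ad G (iv z) (fst q)), L (left_trivialize G z (snd q)) z)"
      by simp
    ultimately show "q \<in> horizontal H H1 (Y', z)" unfolding horizontal_semidirect by blast
  next
    assume "q \<in> horizontal H H1 (Y', z)"
    then show "g q = 0"
      unfolding horizontal_semidirect by (auto simp: g_def proj_1_V_1 zero_prod_def)
  qed
  let ?v = "shear_field p"
  have v: "?v = (F z, 0)" by (simp add: shear_field_def p)
  have "((\<lambda>s. g (E (p + s *\<^sub>R ?v))) has_vector_derivative
     der (\<lambda>h. g (E h)) (p + 0 *\<^sub>R ?v) ?v) (at 0)"
    using E by (intro smooth_line smooth_linear[OF ling]) auto
  moreover have "(\<lambda>s. g (E (p + s *\<^sub>R ?v))) = (\<lambda>s. 0)"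
  proof
    fix s
    have "E (Y + s *\<^sub>R F z, z) \<in> horizontal H H1 (Y + s *\<^sub>R F z, z)" using E by blast
    then show "g (E (p + s *\<^sub>R ?v)) = 0" unfolding g_iff[symmetric] by (simp add: shear_field_def p)
  qed
  ultimately have "der (\<lambda>h. g (E h)) p ?v = 0"
    using vector_derivative_unique_at[OF _ has_vector_derivative_const] by fastforce
  moreover have "((\<lambda>h. g (E h)) has_derivative (\<lambda>v. g (der E p v))) (at p)"
    using E by (intro bounded_linear.has_derivative[OF _ smooth_has_derivative])
      (auto simp only: linear_conv_bounded_linear[symmetric] ling)
  from frechet_derivative_at[OF this] have "der (\<lambda>h. g (E h)) p ?v = g (der E p ?v)"
    by metis
  ultimately have "der E p ?v \<in> horizontal H H1 p"
    using g_iff unfolding p by simp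
  then obtain A' B' where A'B': "A' \<in> V 1" "B' \<in> V 1"
    "der E p ?v = (Ad G z A', L B' z)"
    unfolding p horizontal_semidirect by blast
  have "vf_bracket shear_field E p = (Ad G z (A' - twist z B), L B' z)"
    unfolding vf_bracket_def A'B'(3) 1 by (simp add: linear_diff[OF linear_Ad])
  then show "vf_bracket shear_field E p \<in> horizontal H H1 p"
    using subspace_diff[OF V_1_subspace A'B'(1) DF_left_inv_field(1)[OF AB(2)]] A'B'(2)
    unfolding p horizontal_semidirect by blast
qed

lemma integral_curve_shear: "integral_curve shear_field h (\<lambda>t. shear t h)"
proof -
  have "((\<lambda>t. shear t h) has_vector_derivative (0 + 1 *\<^sub>R F (snd h), 0)) (at t)" for t
    unfolding shear_def
    by (intro has_vector_derivative_Pair has_vector_derivative_add has_vector_derivative_const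
        has_vector_derivative_scaleR[OF DERIV_ident has_vector_derivative_const, simplified])
      (auto intro!: derivative_eq_intros)
  then show ?thesis unfolding integral_curve_def by (simp add: shear_def shear_field_def)
qed

text \<open>\<open>vf_Exp\<close> is a definite description, so uniqueness must be supplied: the
  component in G is constant, and the other one is then affine in t.\<close>

lemma integral_curve_unique:
  assumes "integral_curve shear_field h \<gamma>"
  shows "\<gamma> t = shear t h"
proof -
  have \<gamma>: "\<gamma> 0 = h" "\<And>t. (\<gamma> has_vector_derivative (F (snd (\<gamma> t)), 0)) (at t)"
    using assms unfolding integral_curve_def shear_field_def by auto
  have "((\<lambda>t. snd (\<gamma> t)) has_vector_derivative snd (F (snd (\<gamma> t)), 0::'a)) (at t within UNIV)" for t
    using bounded_linear.has_vector_derivative[OF bounded_linear_snd \<gamma>(2)] by simp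
  then obtain c where "\<And>t. snd (\<gamma> t) = c"
    using has_vector_derivative_zero_constant[of UNIV "\<lambda>t. snd (\<gamma> t)"] by auto
  then have snd: "snd (\<gamma> t) = snd h" for t using \<gamma>(1) by metis
  have "((\<lambda>t. fst (\<gamma> t) - t *\<^sub>R F (snd h)) has_vector_derivative fst (F (snd (\<gamma> t)), 0::'a) - F (snd h)) (at t within UNIV)" for t
    using bounded_linear.has_vector_derivative[OF bounded_linear_fst \<gamma>(2)]
    by (intro has_vector_derivative_diff) (auto intro!: derivative_eq_intros)
  then obtain c where "\<And>t. fst (\<gamma> t) - t *\<^sub>R F (snd h) = c"
    using has_vector_derivative_zero_constant[of UNIV "\<lambda>t. fst (\<gamma> t) - t *\<^sub>R F (snd h)"] by (auto simp: snd)
  then have "fst (\<gamma> t) - t *\<^sub>R F (snd h) = fst (\<gamma> 0) - 0 *\<^sub>R F (snd h)" by metis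
  then show ?thesis using snd[of t] \<gamma>(1) by (simp add: shear_def prod_eq_iff algebra_simps)
qed

lemma complete_shear_field: "complete_vf shear_field"
  unfolding complete_vf_def using integral_curve_shear by blast

lemma vf_Exp_shear_field: "vf_Exp t shear_field = shear t"
proof
  fix h
  show "vf_Exp t shear_field h = shear t h"
    unfolding vf_Exp_def
    by (rule the_equality) (use integral_curve_shear integral_curve_unique in blast)+
qed

lemma contact_map_shear: "contact_map H H1 (shear t)"
  unfolding contact_map_def
proof (intro conjI allI smooth_C_k smooth_shear)
  fix p :: "'a \<times> 'a"
  obtain Y z where p: "p = (Y, z)" by (cases p)
  show "der (shear t) p ` horizontal H H1 p \<subseteq> horizontal H H1 (shear t p)"
  proof
    fix q assume "q \<in> der (shear t) p ` horizontal H H1 p"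
    then obtain A B where AB: "A \<in> V 1" "B \<in> V 1"
      "q = der (shear t) p (Ad G z A, L B z)"
      unfolding p horizontal_semidirect by blast
    have "q = (Ad G z (A + t *\<^sub>R twist z B), L B z)"
      unfolding AB(3) shear_derivative p
      by (simp add: DF_left_inv_field(2)[OF AB(2)] linear_add[OF linear_Ad] linear_scale[OF linear_Ad])
    moreover have "A + t *\<^sub>R twist z B \<in> V 1"
      by (intro subspace_add subspace_scale V_1_subspace AB(1) DF_left_inv_field(1) AB(2))
    ultimately show "q \<in> horizontal H H1 (shear t p)"
      unfolding p shear_def fst_conv snd_conv horizontal_semidirect using AB(2) by blast
  qed
qed

lemma homeomorphism_shear: "homeomorphism UNIV UNIV (shear t) (shear (- t))"
  by (rule homeomorphismI) (auto simp: smooth_continuous[OF smooth_shear], simp_all add: shear_def)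

end

section \<open>Failure of quasiconformality\<close>

lemma has_vector_derivative_difference_quotient:
  fixes f :: "real \<Rightarrow> 'a::real_normed_vector"
  assumes "(f has_vector_derivative D) (at 0 within {0..a})" "0 < a"
  shows "((\<lambda>x. (f x - f 0) /\<^sub>R x) \<longlongrightarrow> D) (at_right 0)"
proof -
  have "((\<lambda>y. (1 / norm (y - 0)) *\<^sub>R (f y - (f 0 + (y - 0) *\<^sub>R D))) \<longlongrightarrow> 0) (at_right 0)"
    using assms unfolding has_vector_derivative_def has_derivative_within by (simp add: at_within_Icc_at_right)
  from tendsto_add[OF this tendsto_const[of D]]
  have "((\<lambda>y. (1 / norm (y - 0)) *\<^sub>R (f y - (f 0 + (y - 0) *\<^sub>R D)) + D) \<longlongrightarrow> D) (at_right 0)" by simp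
  moreover have "\<forall>\<^sub>F y in at_right 0.
      (1 / norm (y - 0)) *\<^sub>R (f y - (f 0 + (y - 0) *\<^sub>R D)) + D = (f y - f 0) /\<^sub>R y"
    unfolding eventually_at_right_field
    by (intro exI[of _ 1]) (auto simp: scaleR_diff_right scaleR_add_right divide_inverse)
  ultimately show ?thesis by (rule Lim_transform_eventually)
qed

lemma ennreal_divide_mono:
  fixes a b c d :: ennreal
  assumes "a \<le> b" "d \<le> c"
  shows "a / c \<le> b / d"
proof -
  have "inverse y \<le> inverse x" if "x \<le> y" for x y :: ennreal
    using that
  proof (cases x y rule: ennreal2_cases)
    case (real_real r q)
    then show ?thesis using that by (cases "r = 0") (auto simp: inverse_ennreal intro!: ennreal_leI le_imp_inverse_le)
  qed (auto simp: top_unique)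
  from this[OF assms(2)] show ?thesis unfolding divide_ennreal_def using assms(1) by (intro mult_mono) auto
qed

lemma (in scalar_product) ip_norm_minus: "ip_norm (- X) = ip_norm X"
  using ip_norm_scale[of "- 1" X] by simp

context precontact_field
begin

text \<open>The abelianization of H: on the abelian factor it is \<open>proj_1\<close> itself, which
  is compatible with left translation because Ad does not change \<open>proj_1\<close>.\<close>

lemma semidirect_abelianization:
  obtains \<psi> f where "smooth \<psi>" "\<And>p P. P \<in> H1 \<Longrightarrow> der \<psi> p (left_inv_field H P p) = P"
    "\<And>Y z. \<psi> (Y, z) = (proj_1 Y, f z)"
    "smooth f" "\<And>z B. B \<in> V 1 \<Longrightarrow> der f z (L B z) = B"
proof -
  obtain f where f: "smooth f" "\<And>z A. der f z (L A z) = proj_1 A"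
    using abelianization by blast
  define \<psi> where "\<psi> h = (proj_1 (fst h), f (snd h))" for h :: "'a \<times> 'a"
  have sm: "smooth \<psi>"
    unfolding \<psi>_def[abs_def]
    by (intro smooth_Pair smooth_bounded_linear[OF bounded_linear_proj_1] smooth_compose[OF f(1)] smooth_fst smooth_snd smooth_id)
  have D: "der \<psi> h v = (proj_1 (fst v), der f (snd h) (snd v))" for h v
  proof -
    have "(\<psi> has_derivative (\<lambda>v. (proj_1 (fst v), der f (snd h) (snd v)))) (at h)"
      unfolding \<psi>_def[abs_def]
      by (intro has_derivative_Pair bounded_linear.has_derivative[OF bounded_linear_proj_1] fst_has_derivative
          has_derivative_compose[OF snd_has_derivative smooth_has_derivative[OF f(1)]])
    from fun_cong[OF frechet_derivative_at[OF this], of v] show ?thesis by simp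
  qed
  show ?thesis
  proof (rule that[OF sm _ _ f(1)])
    fix p P :: "'a \<times> 'a" assume P: "P \<in> H1"
    obtain A B Y z where *: "P = (A, B)" "p = (Y, z)" by (cases P; cases p)
    show "der \<psi> p (left_inv_field H P p) = P"
      using P unfolding D * left_inv_field_semidirect H1_iff
      by (simp add: proj_1_Ad f(2) proj_1_V_1)
  qed (simp_all add: \<psi>_def f proj_1_V_1)
qed

lemma sub_riemannian_semidirect:
  assumes "adapted_scalar_product (semidirect_strata V) l ip"
  shows "sub_riemannian H ip H1"
proof -
  interpret scalar_product ip
    using assms unfolding adapted_scalar_product_def by unfold_locales blast+
  show ?thesis
    by unfold_locales (use subspace_Times[OF V_1_subspace V_1_subspace] in \<open>simp add: semidirect_strata_def\<close>)
qed

lemma shear_not_quasiconformal: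
  assumes "adapted_scalar_product (semidirect_strata V) l ip" and t: "t \<noteq> 0"
  shows "\<not> quasiconformal H H1 ip K (shear t)"
proof
  assume qc: "quasiconformal H H1 ip K (shear t)"
  interpret SR: sub_riemannian H ip H1 by (rule sub_riemannian_semidirect[OF assms(1)])
  let ?N = SR.ip_norm and ?d = "cc_dist H H1 ip"
  obtain \<psi> f where \<psi>: "smooth \<psi>" "\<And>p P. P \<in> H1 \<Longrightarrow> der \<psi> p (left_inv_field H P p) = P"
      "\<And>Y z. \<psi> (Y, z) = (proj_1 Y, f z)"
    and f: "smooth f" "\<And>z B. B \<in> V 1 \<Longrightarrow> der f z (L B z) = B"
    using semidirect_abelianization by blast
  have d_ge: "ennreal (?N (\<psi> q - \<psi> p)) \<le> ?d p q" for p q by (rule SR.cc_dist_ge[OF \<psi>(1,2)])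
  obtain z0 B where B: "B \<in> V 1" and C0: "twist z0 B \<noteq> 0" using twist_nonzero by blast
  define A where "A = twist z0 B"
  have A: "A \<in> V 1" "A \<noteq> 0" using DF_left_inv_field(1)[OF B] C0 by (auto simp: A_def)
  have "B \<noteq> 0" using C0 by (auto simp: twist_def linear_0[OF linear_left_inv_field]
        linear_0[OF smooth_linear_derivative[OF smooth_F]] linear_0[OF linear_proj_1])
  have V0: "0 \<in> V 1" by (rule subspace_0[OF V_1_subspace])
  have NA: "0 < ?N (A, 0)" and NB: "0 < ?N (0, B)"
    using A(2) \<open>B \<noteq> 0\<close> by (auto intro!: SR.ip_norm_pos simp: zero_prod_def)
  \<comment> \<open>Strictly larger than K, and positive whatever the sign of K.\<close>
  define K' where "K' = max K 1 + 1"
  \<comment> \<open>Chosen so that |t| c |(A, 0)| exceeds (K' + 1) |(0, B)|; one multiple of |(0,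
    B)| is lost to the triangle inequality.\<close>
  define c where "c = (K' + 1) * ?N (0, B) / (\<bar>t\<bar> * ?N (A, 0)) + 1"
  have c: "0 < c"
    using NA NB by (auto simp: c_def K'_def intro!: add_nonneg_pos divide_nonneg_nonneg mult_nonneg_nonneg)
  \<comment> \<open>The base point is moved by the dilation with factor c, which multiplies the
    twist by c while B stays the same.\<close>
  obtain \<delta> where "twist (\<delta> z0) B = c *\<^sub>R twist z0 B"
    using dilation[OF c] B by metis
  then obtain z where C: "twist z B = c *\<^sub>R A" unfolding A_def by blast
  have big: "K' * ?N (0, B) < ?N (t *\<^sub>R twist z B, B)"
  proof -
    have "(K' + 1) * ?N (0, B) < \<bar>t\<bar> * c * ?N (A, 0)"
    proof -
      have "\<bar>t\<bar> * c * ?N (A, 0) = (K' + 1) * ?N (0, B) + \<bar>t\<bar> * ?N (A, 0)"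
        using t NA by (simp add: c_def field_simps)
      then show ?thesis using t NA by simp
    qed
    also have "\<dots> = ?N ((t * c) *\<^sub>R (A, 0))" using c by (simp add: SR.ip_norm_scale abs_mult del: scaleR_Pair)
    also have "(t * c) *\<^sub>R (A, 0::'a) = (t *\<^sub>R twist z B, B) + (- 1) *\<^sub>R (0, B)" by (simp add: C)
    also have "?N \<dots> \<le> ?N (t *\<^sub>R twist z B, B) + ?N ((- 1) *\<^sub>R (0, B))" by (rule SR.ip_norm_triangle)
    also have "?N ((- 1) *\<^sub>R (0, B)) = ?N (0, B)" using SR.ip_norm_scale[of "- 1" "(0, B)"] by simp
    finally show ?thesis by (simp add: algebra_simps)
  qed
  \<comment> \<open>The shear translates the fibre over z, so by this formula, valid for every Y, it
    preserves these distances; they will bound the infimum in the distortion.\<close>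
  have vertical: "?d (Y + r *\<^sub>R Ad G z A, z) (Y, z) = ennreal (r * ?N (A, 0))" if r: "0 \<le> r" for r Y
  proof (rule antisym)
    have "((\<lambda>s. (Y + swing r s *\<^sub>R Ad G z A, z)) has_vector_derivative
       swing' r s *\<^sub>R left_inv_field H (A, 0) (Y + swing r s *\<^sub>R Ad G z A, z)) (at s)" for s
    proof -
      have "((\<lambda>s. (Y + swing r s *\<^sub>R Ad G z A, z)) has_vector_derivative (0 + swing' r s *\<^sub>R Ad G z A, 0)) (at s)"
      proof (intro has_vector_derivative_Pair has_vector_derivative_add has_vector_derivative_const)
        have "(swing r has_field_derivative swing' r s) (at s)"
          using swing_derivative by (simp add: has_real_derivative_iff_has_vector_derivative)
        from has_vector_derivative_scaleR[OF this has_vector_derivative_const[where c = "Ad G z A"]]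
        show "((\<lambda>s. swing r s *\<^sub>R Ad G z A) has_vector_derivative swing' r s *\<^sub>R Ad G z A) (at s)" by simp
      qed
      then show ?thesis by (simp add: left_inv_field_semidirect linear_0[OF linear_left_inv_field])
    qed
    from SR.cc_dist_le[OF _ r this] show "?d (Y + r *\<^sub>R Ad G z A, z) (Y, z) \<le> ennreal (r * ?N (A, 0))"
      using A(1) V0 by (simp add: H1_iff del: One_nat_def)
    have "\<psi> (Y, z) - \<psi> (Y + r *\<^sub>R Ad G z A, z) = (- r) *\<^sub>R (A, 0)"
      by (simp add: \<psi>(3) linear_add[OF linear_proj_1] linear_scale[OF linear_proj_1] proj_1_Ad proj_1_V_1[OF A(1)])
    then show "ennreal (r * ?N (A, 0)) \<le> ?d (Y + r *\<^sub>R Ad G z A, z) (Y, z)"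
      using d_ge[of "(Y, z)" "(Y + r *\<^sub>R Ad G z A, z)"] r by (simp add: SR.ip_norm_scale SR.ip_norm_minus del: scaleR_Pair)
  qed
  have smB: "smooth (L B)" by (rule smooth_left_inv_field_const)
  obtain a \<gamma> where a: "0 < a" and \<gamma>0: "\<gamma> 0 = z"
    and \<gamma>: "\<And>s. s \<in> {0..a} \<Longrightarrow> (\<gamma> has_vector_derivative L B (\<gamma> s)) (at s within {0..a})"
    using local_integral_curve[OF smB] by blast
  \<comment> \<open>In the abelianization the integral curve is a straight line with velocity B,
    which makes the lower bound for its endpoints sharp.\<close>
  have f\<gamma>: "f (\<gamma> R) = f z + R *\<^sub>R B" if R: "R \<in> {0..a}" for R
  proof -
    have "((\<lambda>s. f (\<gamma> s)) has_vector_derivative B) (at s within {0..R})" if "s \<in> {0..R}" for s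
      using has_vector_derivative_smooth_compose[OF f(1) has_vector_derivative_within_subset[OF \<gamma>, of s "{0..R}"]]
        that R by (simp add: f(2)[OF B])
    then have "((\<lambda>s. B) has_integral f (\<gamma> R) - f (\<gamma> 0)) {0..R}"
      using R by (intro fundamental_theorem_of_calculus) auto
    moreover have "((\<lambda>s. B) has_integral R *\<^sub>R B) {0..R}"
      using has_integral_const_real[of B 0 R] R by simp
    ultimately have "f (\<gamma> R) - f (\<gamma> 0) = R *\<^sub>R B" by (rule has_integral_unique)
    then show ?thesis by (simp add: \<gamma>0 algebra_simps)
  qed
  have horizontal: "?d (0, \<gamma> R) (0, z) = ennreal (R * ?N (0, B))" if R: "R \<in> {0..a}" for R
  proof (rule antisym)
    have R0: "0 \<le> R" using R by simp
    have sw: "swing R s \<in> {0..a}" for s using swing_bounds[OF R0, of s] R by auto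
    have "((\<lambda>s. (0, \<gamma> (swing R s))) has_vector_derivative
       swing' R s *\<^sub>R left_inv_field H (0, B) (0, \<gamma> (swing R s))) (at s)" for s
    proof -
      have "((\<gamma> \<circ> swing R) has_vector_derivative swing' R s *\<^sub>R L B (\<gamma> (swing R s))) (at s)"
        by (rule vector_diff_chain_within[OF swing_derivative has_vector_derivative_within_subset[OF \<gamma>[OF sw]]])
          (use sw in auto)
      from has_vector_derivative_Pair[OF has_vector_derivative_const this]
      show ?thesis by (simp add: o_def left_inv_field_semidirect linear_0[OF linear_Ad])
    qed
    from SR.cc_dist_le[OF _ R0 this] show "?d (0, \<gamma> R) (0, z) \<le> ennreal (R * ?N (0, B))"
      using B V0 by (simp add: H1_iff \<gamma>0 del: One_nat_def)
    have "\<psi> (0, z) - \<psi> (0, \<gamma> R) = (- R) *\<^sub>R (0, B)"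
      by (simp add: \<psi>(3) f\<gamma>[OF R] linear_0[OF linear_proj_1])
    then show "ennreal (R * ?N (0, B)) \<le> ?d (0, \<gamma> R) (0, z)"
      using d_ge[of "(0, z)" "(0, \<gamma> R)"] R by (simp add: SR.ip_norm_scale SR.ip_norm_minus del: scaleR_Pair)
  qed
  \<comment> \<open>Up to the factor -R this is the displacement between the sheared points in the
    abelianization. As R tends to 0 it converges to (t C(z, B), B).\<close>
  define Q where "Q R = (t *\<^sub>R ((proj_1 (F (\<gamma> R)) - proj_1 (F z)) /\<^sub>R R), B)" for R
  have image: "ennreal (R * ?N (Q R)) \<le> ?d (shear t (0, \<gamma> R)) (shear t (0, z))" if R: "R \<in> {0<..a}" for R
  proof -
    have RR: "R * (t * inverse R) = t" using R by simp
    have "\<psi> (shear t (0, z)) - \<psi> (shear t (0, \<gamma> R)) = (- R) *\<^sub>R Q R"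
      using f\<gamma>[of R] R
      by (simp add: RR shear_def \<psi>(3) Q_def linear_scale[OF linear_proj_1] algebra_simps)
    then show ?thesis
      using d_ge[of "shear t (0, z)" "shear t (0, \<gamma> R)"] R by (simp add: SR.ip_norm_scale SR.ip_norm_minus)
  qed
  have "((\<lambda>R. proj_1 (F (\<gamma> R))) has_vector_derivative twist z B) (at 0 within {0..a})"
  proof -
    have "((\<lambda>R. F (\<gamma> R)) has_vector_derivative DF z (L B z)) (at 0 within {0..a})"
      using has_vector_derivative_smooth_compose[OF smooth_F \<gamma>[of 0]] a by (simp add: \<gamma>0)
    from bounded_linear.has_vector_derivative[OF bounded_linear_proj_1 this] show ?thesis by (simp add: twist_def)
  qed
  from has_vector_derivative_difference_quotient[OF this a]
  have "((\<lambda>R. (proj_1 (F (\<gamma> R)) - proj_1 (F z)) /\<^sub>R R) \<longlongrightarrow> twist z B) (at_right 0)"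
    by (simp add: \<gamma>0)
  then have "(Q \<longlongrightarrow> (t *\<^sub>R twist z B, B)) (at_right 0)"
    unfolding Q_def[abs_def] by (intro tendsto_intros)
  moreover have "isCont ?N (t *\<^sub>R twist z B, B)"
    using SR.continuous_ip_norm[OF continuous_on_id, of UNIV] by (simp add: continuous_on_eq_continuous_at)
  ultimately have "((\<lambda>R. ?N (Q R)) \<longlongrightarrow> ?N (t *\<^sub>R twist z B, B)) (at_right 0)"
    by (rule isCont_tendsto_compose[rotated])
  then have "\<forall>\<^sub>F R in at_right 0. K' * ?N (0, B) < ?N (Q R)"
    using big by (rule order_tendstoD(1))
  moreover have "\<forall>\<^sub>F R in at_right 0. R \<in> {0<..a}"
    unfolding eventually_at_right_field using a by (auto intro!: exI[of _ a])
  ultimately have "\<forall>\<^sub>F R in at_right 0. ennreal K' \<le> distortion H H1 ip (shear t) (0, z) (R * ?N (0, B))"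
  proof eventually_elim
    case (elim R)
    define s where "s = R * ?N (0, B)"
    have s: "0 < s" "s = R * ?N (0, B)" using elim NB by (auto simp: s_def)
    let ?X = "{x. ?d x (0, z) = ennreal s}"
    have "(0, \<gamma> R) \<in> ?X" using horizontal[of R] elim by (simp add: s_def)
    then have "?d (shear t (0, \<gamma> R)) (shear t (0, z)) \<le> (SUP x\<in>?X. ?d (shear t x) (shear t (0, z)))"
      by (rule SUP_upper)
    moreover have "ennreal (K' * s) \<le> ennreal (R * ?N (Q R))"
      using elim by (intro ennreal_leI) (simp add: s_def)
    ultimately have sup: "ennreal (K' * s) \<le> (SUP x\<in>?X. ?d (shear t x) (shear t (0, z)))"
      using image[of R] elim by (meson order_trans)
    \<comment> \<open>This puts the vertical test point on the same sphere of radius s as the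
      horizontal one.\<close>
    define r where "r = s / ?N (A, 0)"
    have r: "0 \<le> r" "r * ?N (A, 0) = s" using s NA by (auto simp: r_def)
    have "(r *\<^sub>R Ad G z A, z) \<in> ?X" using vertical[OF r(1), of 0] r(2) by simp
    then have "(INF x\<in>?X. ?d (shear t x) (shear t (0, z))) \<le> ?d (shear t (r *\<^sub>R Ad G z A, z)) (shear t (0, z))"
      by (rule INF_lower)
    also have "\<dots> = ennreal s"
      using vertical[OF r(1), of "t *\<^sub>R F z"] r(2) by (simp add: shear_def add.commute)
    finally have inf: "(INF x\<in>?X. ?d (shear t x) (shear t (0, z))) \<le> ennreal s" .
    have "ennreal K' = ennreal (K' * s) / ennreal s"
      using s(1) by (subst divide_ennreal) (auto simp: K'_def)
    also have "\<dots> \<le> distortion H H1 ip (shear t) (0, z) s"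
      unfolding distortion_def by (rule ennreal_divide_mono[OF sup inf])
    finally show ?case by (simp add: s_def)
  qed
  then obtain b where b: "0 < b" "\<And>R. 0 < R \<Longrightarrow> R < b \<Longrightarrow>
      ennreal K' \<le> distortion H H1 ip (shear t) (0, z) (R * ?N (0, B))"
    unfolding eventually_at_right_field by auto
  have "ennreal K' \<le> distortion H H1 ip (shear t) (0, z) s" if "0 < s" "s < b * ?N (0, B)" for s
    using b(2)[of "s / ?N (0, B)"] that NB by (simp add: field_simps)
  then have "\<forall>\<^sub>F s in at_right 0. ennreal K' \<le> distortion H H1 ip (shear t) (0, z) s"
    unfolding eventually_at_right_field using b(1) NB by (intro exI[of _ "b * ?N (0, B)"]) simp
  then have "ennreal K' \<le> Limsup (at_right 0) (distortion H H1 ip (shear t) (0, z))"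
    by (intro le_Limsup) auto
  also have "\<dots> \<le> ennreal K" using qc unfolding quasiconformal_def by blast
  \<comment> \<open>\<open>ennreal\<close> truncates negative numbers to 0, hence the second
    alternative, which is excluded by K' > 0.\<close>
  finally have "0 \<le> K \<and> K' \<le> K \<or> K' \<le> 0 \<and> K \<le> 0" unfolding ennreal_le_iff2 .
  then show False unfolding K'_def by linarith
qed

end

section \<open>Conclusion for the field of a degree-one element\<close>

lemma carnotI:
  assumes "carnot_group G brk V l"
  shows "carnot G brk V l"
  using assms unfolding carnot_group_def by unfold_locales auto

text \<open>Linearity with both coefficients 0 shows that \<Phi> maps zero to zero; injectivity then
  keeps the image of U nonzero.\<close>

lemma prol_field_iso_degree_1:
  assumes iso: "prol_field_iso G brk V l \<Phi>" and U: "prol brk V l 1 U" "U \<noteq> (\<lambda>_. 0)"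
  shows "precontact G (V 1) (\<Phi> U)" "homogeneous_vf G V l 1 (\<Phi> U)" "\<Phi> U \<noteq> (\<lambda>_. 0)"
proof -
  have "\<Phi> ` {u. prol brk V l 1 u} = {W. precontact G (V 1) W \<and> homogeneous_vf G V l 1 W}"
    using iso unfolding prol_field_iso_def by simp
  then show "precontact G (V 1) (\<Phi> U)" "homogeneous_vf G V l 1 (\<Phi> U)" using U(1) by blast+
  have U_mem: "U \<in> prol_space brk V l" using U(1) by (rule prol_mem_prol_space)
  have zero_mem: "(\<lambda>_. 0) \<in> prol_space brk V l"
    unfolding prol_space_def by (intro CollectI exI[of _ "{}"]) simp
  have "\<forall>a b. \<Phi> (\<lambda>xs. a *\<^sub>R U xs + b *\<^sub>R U xs) = (\<lambda>p. a *\<^sub>R \<Phi> U p + b *\<^sub>R \<Phi> U p)"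
    using iso U_mem unfolding prol_field_iso_def by blast
  from this[rule_format, of 0 0] have "\<Phi> (\<lambda>_. 0) = (\<lambda>_. 0)" by simp
  moreover have "inj_on \<Phi> (prol_space brk V l)"
    using iso unfolding prol_field_iso_def bij_betw_def by blast
  ultimately show "\<Phi> U \<noteq> (\<lambda>_. 0)"
    using U_mem zero_mem U(2) by (metis inj_onD)
qed

theorem mainTheorem2:
  fixes G :: "'a::euclidean_space monoid"
    and brk :: "'a \<Rightarrow> 'a \<Rightarrow> 'a"
    and V :: "nat \<Rightarrow> 'a set"
    and l :: nat
    and X :: "nat \<Rightarrow> 'a"
    and ip :: "'a \<times> 'a \<Rightarrow> 'a \<times> 'a \<Rightarrow> real"
  assumes "carnot_group G brk V l"
    and "adapted_basis V l X"
    and "prol_finite_dim brk V l"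
    and "{u. prol brk V l 1 u} \<noteq> {\<lambda>_. 0}"
    and "adapted_scalar_product (semidirect_strata V) l ip"
  shows "rigid (semidirect_group G) (semidirect_bracket brk) (semidirect_strata V) l \<and>
    (\<forall>\<Phi> U v. prol_field_iso G brk V l \<Phi> \<and> prol brk V l 1 U \<and> U \<noteq> (\<lambda>_. 0) \<and>
        (\<forall>p. \<Phi> U p = (\<Sum>i=1..DIM('a). v i p *\<^sub>R left_inv_field G (X i) p)) \<longrightarrow>
      (let H = semidirect_group G; H1 = semidirect_strata V 1; W = tau_field G X v in
        precontact H H1 W \<and>
        complete_vf W \<and>
        (\<forall>t. contact_map H H1 (vf_Exp t W)) \<and>
        (\<forall>t. \<exists>g. homeomorphism UNIV UNIV (vf_Exp t W) g) \<and>
        (\<forall>t K. t \<noteq> 0 \<and> 1 \<le> K \<longrightarrow> \<not> quasiconformal H H1 ip K (vf_Exp t W))))"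
proof (intro conjI allI impI)
  interpret carnot G brk V l by (rule carnotI[OF assms(1)])
  show "rigid H (semidirect_bracket brk) (semidirect_strata V) l"
    unfolding rigid_def using carnot_group_semidirect prol_finite_dim_semidirect[OF assms(3)] by blast
  fix \<Phi> U v
  assume *: "prol_field_iso G brk V l \<Phi> \<and> prol brk V l 1 U \<and> U \<noteq> (\<lambda>_. 0) \<and>
    (\<forall>p. \<Phi> U p = (\<Sum>i=1..DIM('a). v i p *\<^sub>R left_inv_field G (X i) p))"
  interpret precontact_field G brk V l "\<Phi> U"
    by unfold_locales (use prol_field_iso_degree_1[of G brk V l \<Phi> U] * in auto)
  have tau: "tau_field G X v = shear_field" by (rule tau_field_eq) (use * in blast)
  show "let H = semidirect_group G; H1 = semidirect_strata V 1; W = tau_field G X v in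
      precontact H H1 W \<and>
      complete_vf W \<and>
      (\<forall>t. contact_map H H1 (vf_Exp t W)) \<and>
      (\<forall>t. \<exists>g. homeomorphism UNIV UNIV (vf_Exp t W) g) \<and>
      (\<forall>t K. t \<noteq> 0 \<and> 1 \<le> K \<longrightarrow> \<not> quasiconformal H H1 ip K (vf_Exp t W))"
    unfolding Let_def tau vf_Exp_shear_field
    using precontact_shear_field complete_shear_field contact_map_shear homeomorphism_shear
      shear_not_quasiconformal[OF assms(5)] by blast
qed

end
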